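(* Let $m\geqslant 7$ be an integer with $m\equiv 0 \pmod 8$ (respectively $m\equiv 1,2,7 \pmod 8$), and let $\delta_0=m-4$ (respectively $\delta_0=m-5,\ m-6,\ m-3$). Then $$\lim_{n\rightarrow \infty}\frac{\sharp\{f\in{\mathbb F}_{2^n}[x] \mid \deg(f)=m,\ \delta^2(f)=\delta_0\}}{\sharp\{f\in{\mathbb F}_{2^n}[x] \mid \deg(f)=m\}}=1.$$
   Context: For $q=2^n$, $f\in\mathbb{F}_q[x]$ and $\alpha,\alpha'\in\mathbb{F}_q$, the second order derivative is $D^2_{\alpha,\alpha'}f(x)=f(x)+f(x+\alpha)+f(x+\alpha')+f(x+\alpha+\alpha')$. The second order differential uniformity of $f$ over $\mathbb{F}_q$ is $$\delta^2(f)=\max_{\alpha,\alpha'\in\mathbb{F}_q^{\ast},\ \alpha\neq\alpha',\ \beta\in\mathbb{F}_q}\sharp\{x\in\mathbb{F}_q\mid D^2_{\alpha,\alpha'}f(x)=\beta\}.$$ *)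

theory Defs
  imports "HOL-Algebra.Polynomials" Complex_Main
begin

definition second_deriv :: "('a, 'b) ring_scheme \<Rightarrow> 'a \<Rightarrow> 'a \<Rightarrow> 'a list \<Rightarrow> 'a \<Rightarrow> 'a" where
  "second_deriv R \<alpha> \<alpha>' f x =
     ring.eval R f x \<oplus>\<^bsub>R\<^esub> ring.eval R f (x \<oplus>\<^bsub>R\<^esub> \<alpha>) \<oplus>\<^bsub>R\<^esub> ring.eval R f (x \<oplus>\<^bsub>R\<^esub> \<alpha>')
       \<oplus>\<^bsub>R\<^esub> ring.eval R f (x \<oplus>\<^bsub>R\<^esub> \<alpha> \<oplus>\<^bsub>R\<^esub> \<alpha>')"

text \<open>Over the field with two elements there are no distinct nonzero \<open>\<alpha>\<close>, \<open>\<alpha>'\<close>, so the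
  maximum below is taken over the empty set and its value is unspecified.\<close>

definition second_diff_uniformity :: "('a, 'b) ring_scheme \<Rightarrow> 'a list \<Rightarrow> nat" where
  "second_diff_uniformity R f =
     Max {card {x \<in> carrier R. second_deriv R \<alpha> \<alpha>' f x = \<beta>} | \<alpha> \<alpha>' \<beta>.
            \<alpha> \<in> carrier R - {\<zero>\<^bsub>R\<^esub>} \<and> \<alpha>' \<in> carrier R - {\<zero>\<^bsub>R\<^esub>} \<and> \<alpha> \<noteq> \<alpha>' \<and> \<beta> \<in> carrier R}"

text \<open>Polynomials are the normalised coefficient lists (leading coefficient first) of
  \<open>HOL-Algebra\<close>; there the zero polynomial has degree \<open>0\<close>, so for \<open>m > 0\<close> this is the set of
  polynomials of exact degree \<open>m\<close>.\<close>

definition polys_of_degree :: "('a, 'b) ring_scheme \<Rightarrow> nat \<Rightarrow> 'a list set" where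
  "polys_of_degree R m = {f \<in> carrier (univ_poly R (carrier R)). degree f = m}"

end

theory Submission
  imports Defs "HOL-Algebra.Algebraic_Closure_Type" "HOL-Library.Z2"
begin

text \<open>
  Let \<open>d\<close> be the odd number with \<open>4 d + 3 \<le> m \<le> 4 d + 6\<close> and write
  \<open>f = P(u) + x B(u)\<close> with \<open>u = x\<^sup>2 + x\<close>. For \<open>a = \<tau>\<^sup>2 + \<tau>\<close> the second derivative of \<open>f\<close> in
  directions \<open>1, \<tau>\<close> is \<open>B(u) + B(u + a)\<close>, which is a polynomial of degree \<open>d\<close> in
  \<open>v = u\<^sup>2 + a u\<close>, provided that the coefficient of \<open>x\<^bsup>4d+3\<^esup>\<close> in \<open>f\<close> is nonzero. Scaling \<open>x\<close> reduces all
  directions to this case, so the uniformity is at most \<open>4 d\<close>, with equality as soon as for some \<open>a\<close>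
  this polynomial is a product of distinct linear factors \<open>v + z\<close> with every \<open>z\<close> a value of \<open>v\<close>.

  Instead of Chebotarev's theorem, a second moment over \<open>a\<close> shows that such an \<open>a\<close> exists for almost
  all \<open>f\<close>. The events for different \<open>a\<close> are not independent, but a nontrivial additive character
  of the space of \<open>B\<close> that is seen by the event for \<open>a\<close> determines \<open>a\<close> up to \<open>d\<close> choices, once the
  few coefficients of \<open>B\<close> that are visible for all \<open>a\<close> have been fixed. What remains is that the event
  for a single \<open>a\<close> keeps positive probability after fixing them: \<open>h = d div 4\<close> conditions are
  prescribed on the elementary symmetric functions \<open>e\<^sub>2, e\<^sub>4, \<dots>, e\<^bsub>2h\<^esub>\<close> of the \<open>d\<close> roots. Splitting off
  \<open>2 h\<close> of the roots makes these conditions linear and triangular, and a second moment over the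
  remaining roots applies.
\<close>

section \<open>Finite subfields and their real characters\<close>

text \<open>The residues of \<open>m\<close> modulo 8 enter through the parity of \<open>d\<close>.
  For odd \<open>d\<close> the binomials \<open>2d+2 choose 2d\<close>,
  \<open>2d+2 choose 2d+1\<close> and \<open>2d+3 choose 2d\<close> are even. This identifies the
  coefficient of \<open>x^(4d+3)\<close> in \<open>f\<close> with that of \<open>u^(2d+1)\<close> in
  \<open>B\<close>, and it keeps \<open>B(u) + B(u + a)\<close> at degree \<open>2d\<close> in
  \<open>u\<close> although \<open>B\<close> may have degree \<open>2d+2\<close>. The obstacle to
  independence is that \<open>B(u) + B(u + a)\<close> does not see the powers
  \<open>(u^2 + a u)^i\<close>, so the event for \<open>a\<close> is a union of cosets of their
  span. A linear form annihilating one of these powers satisfies a polynomial equation in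
  \<open>a\<close> of degree at most \<open>i\<close>, hence the \<open>d\<close> choices. All these
  equations can be void only if the form lives on exponents that occur in no such power; up to
  \<open>2d\<close> these can only be \<open>2d+1-4l\<close> with \<open>1 <= l <= d div 4\<close>,
  hence \<open>h\<close>. In \<open>(16 d)^d\<close> the 16 arises because the roots are drawn from
  two halves with at least \<open>q/16\<close> elements each, and the \<open>d\<close> from
  \<open>n choose k >= (n/k)^k\<close>. One \<open>a\<close> succeeds with probability at least
  \<open>1/(4 (16 d)^d)\<close>, and there are about \<open>q/2\<close> of them, so the exceptional
  proportion is \<open>O(1/q)\<close>.\<close>

lemma sum_squared_le_card_mult:
  fixes f :: "'i \<Rightarrow> real"
  shows "(sum f A)\<^sup>2 \<le> real (card A) * (\<Sum>i\<in>A. (f i)\<^sup>2)"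
proof -
  have "0 \<le> (\<Sum>i\<in>A. \<Sum>j\<in>A. (f i - f j)\<^sup>2)" by (intro sum_nonneg) auto
  also have "\<dots> = 2 * (real (card A) * (\<Sum>i\<in>A. (f i)\<^sup>2) - (sum f A)\<^sup>2)"
    by (simp add: power2_diff sum.distrib sum_subtractf power2_eq_square sum_product
        sum_distrib_left algebra_simps)
  finally show ?thesis by simp
qed

text \<open>A subset of a field type rather than a type: the fields of all orders \<open>2^n\<close>
  are realised inside one algebraic closure, so that type-based polynomials can be used with
  coefficients confined to \<open>K\<close>.\<close>

locale finite_subfield =
  fixes K :: "'k::field set"
  assumes finite_K: "finite K"
    and zero_K [simp]: "0 \<in> K"
    and one_K [simp]: "1 \<in> K"
    and add_K: "x \<in> K \<Longrightarrow> y \<in> K \<Longrightarrow> x + y \<in> K"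
    and minus_K: "x \<in> K \<Longrightarrow> - x \<in> K"
    and mult_K: "x \<in> K \<Longrightarrow> y \<in> K \<Longrightarrow> x * y \<in> K"
    and inverse_K: "x \<in> K \<Longrightarrow> inverse x \<in> K"
begin

lemma diff_K: "x \<in> K \<Longrightarrow> y \<in> K \<Longrightarrow> x - y \<in> K"
  using add_K[of x "- y"] minus_K by simp

lemma divide_K: "x \<in> K \<Longrightarrow> y \<in> K \<Longrightarrow> x / y \<in> K"
  by (simp add: divide_inverse mult_K inverse_K)

lemma power_K: "x \<in> K \<Longrightarrow> x ^ n \<in> K"
  by (induction n) (auto intro: mult_K)

lemma sum_K: "(\<And>i. i \<in> A \<Longrightarrow> f i \<in> K) \<Longrightarrow> sum f A \<in> K"
  by (induction A rule: infinite_finite_induct) (auto intro: add_K)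

lemma prod_K: "(\<And>i. i \<in> A \<Longrightarrow> f i \<in> K) \<Longrightarrow> prod f A \<in> K"
  by (induction A rule: infinite_finite_induct) (auto intro: mult_K)

lemma of_nat_K: "of_nat n \<in> K"
  by (induction n) (auto intro: add_K)

lemmas K_intros = add_K minus_K mult_K inverse_K diff_K divide_K power_K sum_K prod_K of_nat_K

lemma card_K_ge_2: "card K \<ge> 2"
proof -
  have "card {0, 1 :: 'k} \<le> card K"
    by (rule card_mono) (auto simp: finite_K)
  thus ?thesis by simp
qed

lemma translate_K: "e \<in> K \<Longrightarrow> bij_betw (\<lambda>x. x + e) K K"
  by (rule bij_betwI[where g = "\<lambda>x. x - e"]) (auto intro: K_intros)

lemma scale_K: "e \<in> K \<Longrightarrow> e \<noteq> 0 \<Longrightarrow> bij_betw (\<lambda>x. x * e) K K"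
  by (rule bij_betwI[where g = "\<lambda>x. x / e"]) (auto intro: K_intros)

end

text \<open>Values 1 and -1 suffice for an additive group of exponent two and keep the Fourier
  analysis free of conjugation.\<close>

locale real_character = finite_subfield K for K :: "'k::field set" +
  fixes \<psi> :: "'k \<Rightarrow> real"
  assumes \<psi>_cases: "x \<in> K \<Longrightarrow> \<psi> x = 1 \<or> \<psi> x = -1"
    and \<psi>_add: "x \<in> K \<Longrightarrow> y \<in> K \<Longrightarrow> \<psi> (x + y) = \<psi> x * \<psi> y"
    and \<psi>_nontrivial: "\<exists>e\<in>K. \<psi> e = -1"
begin

lemma \<psi>_zero: "\<psi> 0 = 1"
  using \<psi>_add[of 0 0] \<psi>_cases[of 0] by auto

lemma \<psi>_diff: "x \<in> K \<Longrightarrow> y \<in> K \<Longrightarrow> \<psi> (x - y) = \<psi> x * \<psi> y"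
  using \<psi>_add[of "x - y" y] \<psi>_cases[of y] by (auto simp: diff_K)

text \<open>Multiplication by a nonzero \<open>x\<close> permutes \<open>K\<close>, and translation
  by some \<open>e\<close> with \<open>\<psi> e = -1\<close> negates the resulting sum.\<close>

lemma sum_\<psi>:
  assumes "x \<in> K"
  shows "(\<Sum>c\<in>K. \<psi> (c * x)) = (if x = 0 then real (card K) else 0)"
proof (cases "x = 0")
  case False
  obtain e where e: "e \<in> K" "\<psi> e = -1" using \<psi>_nontrivial by blast
  have "(\<Sum>c\<in>K. \<psi> (c * x)) = (\<Sum>c\<in>K. \<psi> c)"
    by (rule sum.reindex_bij_betw[OF scale_K[OF assms False]])
  moreover have "(\<Sum>c\<in>K. \<psi> c) = (\<Sum>c\<in>K. \<psi> (c + e))"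
    by (rule sum.reindex_bij_betw[OF translate_K[OF e(1)], symmetric])
  moreover have "(\<Sum>c\<in>K. \<psi> (c + e)) = (\<Sum>c\<in>K. - \<psi> c)"
    using e(2) by (intro sum.cong refl) (simp only: \<psi>_add[OF _ e(1)] mult_minus_right mult_1_right)
  ultimately have "(\<Sum>c\<in>K. \<psi> (c * x)) = 0" unfolding sum_negf by linarith
  thus ?thesis using False by simp
qed (simp add: \<psi>_zero)

section \<open>Characters of vectors over \<open>K\<close> and a second moment sieve\<close>

text \<open>The character attached to a dual vector \<open>c\<close>. The product form lets a sum
  over all \<open>c\<close> split by coordinates; \<open>\<chi>_eq_\<psi>\<close> recovers the inner
  product.\<close>

definition \<chi> :: "'i set \<Rightarrow> ('i \<Rightarrow> 'k) \<Rightarrow> ('i \<Rightarrow> 'k) \<Rightarrow> real" where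
  "\<chi> S c x = (\<Prod>j\<in>S. \<psi> (c j * x j))"

abbreviation vecs :: "'i set \<Rightarrow> ('i \<Rightarrow> 'k) set" where
  "vecs S \<equiv> PiE S (\<lambda>_. K)"

lemma \<chi>_eq_\<psi>:
  assumes "finite S" "\<And>j. j \<in> S \<Longrightarrow> c j \<in> K" "\<And>j. j \<in> S \<Longrightarrow> x j \<in> K"
  shows "\<chi> S c x = \<psi> (\<Sum>j\<in>S. c j * x j)"
  using assms
proof (induction S rule: finite_induct)
  case (insert j S)
  have "\<psi> (c j * x j + (\<Sum>j\<in>S. c j * x j)) = \<psi> (c j * x j) * \<psi> (\<Sum>j\<in>S. c j * x j)"
    by (intro \<psi>_add mult_K sum_K) (use insert.prems in auto)
  thus ?case using insert by (simp add: \<chi>_def)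
qed (simp add: \<chi>_def \<psi>_zero)

lemma \<chi>_orthogonal:
  assumes "finite S" "x \<in> vecs S" "y \<in> vecs S"
  shows "(\<Sum>c\<in>vecs S. \<chi> S c x * \<chi> S c y) = (if x = y then real (card (vecs S)) else 0)"
proof -
  have "(\<Sum>c\<in>vecs S. \<chi> S c x * \<chi> S c y) = (\<Sum>c\<in>vecs S. \<Prod>j\<in>S. \<psi> (c j * (x j - y j)))"
    unfolding \<chi>_def prod.distrib [symmetric] right_diff_distrib
    by (intro sum.cong prod.cong refl \<psi>_diff [symmetric] mult_K) (use assms in auto)
  also have "\<dots> = (\<Prod>j\<in>S. \<Sum>c\<in>K. \<psi> (c * (x j - y j)))"
    using prod_sum_PiE[of S "\<lambda>_. K" "\<lambda>j c. \<psi> (c * (x j - y j))"] assms finite_K by simp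
  also have "\<dots> = (\<Prod>j\<in>S. if x j = y j then real (card K) else 0)"
  proof (intro prod.cong refl)
    fix j assume "j \<in> S"
    hence "x j - y j \<in> K" using assms by (intro diff_K) auto
    thus "(\<Sum>c\<in>K. \<psi> (c * (x j - y j))) = (if x j = y j then real (card K) else 0)"
      by (simp only: sum_\<psi> right_minus_eq)
  qed
  also have "\<dots> = (if x = y then real (card (vecs S)) else 0)"
  proof (cases "x = y")
    case False
    then obtain j where "j \<in> S" "x j \<noteq> y j" using assms by (meson PiE_ext)
    thus ?thesis using assms False by auto
  qed (use assms in \<open>simp add: card_PiE\<close>)
  finally show ?thesis .
qed

lemma finite_vecs: "finite S \<Longrightarrow> finite (vecs S)"
  by (simp add: finite_PiE finite_K)

lemma parseval:
  assumes "finite S"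
  shows "(\<Sum>c\<in>vecs S. (\<Sum>x\<in>vecs S. g x * \<chi> S c x)\<^sup>2) = real (card (vecs S)) * (\<Sum>x\<in>vecs S. (g x)\<^sup>2)"
proof -
  have "(\<Sum>c\<in>vecs S. (\<Sum>x\<in>vecs S. g x * \<chi> S c x)\<^sup>2)
      = (\<Sum>c\<in>vecs S. \<Sum>x\<in>vecs S. \<Sum>y\<in>vecs S. g x * g y * (\<chi> S c x * \<chi> S c y))"
    by (simp add: power2_eq_square sum_product algebra_simps)
  also have "\<dots> = (\<Sum>x\<in>vecs S. \<Sum>y\<in>vecs S. g x * g y * (\<Sum>c\<in>vecs S. \<chi> S c x * \<chi> S c y))"
    by (subst sum.swap, rule sum.cong[OF refl], subst sum.swap) (simp add: sum_distrib_left)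
  also have "\<dots> = (\<Sum>x\<in>vecs S. \<Sum>y\<in>vecs S. if x = y then g x * g x * real (card (vecs S)) else 0)"
    by (intro sum.cong refl) (simp add: \<chi>_orthogonal assms)
  also have "\<dots> = (\<Sum>x\<in>vecs S. g x * g x * real (card (vecs S)))"
    using finite_vecs[OF assms] by (simp add: sum.delta)
  finally show ?thesis by (simp add: power2_eq_square sum_distrib_left mult.commute)
qed

text \<open>Translation by \<open>s\<close> permutes \<open>A\<close> and multiplies each summand by
  -1. Closure in one direction is enough: an injective map of a finite set into itself is
  onto.\<close>

lemma sum_\<chi>_invariant:
  assumes S: "finite S" and A: "A \<subseteq> vecs S" and c: "c \<in> vecs S" and s: "s \<in> vecs S"
    and shift: "\<And>x. x \<in> A \<Longrightarrow> (\<lambda>j\<in>S. x j + s j) \<in> A" and neg: "\<chi> S c s = -1"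
  shows "(\<Sum>x\<in>A. \<chi> S c x) = 0"
proof -
  let ?t = "\<lambda>x. (\<lambda>j\<in>S. x j + s j)"
  have finA: "finite A" using A finite_vecs[OF S] finite_subset by blast
  have inj: "inj_on ?t A"
  proof (rule inj_onI)
    fix x y assume xy: "x \<in> A" "y \<in> A" "?t x = ?t y"
    have "x j = y j" if "j \<in> S" for j
      using fun_cong[OF xy(3), of j] that by simp
    thus "x = y" using xy A by (meson PiE_ext subsetD)
  qed
  have "?t ` A = A"
    by (rule card_subset_eq[OF finA]) (use shift inj in \<open>auto simp: card_image\<close>)
  hence bij: "bij_betw ?t A A" using inj by (simp add: bij_betw_def)
  have "(\<Sum>x\<in>A. \<chi> S c x) = (\<Sum>x\<in>A. \<chi> S c (?t x))"
    by (rule sum.reindex_bij_betw[OF bij, symmetric])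
  also have "\<dots> = (\<Sum>x\<in>A. - \<chi> S c x)"
  proof (rule sum.cong[OF refl])
    fix x assume "x \<in> A"
    hence x: "x \<in> vecs S" using A by blast
    have "\<chi> S c (?t x) = \<chi> S c x * \<chi> S c s"
      unfolding \<chi>_def prod.distrib [symmetric]
    proof (intro prod.cong refl)
      fix j assume j: "j \<in> S"
      have "c j \<in> K" "x j \<in> K" "s j \<in> K" using x c s j by auto
      thus "\<psi> (c j * (\<lambda>j\<in>S. x j + s j) j) = \<psi> (c j * x j) * \<psi> (c j * s j)"
        using j by (simp add: \<psi>_add distrib_left mult_K)
    qed
    thus "\<chi> S c (?t x) = - \<chi> S c x" using neg by simp
  qed
  finally show ?thesis by (simp add: sum_negf)
qed

text \<open>The Fourier transform of a union \<open>A a\<close> of cosets of a subgroup is supported on the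
  annihilator of that subgroup. So if every nontrivial character annihilates few of these
  subgroups, the centred indicator functions of the sets \<open>A a\<close> are nearly orthogonal on average,
  even when no two of them are independent.\<close>

lemma card_avoiding_le:
  assumes S: "finite S" and I: "finite I" and A: "\<And>a. a \<in> I \<Longrightarrow> A a \<subseteq> vecs S"
    and few: "\<And>c. c \<in> vecs S \<Longrightarrow> (\<exists>j\<in>S. c j \<noteq> 0) \<Longrightarrow>
      card {a \<in> I. (\<Sum>x\<in>A a. \<chi> S c x) \<noteq> 0} \<le> J"
  shows "card {x \<in> vecs S. \<forall>a\<in>I. x \<notin> A a} * (\<Sum>a\<in>I. card (A a)) \<le> J * (card (vecs S))\<^sup>2"
proof -
  define V where "V = vecs S"
  define g where "g a x = (if x \<in> A a then 1 else 0 :: real)" for a x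
  define N where "N x = (\<Sum>a\<in>I. g a x)" for x
  define T where "T = (\<Sum>a\<in>I. real (card (A a)))"
  define F where "F a c = (\<Sum>x\<in>V. g a x * \<chi> S c x)" for a c
  define v where "v = real (card V)"
  have finV: "finite V" unfolding V_def by (rule finite_vecs[OF S])
  have F_eq: "F a c = (\<Sum>x\<in>A a. \<chi> S c x)" if "a \<in> I" for a c
  proof -
    have "F a c = (\<Sum>x\<in>V. if x \<in> A a then \<chi> S c x else 0)"
      unfolding F_def g_def by (intro sum.cong) auto
    also have "\<dots> = (\<Sum>x\<in>V \<inter> A a. \<chi> S c x)" by (rule sum.inter_restrict[symmetric, OF finV])
    also have "V \<inter> A a = A a" using A[OF that] by (auto simp: V_def)
    finally show ?thesis .
  qed
  have g_sum: "(\<Sum>x\<in>V. g a x) = real (card (A a))" if "a \<in> I" for a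
  proof -
    have "(\<Sum>x\<in>V. g a x) = (\<Sum>x\<in>V \<inter> A a. 1)" unfolding g_def
      by (rule sum.inter_restrict[symmetric, OF finV])
    also have "V \<inter> A a = A a" using A[OF that] by (auto simp: V_def)
    finally show ?thesis by simp
  qed
  have N_hat: "(\<Sum>x\<in>V. N x * \<chi> S c x) = (\<Sum>a\<in>I. F a c)" for c
    unfolding N_def F_def sum_distrib_right by (rule sum.swap)
  have N_sum: "(\<Sum>x\<in>V. N x) = T"
    unfolding N_def T_def by (subst sum.swap) (simp add: g_sum)
  define o0 where "o0 = (\<lambda>j\<in>S. (0::'k))"
  have o0: "o0 \<in> V" by (simp add: o0_def V_def)
  have \<chi>_o0: "\<chi> S o0 x = 1" for x by (simp add: \<chi>_def o0_def \<psi>_zero)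
  have hat_o0: "(\<Sum>a\<in>I. F a o0) = T"
    using N_hat[of o0] N_sum by (simp add: \<chi>_o0)
  \<comment> \<open>Away from the trivial character \<open>o0\<close> at most \<open>J\<close>
    summands are nonzero, so Cauchy-Schwarz costs a factor \<open>J\<close> instead of
    \<open>card I\<close>.\<close>
  have 1: "(\<Sum>a\<in>I. F a c)\<^sup>2 \<le> real J * (\<Sum>a\<in>I. (F a c)\<^sup>2)" if c: "c \<in> V - {o0}" for c
  proof -
    let ?I = "{a \<in> I. F a c \<noteq> 0}"
    have "\<exists>j\<in>S. c j \<noteq> 0"
    proof (rule ccontr)
      assume "\<not> ?thesis"
      hence "c = o0" using c o0 unfolding V_def by (intro PiE_ext[of c S]) (auto simp: o0_def)
      thus False using c by auto
    qed
    moreover have "?I = {a \<in> I. (\<Sum>x\<in>A a. \<chi> S c x) \<noteq> 0}" by (auto simp: F_eq)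
    ultimately have J: "card ?I \<le> J" using few[of c] c by (simp add: V_def)
    have "(\<Sum>a\<in>I. F a c) = (\<Sum>a\<in>?I. F a c)" by (rule sum.mono_neutral_right) (use I in auto)
    hence "(\<Sum>a\<in>I. F a c)\<^sup>2 \<le> real (card ?I) * (\<Sum>a\<in>?I. (F a c)\<^sup>2)"
      using sum_squared_le_card_mult[of "\<lambda>a. F a c" ?I] by simp
    also have "\<dots> \<le> real J * (\<Sum>a\<in>I. (F a c)\<^sup>2)"
      by (intro mult_mono of_nat_mono sum_mono2 J) (use I in \<open>auto intro: sum_nonneg\<close>)
    finally show ?thesis .
  qed
  have 2: "(\<Sum>c\<in>V. (F a c)\<^sup>2) = v * real (card (A a))" if "a \<in> I" for a
  proof -
    have "(\<Sum>c\<in>V. (F a c)\<^sup>2) = v * (\<Sum>x\<in>V. (g a x)\<^sup>2)"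
      unfolding F_def v_def V_def by (rule parseval[OF S])
    also have "(\<Sum>x\<in>V. (g a x)\<^sup>2) = (\<Sum>x\<in>V. g a x)" by (intro sum.cong) (auto simp: g_def)
    finally show ?thesis by (simp add: g_sum that)
  qed
  have "v * (\<Sum>x\<in>V. (N x)\<^sup>2) = (\<Sum>c\<in>V. (\<Sum>x\<in>V. N x * \<chi> S c x)\<^sup>2)"
    unfolding v_def V_def by (rule parseval[OF S, symmetric])
  also have "\<dots> = T\<^sup>2 + (\<Sum>c\<in>V - {o0}. (\<Sum>a\<in>I. F a c)\<^sup>2)"
    by (simp add: N_hat sum.remove[OF finV o0] hat_o0)
  also have "(\<Sum>c\<in>V - {o0}. (\<Sum>a\<in>I. F a c)\<^sup>2) \<le> (\<Sum>c\<in>V - {o0}. real J * (\<Sum>a\<in>I. (F a c)\<^sup>2))"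
    by (rule sum_mono) (rule 1)
  also have "\<dots> \<le> (\<Sum>c\<in>V. real J * (\<Sum>a\<in>I. (F a c)\<^sup>2))"
    by (rule sum_mono2) (use finV in \<open>auto intro!: mult_nonneg_nonneg sum_nonneg\<close>)
  also have "\<dots> = real J * (\<Sum>a\<in>I. \<Sum>c\<in>V. (F a c)\<^sup>2)"
    unfolding sum_distrib_left[symmetric] by (subst sum.swap) simp
  also have "\<dots> = real J * v * T" by (simp add: 2 T_def sum_distrib_left mult_ac)
  finally have 3: "v * (\<Sum>x\<in>V. (N x)\<^sup>2) \<le> T\<^sup>2 + real J * v * T" by simp
  let ?B = "{x \<in> V. \<forall>a\<in>I. x \<notin> A a}"
  \<comment> \<open>Chebyshev: \<open>T / v\<close> is the mean of \<open>N\<close>, and a vector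
    that avoids every \<open>A a\<close> has \<open>N x = 0\<close>, so it contributes the full
    \<open>T^2\<close>.\<close>
  have "real (card ?B) * T\<^sup>2 = (\<Sum>x\<in>?B. (v * N x - T)\<^sup>2)"
    by (simp add: N_def g_def)
  also have "\<dots> \<le> (\<Sum>x\<in>V. (v * N x - T)\<^sup>2)"
    by (rule sum_mono2) (use finV in auto)
  also have "\<dots> = v * (v * (\<Sum>x\<in>V. (N x)\<^sup>2)) - 2 * v * T * (\<Sum>x\<in>V. N x) + v * T\<^sup>2"
    by (simp add: power2_diff power_mult_distrib sum.distrib sum_subtractf sum_distrib_left
        sum_distrib_right v_def power2_eq_square algebra_simps)
  also have "\<dots> \<le> v * (T\<^sup>2 + real J * v * T) - 2 * v * T * T + v * T\<^sup>2"
    using mult_left_mono[OF 3, of v] N_sum by (simp add: v_def)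
  also have "\<dots> = real J * v\<^sup>2 * T" by (simp add: power2_eq_square algebra_simps)
  finally have 4: "real (card ?B) * T * T \<le> real J * v\<^sup>2 * T" by (simp add: power2_eq_square mult_ac)
  have T0: "T \<ge> 0" unfolding T_def by (rule sum_nonneg) simp
  have "real (card ?B) * T \<le> real J * v\<^sup>2"
  proof (cases "T = 0")
    case False
    thus ?thesis using 4 T0 by simp
  qed simp
  hence "real (card ?B * (\<Sum>a\<in>I. card (A a))) \<le> real (J * (card V)\<^sup>2)"
    by (simp add: T_def v_def)
  thus ?thesis unfolding V_def by (simp only: of_nat_le_iff)
qed

end

section \<open>Subsets with prescribed symmetric functions\<close>

context finite_subfield
begin

text \<open>Coordinates in \<open>P\<close> are forced by earlier ones and all others are free, so
  one more coordinate multiplies the number of solutions by 1 or by \<open>card K\<close>.\<close>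

lemma card_triangular:
  fixes P :: "nat set"
  assumes closed: "\<And>p w. p \<in> P \<Longrightarrow> (\<And>i. i < p \<Longrightarrow> w i \<in> K) \<Longrightarrow> \<phi> p w \<in> K"
    and dep: "\<And>p w w'. p \<in> P \<Longrightarrow> (\<And>i. i < p \<Longrightarrow> w i = w' i) \<Longrightarrow> \<phi> p w = \<phi> p w'"
  shows "card {w \<in> PiE {..<N} (\<lambda>_. K). \<forall>p\<in>P. p < N \<longrightarrow> w p = \<phi> p w} = card K ^ card ({..<N} - P)"
proof (induction N)
  case 0
  have "{w \<in> PiE {..<0::nat} (\<lambda>_. K). \<forall>p\<in>P. p < 0 \<longrightarrow> w p = \<phi> p w} = {\<lambda>_. undefined}"
    by auto
  thus ?case by simp
next
  case (Suc N)
  define sol where "sol N = {w \<in> PiE {..<N} (\<lambda>_. K). \<forall>p\<in>P. p < N \<longrightarrow> w p = \<phi> p w}" for N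
  define T where "T w = (if N \<in> P then {\<phi> N w} else K)" for w
  have bij: "bij_betw (\<lambda>w. (restrict w {..<N}, w N)) (sol (Suc N)) (SIGMA w:sol N. T w)"
  proof (rule bij_betwI[where g = "\<lambda>(w, x). w(N := x)"])
    show "(\<lambda>w. (restrict w {..<N}, w N)) \<in> sol (Suc N) \<rightarrow> (SIGMA w:sol N. T w)"
    proof (intro funcsetI SigmaI)
      fix w assume w: "w \<in> sol (Suc N)"
      have eq: "\<phi> p (restrict w {..<N}) = \<phi> p w" if "p \<in> P" "p \<le> N" for p
        by (rule dep) (use that in auto)
      show "restrict w {..<N} \<in> sol N" using w by (auto simp: sol_def eq)
      show "w N \<in> T (restrict w {..<N})" using w by (auto simp: sol_def T_def eq)
    qed
    show "(\<lambda>(w, x). w(N := x)) \<in> (SIGMA w:sol N. T w) \<rightarrow> sol (Suc N)"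
    proof (rule funcsetI, clarify)
      fix w x assume w: "w \<in> sol N" and x: "x \<in> T w"
      have eq: "\<phi> p (w(N := x)) = \<phi> p w" if "p \<in> P" "p \<le> N" for p
        by (rule dep) (use that in auto)
      have "\<phi> N w \<in> K" if "N \<in> P"
        by (rule closed) (use that w in \<open>auto simp: sol_def\<close>)
      hence "x \<in> K" using x by (auto simp: T_def split: if_splits)
      hence "w(N := x) \<in> PiE {..<Suc N} (\<lambda>_. K)"
        using w by (auto simp: sol_def PiE_iff extensional_def less_Suc_eq)
      moreover have "(w(N := x)) p = \<phi> p (w(N := x))" if "p \<in> P" "p < Suc N" for p
        using that w x eq[of p] by (cases "p = N") (auto simp: sol_def T_def)
      ultimately show "w(N := x) \<in> sol (Suc N)" by (auto simp: sol_def)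
    qed
    show "(\<lambda>(w, x). w(N := x)) (restrict w {..<N}, w N) = w" if "w \<in> sol (Suc N)" for w
    proof
      fix i show "(\<lambda>(w, x). w(N := x)) (restrict w {..<N}, w N) i = w i"
        using that by (auto simp: sol_def PiE_iff extensional_def)
    qed
    show "(\<lambda>w. (restrict w {..<N}, w N)) ((\<lambda>(w, x). w(N := x)) wx) = wx"
      if wx_in: "wx \<in> (SIGMA w:sol N. T w)" for wx
    proof -
      from wx_in obtain w x where wx: "wx = (w, x)" "w \<in> sol N" by auto
      have "restrict (w(N := x)) {..<N} = w"
        using wx by (intro ext) (auto simp: sol_def PiE_iff extensional_def)
      thus ?thesis using wx by simp
    qed
  qed
  have fin: "finite (sol N)" by (simp add: sol_def finite_PiE finite_K)
  have "card (sol (Suc N)) = card (SIGMA w:sol N. T w)" by (rule bij_betw_same_card[OF bij])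
  also have "\<dots> = (\<Sum>w\<in>sol N. card (T w))"
    using fin finite_K by (intro card_SigmaI) (auto simp: T_def)
  also have "\<dots> = card (sol N) * (if N \<in> P then 1 else card K)"
    by (simp add: T_def)
  also have "card (sol N) = card K ^ card ({..<N} - P)" using Suc by (simp add: sol_def)
  also have "card K ^ card ({..<N} - P) * (if N \<in> P then 1 else card K) = card K ^ card ({..<Suc N} - P)"
  proof (cases "N \<in> P")
    case False
    hence "{..<Suc N} - P = insert N ({..<N} - P)" by auto
    thus ?thesis using False by simp
  qed (simp add: lessThan_Suc insert_Diff_if)
  finally show ?case unfolding sol_def .
qed

end

section \<open>Triangular systems of conditions and their common solutions\<close>

text \<open>Data of the conditions \<open>sum_{i <= 2l} lam l i * e_i = z l\<close> on elementary
  symmetric functions. The unit coefficient at \<open>i = 2 * l\<close> lets condition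
  \<open>l\<close> determine \<open>e_(2l)\<close> from its predecessors.\<close>

locale triangular_conditions = finite_subfield K for K :: "'k::field set" +
  fixes h :: nat and lam :: "nat \<Rightarrow> nat \<Rightarrow> 'k" and z :: "nat \<Rightarrow> 'k"
  assumes lam_K: "lam l i \<in> K" and z_K: "z l \<in> K"
    and lam_lead: "l \<in> {1..h} \<Longrightarrow> lam l (2 * l) = 1"
begin

text \<open>For \<open>w = esym Y\<close> and \<open>G = esym Z\<close> with disjoint
  \<open>Y\<close>, \<open>Z\<close>, this is the coefficient of \<open>w a\<close> in condition
  \<open>l\<close> for the union, by the convolution formula \<open>esym_Un\<close>.\<close>

definition \<rho> :: "(nat \<Rightarrow> 'k) \<Rightarrow> nat \<Rightarrow> nat \<Rightarrow> 'k" where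
  "\<rho> G l a = (\<Sum>i\<in>{a..2 * l}. lam l i * G (i - a))"

text \<open>A vector \<open>w\<close> stands for the symmetric functions of the unknown part
  \<open>Y\<close>. Indices stop at \<open>2 * h\<close> because no condition looks further, and
  \<open>w 0 = 1\<close> mirrors \<open>esym_0\<close>.\<close>

definition Sol :: "(nat \<Rightarrow> 'k) \<Rightarrow> (nat \<Rightarrow> 'k) set" where
  "Sol G = {w \<in> PiE {..<2 * h + 1} (\<lambda>_. K). w 0 = 1 \<and>
     (\<forall>l\<in>{1..h}. (\<Sum>a\<le>2 * l. w a * \<rho> G l a) = z l)}"

lemma finite_Sol: "finite (Sol G)"
  by (simp add: Sol_def finite_PiE finite_K)

lemma \<rho>_K: "(\<And>i. G i \<in> K) \<Longrightarrow> \<rho> G l a \<in> K"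
  by (auto simp: \<rho>_def intro!: K_intros lam_K)

lemma \<rho>_lead: "l \<in> {1..h} \<Longrightarrow> G 0 = 1 \<Longrightarrow> \<rho> G l (2 * l) = 1"
  by (simp add: \<rho>_def lam_lead)

lemma sum_atMost_split_last: "(\<Sum>a\<le>n. f a) = (\<Sum>a<n. f a) + (f n :: 'k)" for n :: nat
  by (simp add: lessThan_Suc_atMost [symmetric])

text \<open>For even \<open>p > 0\<close>, condition \<open>p div 2\<close> solved for its last
  unknown \<open>w p\<close>; index 0 carries the normalisation.\<close>

definition even_pivot :: "(nat \<Rightarrow> 'k) \<Rightarrow> nat \<Rightarrow> (nat \<Rightarrow> 'k) \<Rightarrow> 'k" where
  "even_pivot G p w = (if p = 0 then 1 else z (p div 2) - (\<Sum>a<p. w a * \<rho> G (p div 2) a))"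

lemma even_pivot_K: "(\<And>i. G i \<in> K) \<Longrightarrow> (\<And>i. i < p \<Longrightarrow> w i \<in> K) \<Longrightarrow> even_pivot G p w \<in> K"
  by (auto simp: even_pivot_def intro!: K_intros \<rho>_K z_K)

lemma even_pivot_cong: "(\<And>i. i < p \<Longrightarrow> w i = w' i) \<Longrightarrow> even_pivot G p w = even_pivot G p w'"
  by (auto simp: even_pivot_def intro!: sum.cong)

lemma Sol_eq:
  assumes "G 0 = 1"
  shows "Sol G = {w \<in> PiE {..<2 * h + 1} (\<lambda>_. K). \<forall>p\<in>{p. even p}. p < 2 * h + 1 \<longrightarrow> w p = even_pivot G p w}"
proof -
  have iff: "(\<Sum>a\<le>2 * l. w a * \<rho> G l a) = z l \<longleftrightarrow> w (2 * l) = even_pivot G (2 * l) w"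
    if "l \<in> {1..h}" for w l
    using that \<rho>_lead[OF that, of G] assms
    by (simp add: sum_atMost_split_last even_pivot_def eq_diff_eq add.commute)
  have "(w 0 = 1 \<and> (\<forall>l\<in>{1..h}. (\<Sum>a\<le>2 * l. w a * \<rho> G l a) = z l)) \<longleftrightarrow>
      (\<forall>p\<in>{p. even p}. p < 2 * h + 1 \<longrightarrow> w p = even_pivot G p w)" (is "?L \<longleftrightarrow> ?R") for w
  proof
    assume L: ?L
    show ?R
    proof (intro ballI impI)
      fix p assume p: "p \<in> {p. even p}" "p < 2 * h + 1"
      then obtain l where l: "p = 2 * l" by (auto elim: evenE)
      show "w p = even_pivot G p w"
        using L p l iff[of l w] by (cases "l = 0") (auto simp: even_pivot_def)
    qed
  next
    assume R: ?R
    have "w 0 = 1" using R by (auto simp: even_pivot_def dest: bspec[of _ _ 0])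
    moreover have "w (2 * l) = even_pivot G (2 * l) w" if "l \<in> {1..h}" for l
      using R that by (auto dest: bspec[of _ _ "2 * l"])
    ultimately show ?L using iff by auto
  qed
  thus ?thesis by (auto simp: Sol_def)
qed

text \<open>All even indices are pivots, which leaves the \<open>h\<close> odd indices below
  \<open>2 * h + 1\<close> free.\<close>

lemma card_Sol:
  assumes "G 0 = 1" "\<And>i. G i \<in> K"
  shows "card (Sol G) = card K ^ h"
proof -
  have "{..<2 * h + 1} - {p. even p} = (\<lambda>l. 2 * l + 1) ` {..<h}"
  proof (intro equalityI subsetI)
    fix p assume p: "p \<in> {..<2 * h + 1} - {p. even p}"
    then obtain l where "p = 2 * l + 1" by (auto elim: oddE)
    thus "p \<in> (\<lambda>l. 2 * l + 1) ` {..<h}" using p by auto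
  qed auto
  moreover have "inj_on (\<lambda>l. 2 * l + 1) {..<h}" by (auto intro: inj_onI)
  ultimately have "card ({..<2 * h + 1} - {p. even p}) = h" by (simp add: card_image)
  moreover have "card (Sol G) = card K ^ card ({..<2 * h + 1} - {p. even p})"
    unfolding Sol_eq[of G, OF assms(1)]
    by (rule card_triangular) (use assms in \<open>auto intro!: even_pivot_K even_pivot_cong\<close>)
  ultimately show ?thesis by simp
qed

text \<open>Subtracting the \<open>l\<close>-th equations for \<open>G\<close> and \<open>G'\<close> shifts the pivot from the even index \<open>2 * l\<close>
  to \<open>2 * l - s\<close>, where \<open>s\<close> is the first index at which \<open>G\<close> and \<open>G'\<close> differ. If \<open>s\<close> is odd, this is a
  new pivot; if \<open>s\<close> is even, the equation \<open>l = s div 2\<close> becomes contradictory.\<close>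

lemma card_Sol_inter_le:
  assumes G: "G 0 = 1" "\<And>i. G i \<in> K" and G': "G' 0 = 1" "\<And>i. G' i \<in> K"
    and t: "t < h" and agree: "\<And>i. i \<le> 2 * t \<Longrightarrow> G i = G' i"
    and differ: "G (2 * t + 1) \<noteq> G' (2 * t + 1) \<or> G (2 * t + 2) \<noteq> G' (2 * t + 2)"
  shows "card (Sol G \<inter> Sol G') \<le> card K ^ t"
proof -
  define D where "D l a = \<rho> G l a - \<rho> G' l a" for l a
  have D_eq: "D l a = (\<Sum>i\<in>{a..2 * l}. lam l i * (G (i - a) - G' (i - a)))" for l a
    by (simp add: D_def \<rho>_def sum_subtractf algebra_simps)
  have D_0: "D l a = 0" if "\<And>i. i < s \<Longrightarrow> G i = G' i" "2 * l < a + s" for l a s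
    unfolding D_eq by (rule sum.neutral) (use that in auto)
  have D_lead: "D l (2 * l - s) = G s - G' s"
    if "\<And>i. i < s \<Longrightarrow> G i = G' i" "s \<le> 2 * l" "l \<in> {1..h}" for l s
  proof -
    have "D l (2 * l - s) = (\<Sum>i\<in>{2 * l}. lam l i * (G (i - (2 * l - s)) - G' (i - (2 * l - s))))"
      unfolding D_eq by (rule sum.mono_neutral_right) (use that in auto)
    thus ?thesis using that by (simp add: lam_lead)
  qed
  have D_sum: "(\<Sum>a\<le>2 * l. w a * D l a) = 0" if "w \<in> Sol G \<inter> Sol G'" "l \<in> {1..h}" for w l
    using that by (auto simp: D_def Sol_def algebra_simps sum_subtractf)
  show ?thesis
  proof (cases "G (2 * t + 1) = G' (2 * t + 1)")
    case True
    have agree': "G i = G' i" if "i < 2 * (t + 1)" for i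
      using True agree[of i] that by (cases "i \<le> 2 * t") (auto simp: not_le le_Suc_eq less_Suc_eq)
    \<comment> \<open>Here the first disagreement is at the even index \<open>2 * t + 2\<close>. In
      the difference of the two equations for \<open>l = t + 1\<close> only the term
      \<open>a = 0\<close> survives, and it is nonzero since \<open>w 0 = 1\<close>.\<close>
    have "Sol G \<inter> Sol G' = {}"
    proof (rule ccontr)
      assume "Sol G \<inter> Sol G' \<noteq> {}"
      then obtain w where w: "w \<in> Sol G \<inter> Sol G'" by blast
      have "(\<Sum>a\<le>2 * (t + 1). w a * D (t + 1) a) = (\<Sum>a\<in>{0}. w a * D (t + 1) a)"
        by (rule sum.mono_neutral_right) (use D_0[of "2 * (t + 1)" "t + 1"] agree' in auto)
      moreover have "w 0 = 1" using w by (simp add: Sol_def)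
      ultimately have "D (t + 1) 0 = 0" using D_sum[OF w, of "t + 1"] t by simp
      thus False using D_lead[of "2 * (t + 1)" "t + 1"] agree' differ True t by simp
    qed
    thus ?thesis by simp
  next
    case False
    define s where "s = 2 * t + 1"
    define \<delta> where "\<delta> = G s - G' s"
    have \<delta>: "\<delta> \<noteq> 0" "\<delta> \<in> K" using False G G' by (auto simp: \<delta>_def s_def intro: diff_K)
    have agree': "G i = G' i" if "i < s" for i using agree that by (simp add: s_def)
    \<comment> \<open>The new pivots \<open>2 * l - s\<close> for \<open>l = t + 1, ..., h\<close>
      are the first \<open>h - t\<close> odd numbers; together with the even pivots they leave
      \<open>t\<close> free indices.\<close>
    define odds where "odds = (\<lambda>i. 2 * i + 1) ` {..<h - t}"
    define P where "P = {p. even p} \<union> odds"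
    define \<phi> where "\<phi> p w = (if even p then even_pivot G p w
      else - (\<Sum>a<p. w a * D ((p + s) div 2) a) / \<delta>)" for p w
    have D_K: "D l a \<in> K" for l a using \<rho>_K G G' by (auto simp: D_def intro: diff_K)
    have sub: "Sol G \<inter> Sol G' \<subseteq> {w \<in> PiE {..<2 * h + 1} (\<lambda>_. K). \<forall>p\<in>P. p < 2 * h + 1 \<longrightarrow> w p = \<phi> p w}"
    proof (rule subsetI)
      fix w assume w: "w \<in> Sol G \<inter> Sol G'"
      have "w p = \<phi> p w" if "p \<in> P" "p < 2 * h + 1" for p
      proof (cases "even p")
        case True
        thus ?thesis using w that unfolding Sol_eq[of G, OF G(1)] by (auto simp: \<phi>_def)
      next
        case False
        with \<open>p \<in> P\<close> obtain i where i: "p = 2 * i + 1" "i < h - t" by (auto simp: P_def odds_def)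
        define l where "l = i + t + 1"
        have l: "l \<in> {1..h}" "p = 2 * l - s" "(p + s) div 2 = l" "s \<le> 2 * l"
          using i by (auto simp: l_def s_def)
        have "0 = (\<Sum>a\<le>2 * l. w a * D l a)" using D_sum[OF w l(1)] by simp
        also have "\<dots> = (\<Sum>a\<le>p. w a * D l a)"
          by (rule sum.mono_neutral_right) (use D_0[of s l] agree' l in auto)
        also have "\<dots> = (\<Sum>a<p. w a * D l a) + w p * \<delta>"
          using D_lead[of s l] agree' l by (simp add: sum_atMost_split_last \<delta>_def)
        finally have "w p * \<delta> = - (\<Sum>a<p. w a * D l a)" by (simp add: eq_neg_iff_add_eq_0 add.commute)
        thus ?thesis using False l(3) \<delta>(1) by (simp add: \<phi>_def field_simps)
      qed
      thus "w \<in> {w \<in> PiE {..<2 * h + 1} (\<lambda>_. K). \<forall>p\<in>P. p < 2 * h + 1 \<longrightarrow> w p = \<phi> p w}"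
        using w by (auto simp: Sol_def)
    qed
    have "{..<2 * h + 1} - P = (\<lambda>i. 2 * i + 1) ` {h - t..<h}"
    proof (intro equalityI subsetI)
      fix p assume p: "p \<in> {..<2 * h + 1} - P"
      then obtain i where "p = 2 * i + 1" by (auto simp: P_def elim: oddE)
      thus "p \<in> (\<lambda>i. 2 * i + 1) ` {h - t..<h}"
        using p by (cases "i < h - t") (auto simp: P_def odds_def)
    qed (auto simp: P_def odds_def)
    moreover have "inj_on (\<lambda>i. 2 * i + 1) {h - t..<h}" by (auto intro: inj_onI)
    ultimately have "card ({..<2 * h + 1} - P) = t" using t by (simp add: card_image)
    hence "card {w \<in> PiE {..<2 * h + 1} (\<lambda>_. K). \<forall>p\<in>P. p < 2 * h + 1 \<longrightarrow> w p = \<phi> p w} = card K ^ t"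
      by (subst card_triangular)
         (use \<delta> D_K G even_pivot_K[of G] in
          \<open>auto simp: \<phi>_def intro!: K_intros even_pivot_cong sum.cong\<close>)
    thus ?thesis
      using card_mono[OF _ sub] by (simp add: finite_PiE finite_K)
  qed
qed

end

section \<open>Elementary symmetric functions of finite sets\<close>

text \<open>The generating product of the factors \<open>1 + z X\<close> turns disjoint unions into
  products of polynomials, without signs.\<close>

definition esym :: "'k::field set \<Rightarrow> nat \<Rightarrow> 'k" where
  "esym Y i = coeff (\<Prod>z\<in>Y. [:1, z:]) i"

lemma esym_0: "esym Y 0 = 1"
  by (simp add: esym_def poly_0_coeff_0 [symmetric] poly_prod)

lemma esym_Un:
  assumes "finite Y" "finite Z" "Y \<inter> Z = {}"
  shows "esym (Y \<union> Z) i = (\<Sum>a\<le>i. esym Y a * esym Z (i - a))"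
  using assms by (simp add: esym_def prod.union_disjoint coeff_mult)

lemma degree_prod_linear: "finite Y \<Longrightarrow> Polynomial.degree (\<Prod>z\<in>Y. [:z, 1 :: 'k::field:]) = card Y"
  by (subst degree_prod_sum_eq) auto

text \<open>\<open>[:1, z:]\<close> is the reversal of \<open>[:z, 1:]\<close>, and reversal is
  multiplicative.\<close>

lemma esym_eq_coeff:
  assumes "finite Y" "i \<le> card Y"
  shows "esym Y i = coeff (\<Prod>z\<in>Y. [:z, 1:]) (card Y - i)"
proof -
  have "reflect_poly [:z, 1:] = [:1, z:]" for z :: 'a
    by (rule poly_eqI) (auto simp: coeff_reflect_poly coeff_pCons split: nat.split)
  hence "(\<Prod>z\<in>Y. [:1, z:]) = reflect_poly (\<Prod>z\<in>Y. [:z, 1:])"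
    by (simp add: reflect_poly_prod)
  thus ?thesis using assms by (simp add: esym_def coeff_reflect_poly degree_prod_linear)
qed

lemma prod_linear_inject:
  fixes Y Z :: "'k::field set"
  assumes "finite Y" "finite Z" "(\<Prod>z\<in>Y. [:z, 1:]) = (\<Prod>z\<in>Z. [:z, 1:])"
  shows "Y = Z"
proof -
  have roots: "poly (\<Prod>z\<in>A. [:z, 1:]) (- x) = 0 \<longleftrightarrow> x \<in> A" if "finite A" for A and x :: 'k
    using that by (auto simp: poly_prod)
  show ?thesis using roots[OF assms(1)] roots[OF assms(2)] assms(3) by auto
qed

lemma esym_inject:
  assumes "finite Y" "finite Z" "card Y = n" "card Z = n" "\<And>i. i \<le> n \<Longrightarrow> esym Y i = esym Z i"
  shows "Y = Z"
proof -
  have "coeff (\<Prod>z\<in>Y. [:z, 1:]) i = coeff (\<Prod>z\<in>Z. [:z, 1:]) i" for i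
  proof (cases "i \<le> n")
    case True
    thus ?thesis
      using esym_eq_coeff[OF assms(1), of "n - i"] esym_eq_coeff[OF assms(2), of "n - i"] assms
      by simp
  next
    case False
    thus ?thesis using assms by (simp add: coeff_eq_0 degree_prod_linear)
  qed
  thus ?thesis by (intro prod_linear_inject assms poly_eqI)
qed

context finite_subfield
begin

lemma coeff_prod_K: "(\<And>j i. j \<in> A \<Longrightarrow> coeff (p j) i \<in> K) \<Longrightarrow> coeff (prod p A) i \<in> K"
proof (induction A arbitrary: i rule: infinite_finite_induct)
  case (insert j A)
  thus ?case by (auto simp: coeff_mult intro!: sum_K mult_K)
qed auto

lemma esym_K: "Y \<subseteq> K \<Longrightarrow> esym Y i \<in> K"
  unfolding esym_def by (rule coeff_prod_K) (auto simp: coeff_pCons split: nat.split)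

text \<open>A set of size \<open>B\<close> is determined by \<open>e_0, ..., e_B\<close>; fixing
  those up to \<open>2 * t\<close> leaves at most \<open>B - 2 * t\<close> free values in
  \<open>K\<close>.\<close>

lemma card_esym_agree_le:
  assumes U: "U \<subseteq> K"
  shows "card {Z'. Z' \<subseteq> U \<and> card Z' = B \<and> (\<forall>i\<le>2 * t. esym Z' i = g i)} \<le> card K ^ (B - 2 * t)"
proof -
  let ?A = "{Z'. Z' \<subseteq> U \<and> card Z' = B \<and> (\<forall>i\<le>2 * t. esym Z' i = g i)}"
  let ?f = "\<lambda>Z'. restrict (esym Z') {2 * t<..B}"
  have fin: "finite Z'" if "Z' \<in> ?A" for Z'
    using that U finite_K finite_subset[of Z' K] by auto
  have "inj_on ?f ?A"
  proof (rule inj_onI)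
    fix Y Z assume A: "Y \<in> ?A" "Z \<in> ?A" and eq: "?f Y = ?f Z"
    have "esym Y i = esym Z i" if "i \<le> B" for i
    proof (cases "i \<le> 2 * t")
      case False
      thus ?thesis using fun_cong[OF eq, of i] that by simp
    qed (use A in auto)
    thus "Y = Z" using esym_inject[of Y Z B] fin[OF A(1)] fin[OF A(2)] A by auto
  qed
  moreover have "?f ` ?A \<subseteq> PiE {2 * t<..B} (\<lambda>_. K)"
  proof (intro image_subsetI)
    fix Z' assume "Z' \<in> ?A"
    hence "Z' \<subseteq> K" using U by blast
    thus "?f Z' \<in> PiE {2 * t<..B} (\<lambda>_. K)" by (simp add: esym_K)
  qed
  ultimately have "card ?A \<le> card (PiE {2 * t<..B} (\<lambda>_. K))"
    by (intro card_inj_on_le) (auto simp: finite_PiE finite_K)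
  thus ?thesis by (simp add: card_PiE)
qed

end

section \<open>Root sets that satisfy the conditions\<close>

context triangular_conditions
begin

definition conds :: "'k set \<Rightarrow> bool" where
  "conds Y \<longleftrightarrow> (\<forall>l\<in>{1..h}. (\<Sum>i\<le>2 * l. lam l i * esym Y i) = z l)"

text \<open>Exchanging the two summations of the convolution collects the coefficient of each
  \<open>esym Y a\<close>, so for fixed \<open>Z\<close> the conditions become the linear system
  \<open>Sol (esym Z)\<close> for \<open>Y\<close>.\<close>

lemma conds_Un:
  assumes fin: "finite Y" "finite Z" and disj: "Y \<inter> Z = {}" and Y: "Y \<subseteq> K"
    and Sol: "restrict (esym Y) {..<2 * h + 1} \<in> Sol (esym Z)"
  shows "conds (Y \<union> Z)"
  unfolding conds_def
proof
  fix l assume l: "l \<in> {1..h}"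
  have "(\<Sum>i\<le>2 * l. lam l i * esym (Y \<union> Z) i)
      = (\<Sum>i\<le>2 * l. \<Sum>a\<le>i. lam l i * (esym Y a * esym Z (i - a)))"
    by (simp add: esym_Un assms sum_distrib_left)
  also have "\<dots> = (\<Sum>a\<le>2 * l. \<Sum>i\<in>{a..2 * l}. lam l i * (esym Y a * esym Z (i - a)))"
    unfolding sum.Sigma[OF finite_atMost] 
    by (subst (1 2) sum.Sigma) (auto intro!: sum.reindex_bij_witness[of _ "\<lambda>(a, i). (i, a)" "\<lambda>(i, a). (a, i)"])
  also have "\<dots> = (\<Sum>a\<le>2 * l. restrict (esym Y) {..<2 * h + 1} a * \<rho> (esym Z) l a)"
    using l by (intro sum.cong refl) (auto simp: \<rho>_def sum_distrib_left mult_ac)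
  also have "\<dots> = z l" using Sol l by (simp add: Sol_def)
  finally show "(\<Sum>i\<le>2 * l. lam l i * esym (Y \<union> Z) i) = z l" .
qed

text \<open>The vectors \<open>esym Y\<close> have positive density among all vectors \<open>w\<close>, so it is enough to control
  the number of \<open>Z\<close> with \<open>w \<in> Sol (esym Z)\<close> for most \<open>w\<close>. This linearises the unknown \<open>Y\<close>.\<close>

lemma sum_card_Sol_deviation_le:
  fixes B :: nat and U :: "'k set"
  defines "\<Z> \<equiv> {Z. Z \<subseteq> U \<and> card Z = B}"
  assumes U: "U \<subseteq> K" and B: "2 * h \<le> B"
  shows "(\<Sum>w\<in>{w \<in> PiE {..<2 * h + 1} (\<lambda>_. K). w 0 = 1}.
      (real (card {Z \<in> \<Z>. w \<in> Sol (esym Z)}) - real (card \<Z>) / real (card K) ^ h)\<^sup>2)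
    \<le> real (card \<Z> * h) * real (card K) ^ B / real (card K)"
proof -
  define W where "W = {w \<in> PiE {..<2 * h + 1} (\<lambda>_. K). w 0 = 1}"
  define N where "N w = card {Z \<in> \<Z>. w \<in> Sol (esym Z)}" for w
  define q where "q = card K"
  define avg where "avg = real (card \<Z>) / real q ^ h"
  have q: "q \<ge> 2" using card_K_ge_2 by (simp add: q_def)
  have fin_\<Z>: "finite \<Z>" unfolding \<Z>_def
    by (rule finite_subset[of _ "Pow U"]) (use U finite_K finite_subset in auto)
  have fin_W: "finite W" by (simp add: W_def finite_PiE finite_K)
  have Sol_W: "Sol G \<subseteq> W" for G by (auto simp: Sol_def W_def)
  have \<Z>: "esym Z 0 = 1" "\<And>i. esym Z i \<in> K" if "Z \<in> \<Z>" for Z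
    using that U by (auto simp: esym_0 \<Z>_def intro!: esym_K)
  have card_W: "card W = q ^ (2 * h)"
  proof -
    have "W = {w \<in> PiE {..<2 * h + 1} (\<lambda>_. K). \<forall>p\<in>{0}. p < 2 * h + 1 \<longrightarrow> w p = 1}"
      by (auto simp: W_def)
    also have "card \<dots> = card K ^ card ({..<2 * h + 1} - {0})"
      by (rule card_triangular) auto
    finally show ?thesis by (simp add: q_def)
  qed
  have count: "(\<Sum>w\<in>W. if P w then 1 else 0 :: real) = real (card {w \<in> W. P w})" for P
    using fin_W by (simp add: sum.inter_filter [symmetric])
  have N_eq: "real (N w) = (\<Sum>Z\<in>\<Z>. if w \<in> Sol (esym Z) then 1 else 0)" for w
    using fin_\<Z> by (simp add: N_def sum.inter_filter [symmetric])
  have sum_N: "(\<Sum>w\<in>W. real (N w)) = real (card \<Z>) * real q ^ h"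
  proof -
    have "(\<Sum>w\<in>W. real (N w)) = (\<Sum>Z\<in>\<Z>. \<Sum>w\<in>W. if w \<in> Sol (esym Z) then 1 else 0)"
      unfolding N_eq by (rule sum.swap)
    also have "\<dots> = (\<Sum>Z\<in>\<Z>. real (card (Sol (esym Z))))"
      unfolding count using Sol_W by (intro sum.cong refl arg_cong[where f = "\<lambda>x. real (card x)"]) auto
    also have "\<dots> = (\<Sum>Z\<in>\<Z>. real q ^ h)"
      by (intro sum.cong refl) (simp add: card_Sol \<Z> q_def)
    finally show ?thesis by simp
  qed
  define agree where "agree t Z Z' \<longleftrightarrow> (\<forall>i\<le>2 * t. esym Z i = esym Z' i)" for t and Z Z' :: "'k set"
  \<comment> \<open>With \<open>t\<close> the last level of agreement, \<open>q^t\<close> bounds the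
    intersection. The 1 pays for \<open>t = 0\<close>, the size expected of independent systems; the
    sum pays for the rare pairs that agree longer.\<close>
  have pair: "real (card (Sol (esym Z) \<inter> Sol (esym Z')))
      \<le> 1 + (\<Sum>t\<in>{1..h}. if agree t Z Z' then real q ^ t else 0)" if Z: "Z \<in> \<Z>" "Z' \<in> \<Z>" for Z Z'
  proof -
    define t where "t = Max {t. t \<le> h \<and> agree t Z Z'}"
    have fin: "finite {t. t \<le> h \<and> agree t Z Z'}" by simp
    have ne: "0 \<in> {t. t \<le> h \<and> agree t Z Z'}" by (auto simp: agree_def esym_0)
    have t: "t \<le> h" "agree t Z Z'" using Max_in[OF fin] ne unfolding t_def by blast+
    have max: "\<not> agree (Suc t) Z Z'" if "t < h"
      using Max_ge[OF fin, of "Suc t"] that unfolding t_def[symmetric] by auto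
    have "card (Sol (esym Z) \<inter> Sol (esym Z')) \<le> q ^ t"
    proof (cases "t < h")
      case True
      have "esym Z (2 * t + 1) \<noteq> esym Z' (2 * t + 1) \<or> esym Z (2 * t + 2) \<noteq> esym Z' (2 * t + 2)"
      proof (rule ccontr)
        assume "\<not> ?thesis"
        hence "agree (Suc t) Z Z'" using t(2) by (auto simp: agree_def le_Suc_eq)
        thus False using max[OF True] by simp
      qed
      thus ?thesis unfolding q_def
        by (intro card_Sol_inter_le \<Z> True Z) (use t in \<open>auto simp: agree_def\<close>)
    next
      case False
      hence "t = h" using t by simp
      thus ?thesis using card_Sol[of "esym Z"] \<Z>[OF Z(1)] card_mono[of "Sol (esym Z)" "Sol (esym Z) \<inter> Sol (esym Z')"]
        by (simp add: q_def finite_Sol)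
    qed
    hence "real (card (Sol (esym Z) \<inter> Sol (esym Z'))) \<le> real q ^ t"
      by (metis of_nat_le_iff of_nat_power)
    also have "\<dots> \<le> 1 + (\<Sum>t\<in>{1..h}. if agree t Z Z' then real q ^ t else 0)"
    proof (cases "t = 0")
      case True
      thus ?thesis by (simp add: sum_nonneg)
    next
      case False
      have "real q ^ t = (\<Sum>t\<in>{t}. if agree t Z Z' then real q ^ t else 0)" using t by simp
      also have "\<dots> \<le> (\<Sum>t\<in>{1..h}. if agree t Z Z' then real q ^ t else 0)"
        by (rule sum_mono2) (use t False in auto)
      finally show ?thesis by simp
    qed
    finally show ?thesis .
  qed
  \<comment> \<open>At most \<open>q^(B - 2t)\<close> sets \<open>Z'\<close> agree this far and each
    costs \<open>q^t\<close>; as \<open>t \<ge> 1\<close>, a factor \<open>q\<close> is saved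
    against \<open>q^B\<close>.\<close>
  have agree_count: "(\<Sum>Z'\<in>\<Z>. if agree t Z Z' then real q ^ t else 0) \<le> real q ^ B / real q"
    if "Z \<in> \<Z>" "t \<in> {1..h}" for Z t
  proof -
    have "(\<Sum>Z'\<in>\<Z>. if agree t Z Z' then real q ^ t else 0) = real (card {Z' \<in> \<Z>. agree t Z Z'}) * real q ^ t"
      using fin_\<Z> by (simp add: sum.inter_filter [symmetric])
    also have "{Z' \<in> \<Z>. agree t Z Z'} = {Z'. Z' \<subseteq> U \<and> card Z' = B \<and> (\<forall>i\<le>2 * t. esym Z' i = esym Z i)}"
      by (auto simp: \<Z>_def agree_def)
    also have "real (card \<dots>) \<le> real (q ^ (B - 2 * t))"
      unfolding of_nat_le_iff q_def
      by (rule card_esym_agree_le[OF U])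
    also have "real (q ^ (B - 2 * t)) * real q ^ t = real q ^ (B - t)"
      using that B by (simp add: power_add [symmetric])
    also have "\<dots> \<le> real q ^ (B - 1)"
      by (rule power_increasing) (use that q in auto)
    also have "\<dots> = real q ^ B / real q"
      using that B q by (simp add: power_diff)
    finally show ?thesis using q by (simp add: mult_right_mono)
  qed
  have sum_N2: "(\<Sum>w\<in>W. (real (N w))\<^sup>2) \<le> (real (card \<Z>))\<^sup>2 + real (card \<Z> * h) * (real q ^ B / real q)"
  proof -
    have "(\<Sum>w\<in>W. (real (N w))\<^sup>2)
        = (\<Sum>w\<in>W. \<Sum>Z\<in>\<Z>. \<Sum>Z'\<in>\<Z>. if w \<in> Sol (esym Z) \<inter> Sol (esym Z') then 1 else 0)"
      unfolding N_eq power2_eq_square sum_product by (intro sum.cong refl) auto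
    also have "\<dots> = (\<Sum>Z\<in>\<Z>. \<Sum>Z'\<in>\<Z>. \<Sum>w\<in>W. if w \<in> Sol (esym Z) \<inter> Sol (esym Z') then 1 else 0)"
      by (subst sum.swap, rule sum.cong[OF refl], rule sum.swap)
    also have "\<dots> = (\<Sum>Z\<in>\<Z>. \<Sum>Z'\<in>\<Z>. real (card (Sol (esym Z) \<inter> Sol (esym Z'))))"
      unfolding count using Sol_W
      by (intro sum.cong refl arg_cong[where f = "\<lambda>x. real (card x)"]) auto
    also have "\<dots> \<le> (\<Sum>Z\<in>\<Z>. \<Sum>Z'\<in>\<Z>. 1 + (\<Sum>t\<in>{1..h}. if agree t Z Z' then real q ^ t else 0))"
      by (intro sum_mono pair)
    also have "\<dots> = (real (card \<Z>))\<^sup>2 + (\<Sum>Z\<in>\<Z>. \<Sum>t\<in>{1..h}. \<Sum>Z'\<in>\<Z>. if agree t Z Z' then real q ^ t else 0)"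
      by (simp add: sum.distrib power2_eq_square sum.swap[of _ "{Suc 0..h}" \<Z>])
    also have "(\<Sum>Z\<in>\<Z>. \<Sum>t\<in>{1..h}. \<Sum>Z'\<in>\<Z>. if agree t Z Z' then real q ^ t else 0)
        \<le> (\<Sum>Z\<in>\<Z>. \<Sum>t\<in>{1..h}. real q ^ B / real q)"
      by (intro sum_mono agree_count)
    finally show ?thesis by simp
  qed
  have "(\<Sum>w\<in>W. (real (N w) - avg)\<^sup>2)
      = (\<Sum>w\<in>W. (real (N w))\<^sup>2) - 2 * avg * (\<Sum>w\<in>W. real (N w)) + real (card W) * avg\<^sup>2"
    by (simp add: power2_diff sum.distrib sum_subtractf sum_distrib_left mult_ac)
  \<comment> \<open>\<open>card W = q^(2h)\<close> makes the squared mean sum to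
    \<open>(card \<Z>)^2\<close>, which is exactly the main term in \<open>sum_N2\<close>.\<close>
  also have "\<dots> = (\<Sum>w\<in>W. (real (N w))\<^sup>2) - (real (card \<Z>))\<^sup>2"
  proof -
    have "avg * real q ^ h = real (card \<Z>)" using q by (simp add: avg_def)
    moreover have "real (card W) * avg\<^sup>2 = (avg * real q ^ h)\<^sup>2"
      by (simp add: card_W power_mult_distrib mult.commute flip: power_mult)
    moreover have "avg * (\<Sum>w\<in>W. real (N w)) = (avg * real q ^ h) * real (card \<Z>)"
      by (simp add: sum_N)
    ultimately have "real (card W) * avg\<^sup>2 = (real (card \<Z>))\<^sup>2"
      "avg * (\<Sum>w\<in>W. real (N w)) = (real (card \<Z>))\<^sup>2"
      by (simp_all add: power2_eq_square)
    thus ?thesis by simp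
  qed
  also have "\<dots> \<le> real (card \<Z> * h) * (real q ^ B / real q)"
    using sum_N2 by linarith
  finally show ?thesis by (simp add: W_def N_def avg_def q_def)
qed

end

text \<open>Weakened from \<open>(n / k)^k\<close> to the common denominator \<open>d\<close>, so
  that the bounds for the two parts of a set of \<open>d\<close> roots multiply to a
  \<open>d\<close>-th power.\<close>

lemma power_le_binomial:
  assumes "k \<le> d" "d \<ge> 1" "real d \<le> x" "x \<le> real n"
  shows "(x / real d) ^ k \<le> real (n choose k)"
proof (cases "k = 0")
  case False
  have "(x / real d) ^ k \<le> (real n / real k) ^ k"
    using assms False by (intro power_mono frac_le) auto
  also have "\<dots> \<le> real n gchoose k"
    using assms by (intro gbinomial_ge_n_over_k_pow_k) auto
  finally show ?thesis by (simp add: binomial_gbinomial)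
qed simp

context triangular_conditions
begin

text \<open>The expected order of magnitude: about \<open>q^d\<close> sets of roots, each of the
  \<open>h\<close> conditions costing a factor \<open>q\<close>. Drawing the two groups of roots
  from disjoint halves of \<open>U\<close> keeps them disjoint and recoverable from their
  union.\<close>

lemma card_conds_ge:
  fixes U :: "'k set"
  assumes U: "U \<subseteq> K" "card K \<le> 4 * card U" and d: "4 * h \<le> d" "d \<ge> 1"
    and q: "real (card K) \<ge> 2 * (real d + 1) * (16 * real d) ^ d"
  shows "real (card K) ^ (d - h) / (4 * (16 * real d) ^ d) \<le> real (card {Y. Y \<subseteq> U \<and> card Y = d \<and> conds Y})"
proof -
  define q where "q = real (card K)"
  define E where "E = (16 * real d) ^ d"
  have E: "E \<ge> 16 * real d" unfolding E_def using d by (intro self_le_power) auto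
  have q_ge: "q \<ge> 2 * (real d + 1) * E" using q by (simp add: q_def E_def)
  have "2 * (real d + 1) * E \<ge> 2 * (real d + 1) * (16 * real d)"
    using E by (intro mult_left_mono) auto
  hence q_ge': "q \<ge> 2 * (real d + 1) * (16 * real d)" using q_ge by linarith
  have "2 * (real d + 1) * (16 * real d) \<ge> 2 * 1 * (16 * real d)"
    by (intro mult_right_mono) auto
  hence q_ge'': "q \<ge> 32 * real d" using q_ge' by linarith
  hence q_pos: "q \<ge> 32" using d by simp
  have fin_U: "finite U" using U finite_K finite_subset by blast
  obtain U1 where U1: "U1 \<subseteq> U" "card U1 = card U div 2"
    by (rule obtain_subset_with_card_n[of "card U div 2" U]) auto
  define U2 where "U2 = U - U1"
  have U2: "U2 \<subseteq> U" "U1 \<inter> U2 = {}" by (auto simp: U2_def)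
  have card_U2: "card U2 = card U - card U div 2"
    using U1 fin_U by (simp add: U2_def card_Diff_subset finite_subset)
  have q_U: "q \<le> 4 * real (card U)" using U by (simp add: q_def)
  \<comment> \<open>Half of at least \<open>q / 4\<close> elements is at least
    \<open>q / 8 - 1 / 2\<close> after rounding, hence at least \<open>q / 16\<close>.\<close>
  have size: "q / 16 \<le> real (card U1)" "q / 16 \<le> real (card U2)"
    using q_U q_pos unfolding U1(2) card_U2 by linarith+
  define B where "B = d - 2 * h"
  have B: "2 * h \<le> B" "2 * h + B = d" "B \<le> d" "d - h = B + h" using d by (auto simp: B_def)
  define \<Y> where "\<Y> = {Y. Y \<subseteq> U1 \<and> card Y = 2 * h}"
  define \<Z> where "\<Z> = {Z. Z \<subseteq> U2 \<and> card Z = B}"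
  define r where "r Y = restrict (esym Y) {..<2 * h + 1}" for Y :: "'k set"
  define N where "N w = card {Z \<in> \<Z>. w \<in> Sol (esym Z)}" for w
  define W where "W = {w \<in> PiE {..<2 * h + 1} (\<lambda>_. K). w 0 = 1}"
  define avg where "avg = real (card \<Z>) / q ^ h"
  have fin_Y: "finite Y" "Y \<subseteq> K" if "Y \<in> \<Y>" for Y
    using that U1 U fin_U finite_subset[of Y U] by (auto simp: \<Y>_def)
  have fin_Z: "finite Z" if "Z \<in> \<Z>" for Z
    using that U2 fin_U finite_subset[of Z U] by (auto simp: \<Z>_def)
  have fin: "finite \<Y>" "finite \<Z>"
    by (rule finite_subset[of _ "Pow U"], use U1 U2 fin_U in \<open>auto simp: \<Y>_def \<Z>_def\<close>)+
  have fin_W: "finite W" by (simp add: W_def finite_PiE finite_K)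
  have r_W: "r ` \<Y> \<subseteq> W"
  proof (rule image_subsetI)
    fix Y assume "Y \<in> \<Y>"
    thus "r Y \<in> W" using fin_Y(2)[of Y] by (simp add: r_def W_def esym_0 esym_K)
  qed
  have inj_r: "inj_on r \<Y>"
  proof (rule inj_onI)
    fix Y Y' assume Y: "Y \<in> \<Y>" "Y' \<in> \<Y>" "r Y = r Y'"
    have "esym Y i = esym Y' i" if "i \<le> 2 * h" for i
      using fun_cong[OF Y(3), of i] that by (simp add: r_def)
    moreover have "card Y = 2 * h" "card Y' = 2 * h" using Y by (auto simp: \<Y>_def)
    ultimately show "Y = Y'"
      using fin_Y(1)[OF Y(1)] fin_Y(1)[OF Y(2)] by (intro esym_inject)
  qed
  have "card \<Y> = card U1 choose (2 * h)" "card \<Z> = card U2 choose B"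
    unfolding \<Y>_def \<Z>_def by (rule n_subsets, use U1 U2 fin_U finite_subset in blast)+
  moreover have "(q / 16 / real d) ^ (2 * h) \<le> real (card U1 choose (2 * h))"
    by (rule power_le_binomial) (use size d q_ge'' in auto)
  moreover have "(q / 16 / real d) ^ B \<le> real (card U2 choose B)"
    by (rule power_le_binomial) (use size d q_ge'' B in auto)
  ultimately have "(q / 16 / real d) ^ (2 * h) * (q / 16 / real d) ^ B \<le> real (card \<Y>) * real (card \<Z>)"
    using q_pos by (intro mult_mono) auto
  hence YZ: "q ^ d / E \<le> real (card \<Y>) * real (card \<Z>)"
    unfolding power_add [symmetric] B(2) by (simp add: E_def power_divide power_mult_distrib)
  have "0 < q ^ d / E" using q_pos E d by (auto intro!: divide_pos_pos)
  hence Z_pos: "card \<Z> > 0" using YZ by (cases "card \<Z> = 0") auto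
  hence avg: "avg > 0" using q_pos by (simp add: avg_def)
  define total where "total = (\<Sum>w\<in>r ` \<Y>. real (N w))"
  \<comment> \<open>Dropping \<open>N^2\<close> from \<open>(N - avg)^2\<close> gives a lower bound
    linear in \<open>total\<close>; restricting from \<open>W\<close> to the image of
    \<open>r\<close> only loses nonnegative terms.\<close>
  have "real (card \<Y>) * avg\<^sup>2 - 2 * avg * total = (\<Sum>w\<in>r ` \<Y>. avg\<^sup>2 - 2 * avg * real (N w))"
    by (simp add: total_def sum_subtractf sum_distrib_left card_image[OF inj_r])
  also have "\<dots> \<le> (\<Sum>w\<in>r ` \<Y>. (real (N w) - avg)\<^sup>2)"
    by (intro sum_mono) (simp add: power2_diff)
  also have "\<dots> \<le> (\<Sum>w\<in>W. (real (N w) - avg)\<^sup>2)"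
    by (rule sum_mono2) (use r_W fin_W in auto)
  also have "\<dots> \<le> real (card \<Z> * h) * q ^ B / q"
    unfolding W_def N_def avg_def q_def \<Z>_def
    by (rule sum_card_Sol_deviation_le) (use U2 U B in auto)
  also have "\<dots> = avg * (real h * q ^ (d - h) / q)"
    using q_pos unfolding B(4) by (simp add: avg_def power_add field_simps)
  finally have "avg * (real (card \<Y>) * avg - 2 * total) \<le> avg * (real h * q ^ (d - h) / q)"
    by (simp add: power2_eq_square algebra_simps)
  hence 1: "real (card \<Y>) * avg - real h * q ^ (d - h) / q \<le> 2 * total"
    using avg by (simp only: mult_le_cancel_left_pos)
  have "q ^ (d - h) / E = q ^ d / E / q ^ h"
    using d q_pos by (simp add: power_diff)
  also have "\<dots> \<le> real (card \<Y>) * real (card \<Z>) / q ^ h"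
    using YZ q_pos by (intro divide_right_mono) auto
  also have "\<dots> = real (card \<Y>) * avg" by (simp add: avg_def)
  finally have 2: "q ^ (d - h) / E \<le> real (card \<Y>) * avg" .
  \<comment> \<open>The assumed size of \<open>card K\<close> makes the deviation at most half of
    the main term.\<close>
  have 3: "real h * q ^ (d - h) / q \<le> q ^ (d - h) / (2 * E)"
  proof -
    have E0: "E > 0" using E d by simp
    have "2 * real h * E \<le> 2 * (real d + 1) * E"
      using d E0 by (intro mult_right_mono) auto
    hence "2 * real h * E \<le> q" using q_ge by simp
    hence "real h / q \<le> 1 / (2 * E)" using E0 q_pos by (simp add: field_simps)
    hence "q ^ (d - h) * (real h / q) \<le> q ^ (d - h) * (1 / (2 * E))"
      using q_pos by (intro mult_left_mono) auto
    thus ?thesis by (simp add: mult.commute)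
  qed
  have 4: "q ^ (d - h) / (4 * E) \<le> total"
    using 1 2 3 by (simp add: field_simps)
  let ?D = "{Y. Y \<subseteq> U \<and> card Y = d \<and> conds Y}"
  have "total = (\<Sum>Y\<in>\<Y>. real (N (r Y)))"
    unfolding total_def by (rule sum.reindex_cong[OF inj_r]) auto
  also have "\<dots> = real (card (SIGMA Y:\<Y>. {Z \<in> \<Z>. r Y \<in> Sol (esym Z)}))"
    using fin by (simp add: N_def)
  also have "card (SIGMA Y:\<Y>. {Z \<in> \<Z>. r Y \<in> Sol (esym Z)}) \<le> card ?D"
  proof (rule card_inj_on_le[of "\<lambda>(Y, Z). Y \<union> Z"])
    show "inj_on (\<lambda>(Y, Z). Y \<union> Z) (SIGMA Y:\<Y>. {Z \<in> \<Z>. r Y \<in> Sol (esym Z)})"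
    proof (rule inj_onI, clarify)
      fix Y Z Y' Z' assume *: "Y \<in> \<Y>" "Y' \<in> \<Y>" "Z \<in> \<Z>" "Z' \<in> \<Z>" "Y \<union> Z = Y' \<union> Z'"
      have "Y = (Y \<union> Z) \<inter> U1" "Z = (Y \<union> Z) \<inter> U2" "Y' = (Y' \<union> Z') \<inter> U1" "Z' = (Y' \<union> Z') \<inter> U2"
        using * U2(2) by (auto simp: \<Y>_def \<Z>_def)
      thus "Y = Y' \<and> Z = Z'" using *(5) by simp
    qed
    show "(\<lambda>(Y, Z). Y \<union> Z) ` (SIGMA Y:\<Y>. {Z \<in> \<Z>. r Y \<in> Sol (esym Z)}) \<subseteq> ?D"
    proof (clarify, intro conjI)
      fix Y Z assume *: "Y \<in> \<Y>" "Z \<in> \<Z>" "r Y \<in> Sol (esym Z)"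
      have disj: "Y \<inter> Z = {}" using * U2(2) by (auto simp: \<Y>_def \<Z>_def)
      show "Y \<union> Z \<subseteq> U" using * U1 U2 by (auto simp: \<Y>_def \<Z>_def)
      show "card (Y \<union> Z) = d"
        using card_Un_disjoint[OF fin_Y(1)[OF *(1)] fin_Z[OF *(2)] disj] * B by (simp add: \<Y>_def \<Z>_def)
      show "conds (Y \<union> Z)"
        by (rule conds_Un) (use * disj fin_Y fin_Z in \<open>auto simp: r_def\<close>)
    qed
    show "finite ?D" by (rule finite_subset[of _ "Pow U"]) (use fin_U in auto)
  qed
  finally show ?thesis using 4 by (simp add: q_def E_def)
qed

end

section \<open>Two-to-one maps in characteristic two\<close>

lemma card_two_to_one:
  assumes "finite A" "e \<noteq> (0 :: 'a :: field)"
    and "\<And>x. x \<in> A \<Longrightarrow> x + e \<in> A"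
    and "\<And>x y. x \<in> A \<Longrightarrow> y \<in> A \<Longrightarrow> f x = f y \<longleftrightarrow> y = x \<or> y = x + e"
    and "Y \<subseteq> f ` A"
  shows "card {x \<in> A. f x \<in> Y} = 2 * card Y"
proof -
  have finY: "finite Y" using assms finite_surj by blast
  have fib: "card {x \<in> A. f x = y} = 2" if "y \<in> Y" for y
  proof -
    from \<open>y \<in> Y\<close> assms(5) obtain x where x: "x \<in> A" "y = f x" by blast
    have "f x = f x' \<longleftrightarrow> x' = x \<or> x' = x + e" if "x' \<in> A" for x' using assms(4) x(1) that by blast
    hence "{x' \<in> A. f x' = y} = {x, x + e}" using x(1) assms(3)[OF x(1)] unfolding x(2) by force
    thus ?thesis using assms(2) by simp
  qed
  have "{x \<in> A. f x \<in> Y} = (\<Union>y\<in>Y. {x \<in> A. f x = y})" by auto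
  also have "card \<dots> = (\<Sum>y\<in>Y. card {x \<in> A. f x = y})"
    by (rule card_UN_disjoint) (use finY assms(1) in auto)
  finally show ?thesis by (simp add: fib)
qed

locale binary_subfield = finite_subfield K for K :: "'k::field set" +
  assumes one_plus_one: "(1 :: 'k) + 1 = 0"
begin

lemma add_self: "x + x = (0 :: 'k)"
  using one_plus_one by (metis distrib_left mult.right_neutral mult_zero_right)

lemma neg_eq: "- x = (x :: 'k)"
  using add_self[of x] by (simp add: eq_neg_iff_add_eq_0)

lemma diff_eq: "x - y = (x + y :: 'k)"
  using neg_eq[of y] by (metis diff_conv_add_uminus)

lemma add_eq_0: "x + y = 0 \<longleftrightarrow> x = (y :: 'k)"
  by (metis diff_eq right_minus_eq)

lemma of_nat_even: "even n \<Longrightarrow> of_nat n = (0 :: 'k)"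
  by (auto elim!: evenE simp: add_self mult_2)

lemma of_nat_odd: "odd n \<Longrightarrow> of_nat n = (1 :: 'k)"
  by (auto elim!: oddE simp: add_self mult_2)

lemma add_self_poly: "p + p = (0 :: 'k poly)"
  by (rule poly_eqI) (simp only: coeff_add add_self coeff_0)

lemma add_cancel_poly: "p + (p + r) = (r :: 'k poly)"
  by (simp add: add.assoc [symmetric] add_self_poly)

lemma square_add: "(x + y) ^ 2 = x ^ 2 + (y :: 'k) ^ 2"
  by (simp add: power2_sum add_self mult_2)

text \<open>In characteristic two \<open>V a\<close> is additive with kernel \<open>{0, a}\<close>.
  With \<open>u = V 1 x\<close> and \<open>v = V a u\<close>, the sets \<open>H\<close> and
  \<open>U a\<close> are the values of \<open>u\<close> and \<open>v\<close> for \<open>x\<close> in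
  \<open>K\<close>; they have \<open>q / 2\<close> and, for nonzero \<open>a\<close> in
  \<open>H\<close>, \<open>q / 4\<close> elements.\<close>

definition V :: "'k \<Rightarrow> 'k \<Rightarrow> 'k" where "V a w = w ^ 2 + a * w"
definition H :: "'k set" where "H = V 1 ` K"
definition U :: "'k \<Rightarrow> 'k set" where "U a = V a ` H"

lemma V_add: "V a (x + y) = V a x + V a y"
  by (simp add: V_def square_add algebra_simps)

lemma V_eq_iff: "V a x = V a y \<longleftrightarrow> y = x \<or> y = x + a"
proof -
  have "V a x = V a y \<longleftrightarrow> V a (x + y) = 0" by (simp add: V_add add_eq_0)
  also have "\<dots> \<longleftrightarrow> (x + y) * (x + a + y) = 0" by (simp add: V_def power2_eq_square algebra_simps)
  also have "\<dots> \<longleftrightarrow> x = y \<or> x + a = y" by (simp add: add_eq_0)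
  finally show ?thesis by auto
qed

lemma H_K: "H \<subseteq> K" by (auto simp: H_def V_def intro!: K_intros)

lemma H_add: "x \<in> H \<Longrightarrow> y \<in> H \<Longrightarrow> x + y \<in> H"
  by (auto simp: H_def V_add [symmetric] intro!: imageI add_K)

lemma finite_H: "finite H" using H_K finite_K finite_subset by blast

lemma U_K: "a \<in> K \<Longrightarrow> U a \<subseteq> K"
  using H_K by (auto simp: U_def V_def intro!: K_intros)

lemma card_V1_vimage: "W \<subseteq> H \<Longrightarrow> card {x \<in> K. V 1 x \<in> W} = 2 * card W"
  by (rule card_two_to_one[of K 1]) (auto simp: finite_K add_K V_eq_iff H_def)

lemma card_V_vimage: "a \<in> H \<Longrightarrow> a \<noteq> 0 \<Longrightarrow> Y \<subseteq> U a \<Longrightarrow> card {w \<in> H. V a w \<in> Y} = 2 * card Y"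
  by (rule card_two_to_one[of H a]) (auto simp: finite_H H_add V_eq_iff U_def)

lemma card_K_eq: "card K = 2 * card H"
proof -
  have "{x \<in> K. V 1 x \<in> H} = K" by (auto simp: H_def)
  thus ?thesis using card_V1_vimage[of H] by simp
qed

lemma card_K_eq_U:
  assumes "a \<in> H" "a \<noteq> 0"
  shows "card K = 4 * card (U a)"
proof -
  have "{w \<in> H. V a w \<in> U a} = H" by (auto simp: U_def)
  thus ?thesis using card_V_vimage[OF assms, of "U a"] card_K_eq by simp
qed

text \<open>\<open>H\<close> and its coset through \<open>x\<close> are disjoint and each has half
  the size of \<open>K\<close>, so every element outside \<open>H\<close> lies in that
  coset.\<close>

lemma add_in_H:
  assumes "x \<in> K - H" "y \<in> K - H"
  shows "x + y \<in> H"
proof -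
  let ?T = "(\<lambda>w. x + w) ` H"
  have "H \<inter> ?T = {}"
  proof -
    have "x + w \<notin> H" if "w \<in> H" for w
      using H_add[of "x + w" w] that assms by (auto simp: add.assoc add_self)
    thus ?thesis by auto
  qed
  hence "card (H \<union> ?T) = card H + card ?T" by (intro card_Un_disjoint) (auto simp: finite_H)
  also have "card ?T = card H" by (rule card_image) auto
  finally have "card (H \<union> ?T) = card K" using card_K_eq by simp
  moreover have "H \<union> ?T \<subseteq> K" using H_K assms by (auto intro!: add_K)
  ultimately have "H \<union> ?T = K" using card_subset_eq[OF finite_K] by blast
  then obtain w where "w \<in> H" "y = x + w" using assms by blast
  thus ?thesis by (simp add: add_self flip: add.assoc)
qed

text \<open>The character of \<open>K\<close> with kernel \<open>H\<close>, available because
  \<open>H\<close> has index two.\<close>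

definition sgn_H :: "'k \<Rightarrow> real" where "sgn_H x = (if x \<in> H then 1 else -1)"

sublocale real_character K sgn_H
proof
  show "sgn_H (x + y) = sgn_H x * sgn_H y" if "x \<in> K" "y \<in> K" for x y
  proof -
    have 1: "x + y \<notin> H" if "x \<in> H" "y \<notin> H" for x y
      using H_add[of "x + y" x] that by (auto simp: add_ac add_self simp flip: add.assoc)
    show ?thesis
      using H_add[of x y] add_in_H[of x y] 1[of x y] 1[of y x] that
      by (auto simp: sgn_H_def add.commute)
  qed
  have "H \<noteq> K" using card_K_eq card_K_ge_2 by auto
  thus "\<exists>e\<in>K. sgn_H e = -1" using H_K by (auto simp: sgn_H_def)
qed (auto simp: sgn_H_def)

end

section \<open>First derivatives that split\<close>

lemma pcompose_power: "pcompose (p ^ n) q = pcompose p q ^ n" for p :: "'a::comm_semiring_1 poly"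
  by (induction n) (simp_all add: pcompose_mult pcompose_1)

lemma pcompose_monom: "pcompose (monom c n) q = smult c (q ^ n)" for q :: "'a::comm_ring_1 poly"
  by (simp add: monom_altdef pcompose_smult pcompose_power pcompose_pCons)

lemma smult_sum_right: "smult c (\<Sum>i\<in>A. f i) = (\<Sum>i\<in>A. smult c (f i))"
  by (induction A rule: infinite_finite_induct) (auto simp: smult_add_right)

lemma prod_linear_eq_sum_esym:
  fixes Y :: "'k::field set"
  assumes "finite Y"
  shows "(\<Prod>z\<in>Y. [:z, 1:]) = (\<Sum>i\<le>card Y. monom (esym Y i) (card Y - i))"
proof -
  let ?p = "\<Prod>z\<in>Y. [:z, 1:]"
  have "?p = (\<Sum>i\<le>card Y. monom (coeff ?p i) i)"
    using poly_as_sum_of_monoms[of ?p] by (simp add: degree_prod_linear assms)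
  also have "\<dots> = (\<Sum>i\<le>card Y. monom (esym Y i) (card Y - i))"
    by (rule sum.reindex_bij_witness[of _ "\<lambda>i. card Y - i" "\<lambda>i. card Y - i"])
       (auto simp: esym_eq_coeff assms)
  finally show ?thesis .
qed

context binary_subfield
begin

section \<open>Derivatives of polynomials in \<open>u^2 + a u\<close>\<close>

definition Vp :: "'k \<Rightarrow> 'k poly" where "Vp a = [:0, a, 1:]"

definition \<Delta> :: "'k \<Rightarrow> 'k poly \<Rightarrow> 'k poly" where "\<Delta> a B = B + pcompose B [:a, 1:]"

lemma \<Delta>_add: "\<Delta> a (p + r) = \<Delta> a p + \<Delta> a r"
  by (simp add: \<Delta>_def pcompose_add algebra_simps)

lemma \<Delta>_sum: "\<Delta> a (\<Sum>i\<in>A. f i) = (\<Sum>i\<in>A. \<Delta> a (f i))"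
  by (simp add: \<Delta>_def pcompose_sum sum.distrib)

lemma poly_\<Delta>: "poly (\<Delta> a B) x = poly B x + poly B (x + a)"
  by (simp add: \<Delta>_def poly_pcompose add.commute)

lemma poly_Vp: "poly (Vp a) x = V a x"
  by (simp add: Vp_def V_def power2_eq_square algebra_simps)

lemma Vp_shift: "pcompose (Vp a) [:a, 1:] = Vp a"
  by (simp add: Vp_def pcompose_pCons add_self add.assoc [symmetric])

lemma \<Delta>_Vp_power: "\<Delta> a (smult c (Vp a ^ i)) = 0"
  by (simp only: \<Delta>_def pcompose_smult pcompose_power Vp_shift add_self_poly)

lemma \<Delta>_X_Vp_power: "\<Delta> a (smult c ([:0, 1:] * Vp a ^ i)) = smult (a * c) (Vp a ^ i)"
proof -
  have "\<Delta> a (smult c ([:0, 1:] * Vp a ^ i)) = smult c (([:0, 1:] + [:a, 1:]) * Vp a ^ i)"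
    by (simp only: \<Delta>_def pcompose_smult pcompose_power pcompose_mult Vp_shift smult_add_right distrib_right)
       (simp add: pcompose_pCons)
  thus ?thesis by (simp add: add_self mult.commute)
qed

lemma degree_Vp: "Polynomial.degree (Vp a) = 2" by (simp add: Vp_def)

text \<open>From \<open>Vp a = X (X + a)\<close>. The guard \<open>i \<le> j\<close> is essential,
  since truncated subtraction would turn \<open>j - i\<close> into 0 and the binomial into
  1.\<close>

lemma coeff_Vp_power:
  "coeff (Vp a ^ i) j = (if i \<le> j \<and> j \<le> 2 * i then of_nat (i choose (j - i)) * a ^ (2 * i - j) else 0)"
proof -
  have "Vp a = monom 1 1 * [:a, 1:]" by (simp add: Vp_def monom_altdef)
  hence "Vp a ^ i = monom 1 i * [:a, 1:] ^ i" by (simp only: power_mult_distrib monom_power) simp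
  moreover have "coeff ([:a, 1:] ^ i) (j - i) = 0" if "2 * i < j"
    by (rule coeff_eq_0) (use that in \<open>simp add: degree_linear_power\<close>)
  ultimately show ?thesis
    by (auto simp: coeff_monom_mult coeff_linear_poly_power mult_2)
qed

lemma coeff_Vp_power_lead: "coeff (Vp a ^ i) (2 * i) = 1"
  by (simp add: coeff_Vp_power)

lemma coeff_Vp_power_K: "a \<in> K \<Longrightarrow> coeff (Vp a ^ i) j \<in> K"
  by (auto simp: coeff_Vp_power intro!: K_intros)

text \<open>The exponents that occur in some power \<open>Vp a ^ i\<close> with \<open>i \<le> d\<close>, for generic \<open>a\<close>.
  Coefficients of a polynomial \<open>B\<close> outside this set survive in \<open>\<Delta> a B\<close> for all \<open>a\<close> at once,
  and are therefore kept fixed below.\<close>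

definition S :: "nat \<Rightarrow> nat set" where
  "S d = {j. \<exists>i\<le>d. i \<le> j \<and> j \<le> 2 * i \<and> odd (i choose (j - i))}"

lemma S_le: "j \<in> S d \<Longrightarrow> j \<le> 2 * d" by (auto simp: S_def)

lemma finite_S: "finite (S d)"
  by (rule finite_subset[of _ "{..2 * d}"]) (auto dest: S_le)

lemma coeff_Vp_power_notin_S: "i \<le> d \<Longrightarrow> j \<notin> S d \<Longrightarrow> coeff (Vp a ^ i) j = 0"
  by (auto simp: coeff_Vp_power S_def of_nat_even)

text \<open>Present are even \<open>j = 2 * i\<close> as leading exponents, \<open>j \<le> d\<close>
  as lowest exponents of \<open>Vp a ^ j\<close>, and \<open>j = 2 * i + 1\<close> with
  \<open>i\<close> even through the odd binomial \<open>i + 1 choose i\<close>. What is left exceeds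
  \<open>d\<close> and is congruent to 3 modulo 4, as is \<open>2 * d + 1\<close>.\<close>

lemma notin_S_cases:
  assumes d: "odd d" and j: "j \<le> 2 * d" "j \<notin> S d"
  obtains l where "l \<in> {1..d div 4}" "j = 2 * d + 1 - 4 * l"
proof -
  have "odd j"
  proof (rule ccontr)
    assume "\<not> odd j"
    then obtain i where i: "j = 2 * i" by (auto elim: evenE)
    hence "j \<in> S d" using j unfolding S_def by (auto intro!: exI[of _ i])
    thus False using j by simp
  qed
  then obtain i where i: "j = 2 * i + 1" by (auto elim: oddE)
  have "odd i"
  proof (rule ccontr)
    assume *: "\<not> odd i"
    have "j \<in> S d" using j i * d unfolding S_def
      by (auto intro!: exI[of _ "i + 1"] simp: binomial_symmetric[of i "Suc i", symmetric])
    thus False using j by simp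
  qed
  have "d < j"
  proof (rule ccontr)
    assume "\<not> d < j"
    hence "j \<in> S d" unfolding S_def by (auto intro!: exI[of _ j])
    thus False using j by simp
  qed
  obtain k where k: "d = 2 * k + 1" using d by (auto elim: oddE)
  obtain r where r: "i = 2 * r + 1" using \<open>odd i\<close> by (auto elim: oddE)
  show ?thesis
    by (rule that[of "k - r"]) (use i k r j \<open>d < j\<close> in auto)
qed

definition polyS :: "nat \<Rightarrow> (nat \<Rightarrow> 'k) \<Rightarrow> 'k poly" where
  "polyS d x = (\<Sum>j\<in>S d. monom (x j) j)"

lemma coeff_polyS: "coeff (polyS d x) j = (if j \<in> S d then x j else 0)"
  unfolding polyS_def by (simp add: coeff_sum finite_S)

text \<open>\<open>c\<close> is to be the coefficient of \<open>u^(2d+1)\<close> in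
  \<open>B\<close>, which makes \<open>a * c\<close> the leading coefficient of
  \<open>\<Delta> a B\<close>. The inclusion in \<open>U a\<close> places the roots of every factor
  in \<open>H\<close>, so that they lift to \<open>K\<close>.\<close>

definition splits :: "nat \<Rightarrow> 'k \<Rightarrow> 'k \<Rightarrow> 'k poly \<Rightarrow> bool" where
  "splits d a c B \<longleftrightarrow> (\<exists>Y\<subseteq>U a. card Y = d \<and> \<Delta> a B = smult (a * c) (\<Prod>z\<in>Y. Vp a + [:z:]))"

lemma prod_Vp_eq_pcompose: "(\<Prod>z\<in>Y. Vp a + [:z:]) = pcompose (\<Prod>z\<in>Y. [:z, 1:]) (Vp a)"
  by (simp add: pcompose_prod pcompose_pCons add.commute)

lemma pcompose_Vp_inject: "pcompose p (Vp a) = pcompose r (Vp a) \<longleftrightarrow> p = r"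
proof -
  have "pcompose p (Vp a) = pcompose r (Vp a) \<longleftrightarrow> pcompose (p - r) (Vp a) = 0"
    by (simp add: pcompose_diff)
  also have "\<dots> \<longleftrightarrow> p = r" by (subst pcompose_eq_0_iff) (auto simp: degree_Vp)
  finally show ?thesis .
qed

text \<open>\<open>\<Delta> a\<close> maps \<open>X * Vp a ^ i\<close> to \<open>a * Vp a ^ i\<close> because \<open>Vp a\<close> is invariant under translation
  by \<open>a\<close>.\<close>

definition lift :: "nat \<Rightarrow> 'k \<Rightarrow> 'k \<Rightarrow> 'k set \<Rightarrow> 'k poly" where
  "lift d a c Y = (\<Sum>i\<le>d. smult (c * esym Y i) ([:0, 1:] * Vp a ^ (d - i)))"

lemma \<Delta>_lift:
  assumes "finite Y" "card Y = d"
  shows "\<Delta> a (lift d a c Y) = smult (a * c) (\<Prod>z\<in>Y. Vp a + [:z:])"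
  unfolding lift_def \<Delta>_sum \<Delta>_X_Vp_power prod_Vp_eq_pcompose prod_linear_eq_sum_esym[OF assms(1)]
  by (simp add: pcompose_sum pcompose_monom smult_sum_right assms mult_ac)

lemma coeff_lift:
  "coeff (lift d a c Y) (Suc j) = (\<Sum>i\<le>d. c * esym Y i * coeff (Vp a ^ (d - i)) j)"
  by (simp add: lift_def coeff_sum)

section \<open>Probability of splitting for a single \<open>a\<close>\<close>

abbreviation S_compl :: "nat \<Rightarrow> nat set" where "S_compl d \<equiv> {..2 * d} - S d"

definition large_order :: "nat \<Rightarrow> bool" where
  "large_order d \<longleftrightarrow> real (card K) \<ge> 2 * (real d + 1) * (16 * real d) ^ d"

text \<open>At exponent \<open>2 * d + 1 - 4 * l\<close> the terms of \<open>lift\<close> with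
  \<open>i > 2 * l\<close> have too small a degree and \<open>i = 2 * l\<close> enters with its
  leading coefficient, so prescribing this coefficient is a triangular condition on the
  \<open>esym Y i\<close>. Where such an exponent lies in \<open>S d\<close> its value is free: the
  bound is summed over all values at these \<open>l\<close>, collected in \<open>LO\<close>.\<close>

lemma card_lift_prescribed_ge:
  assumes d: "odd d" and a: "a \<in> H" "a \<noteq> 0" and c: "c \<in> K" "c \<noteq> 0" and b: "\<And>j. b j \<in> K"
    and q: "large_order d"
  shows "card (S_compl d) \<le> d"
    and "real (card K) ^ (d - card (S_compl d)) / (4 * (16 * real d) ^ d)
      \<le> real (card {Y. Y \<subseteq> U a \<and> card Y = d \<and> (\<forall>j\<in>S_compl d. coeff (lift d a c Y) j = b j)})"
proof -
  define h where "h = d div 4"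
  have h: "4 * h \<le> d" "d \<ge> 1" using d by (auto simp: h_def odd_pos Suc_leI)
  have aK: "a \<in> K" using a H_K by blast
  define J where "J l = 2 * d + 1 - 4 * l" for l
  define LF where "LF = {l \<in> {1..h}. J l \<in> S_compl d}"
  define LO where "LO = {1..h} - LF"
  have inj_J: "inj_on J {1..h}" using h by (auto simp: J_def inj_on_def)
  have J_Suc: "J l = Suc (2 * d - 4 * l)" if "l \<in> {1..h}" for l using that h by (auto simp: J_def)
  have Fix: "S_compl d = J ` LF"
  proof (intro equalityI subsetI)
    fix j assume j: "j \<in> S_compl d"
    then obtain l where "l \<in> {1..d div 4}" "j = J l"
      using notin_S_cases[OF d, of j] unfolding J_def by auto
    thus "j \<in> J ` LF" using j by (auto simp: LF_def h_def)
  qed (auto simp: LF_def)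
  have card_Fix: "card (S_compl d) = card LF"
    unfolding Fix by (rule card_image) (rule inj_on_subset[OF inj_J], auto simp: LF_def)
  have "LF \<subseteq> {1..h}" by (auto simp: LF_def)
  from card_mono[OF _ this] have LF: "card LF \<le> h" by simp
  have card_LO: "card LO = h - card LF"
    unfolding LO_def by (subst card_Diff_subset) (auto simp: LF_def)
  show "card (S_compl d) \<le> d" using card_Fix LF h by simp
  define lam where "lam l i = coeff (Vp a ^ (d - i)) (2 * d - 4 * l)" for l i
  define zf where "zf x l = (if l \<in> LF then b (J l) / c else if l \<in> LO then x l else 0)" for x l
  define D where "D x = {Y. Y \<subseteq> U a \<and> card Y = d \<and>
    (\<forall>l\<in>{1..h}. (\<Sum>i\<le>2 * l. lam l i * esym Y i) = zf x l)}" for x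
  have D_ge: "real (card K) ^ (d - h) / (4 * (16 * real d) ^ d) \<le> real (card (D x))"
    if x: "x \<in> vecs LO" for x
  proof -
    interpret triangular_conditions K h lam "zf x"
    proof
      show "lam l i \<in> K" for l i unfolding lam_def by (rule coeff_Vp_power_K[OF aK])
      show "zf x l \<in> K" for l using x b c by (auto simp: zf_def intro!: divide_K)
      show "lam l (2 * l) = 1" if "l \<in> {1..h}" for l
        using coeff_Vp_power_lead[of a "d - 2 * l"] that h by (simp add: lam_def right_diff_distrib')
    qed
    have "D x = {Y. Y \<subseteq> U a \<and> card Y = d \<and> conds Y}" by (auto simp: D_def conds_def)
    moreover have "card K \<le> 4 * card (U a)" using card_K_eq_U[OF a] by simp
    ultimately show ?thesis
      using card_conds_ge[OF U_K[OF aK] _ h] q by (simp add: large_order_def)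
  qed
  have coeff_J: "coeff (lift d a c Y) (J l) = c * (\<Sum>i\<le>2 * l. lam l i * esym Y i)"
    if l: "l \<in> {1..h}" for Y l
  proof -
    have "coeff (lift d a c Y) (J l) = (\<Sum>i\<le>d. c * esym Y i * lam l i)"
      by (simp add: J_Suc[OF l] coeff_lift lam_def)
    also have "\<dots> = (\<Sum>i\<le>2 * l. c * esym Y i * lam l i)"
    proof (rule sum.mono_neutral_right)
      show "\<forall>i\<in>{..d} - {..2 * l}. c * esym Y i * lam l i = 0"
        using l h by (auto simp: lam_def coeff_Vp_power)
    qed (use l h in auto)
    finally show ?thesis by (simp add: sum_distrib_left mult_ac)
  qed
  let ?T = "{Y. Y \<subseteq> U a \<and> card Y = d \<and> (\<forall>j\<in>S_compl d. coeff (lift d a c Y) j = b j)}"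
  have fin: "finite ?T" 
    by (rule finite_subset[of _ "Pow (U a)"]) (use finite_H in \<open>auto simp: U_def\<close>)
  have sub: "(\<Union>x\<in>vecs LO. D x) \<subseteq> ?T"
  proof (rule UN_least)
    fix x show "D x \<subseteq> ?T"
    proof
      fix Y assume Y: "Y \<in> D x"
      have "coeff (lift d a c Y) (J l) = b (J l)" if "l \<in> LF" for l
      proof -
        have "l \<in> {1..h}" using that by (auto simp: LF_def)
        hence "coeff (lift d a c Y) (J l) = c * zf x l" using Y by (simp add: coeff_J D_def)
        thus ?thesis using that c by (simp add: zf_def)
      qed
      hence "\<forall>j\<in>S_compl d. coeff (lift d a c Y) j = b j" unfolding Fix by blast
      thus "Y \<in> ?T" using Y by (simp add: D_def)
    qed
  qed
  have finD: "finite (D x)" for x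
    by (rule finite_subset[of _ "Pow (U a)"]) (use finite_H in \<open>auto simp: U_def D_def\<close>)
  have fin_LO: "finite LO" by (simp add: LO_def)
  have disj: "D x \<inter> D y = {}" if "x \<in> vecs LO" "y \<in> vecs LO" "x \<noteq> y" for x y
  proof (rule ccontr)
    assume "D x \<inter> D y \<noteq> {}"
    then obtain Y where "Y \<in> D x" "Y \<in> D y" by blast
    hence eq: "zf x l = zf y l" if "l \<in> {1..h}" for l using that by (auto simp: D_def)
    have "x l = y l" if "l \<in> LO" for l using eq[of l] that by (auto simp: zf_def LO_def)
    thus False using that by (meson PiE_ext)
  qed
  have "real (card K) ^ (d - card (S_compl d)) / (4 * (16 * real d) ^ d)
      = (\<Sum>x\<in>vecs LO. real (card K) ^ (d - h) / (4 * (16 * real d) ^ d))"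
  proof -
    have "d - card (S_compl d) = card LO + (d - h)" using card_LO card_Fix LF h by simp
    thus ?thesis by (simp add: card_PiE fin_LO power_add)
  qed
  also have "\<dots> \<le> (\<Sum>x\<in>vecs LO. real (card (D x)))" by (rule sum_mono) (rule D_ge)
  also have "\<dots> = real (card (\<Union>x\<in>vecs LO. D x))"
    by (subst card_UN_disjoint) (use finD disj finite_vecs[OF fin_LO] in auto)
  also have "\<dots> \<le> real (card ?T)" using card_mono[OF fin sub] by simp
  finally show "real (card K) ^ (d - card (S_compl d)) / (4 * (16 * real d) ^ d) \<le> real (card ?T)" .
qed

text \<open>Each \<open>Y\<close> with the right coefficients outside \<open>S d\<close> and each
  combination \<open>P p\<close> of powers killed by \<open>\<Delta> a\<close> yield one
  \<open>x\<close>, the correction of \<open>B\<close> to a polynomial with split derivative.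
  Conversely \<open>\<Delta> a\<close> recovers \<open>Y\<close>, and then \<open>p\<close> is
  determined. The exponents of \<open>card K\<close> add up to \<open>card (S d)\<close>.\<close>

lemma card_splits_ge:
  assumes d: "odd d" and a: "a \<in> H" "a \<noteq> 0" and B: "\<And>j. coeff B j \<in> K"
    and deg: "Polynomial.degree B \<le> 2 * d + 2" and lead: "coeff B (2 * d + 1) \<noteq> 0"
    and q: "large_order d"
  shows "real (card (vecs (S d))) / (4 * (16 * real d) ^ d)
    \<le> real (card {x \<in> vecs (S d). splits d a (coeff B (2 * d + 1)) (B + polyS d x)})"
proof -
  define c where "c = coeff B (2 * d + 1)"
  have c: "c \<in> K" "c \<noteq> 0" using B lead by (auto simp: c_def)
  have aK: "a \<in> K" using a H_K by blast
  define T where "T = {Y. Y \<subseteq> U a \<and> card Y = d \<and> (\<forall>j\<in>S_compl d. coeff (lift d a c Y) j = coeff B j)}"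
  define P where "P p = (\<Sum>i\<le>d. smult (p i) (Vp a ^ i))" for p :: "nat \<Rightarrow> 'k"
  \<comment> \<open>The last term cancels the coefficient of \<open>B\<close> at
    \<open>2 * d + 2\<close>, is killed by \<open>\<Delta> a\<close>, and by parity disturbs no
    other exponent outside \<open>S d\<close>.\<close>
  define R where "R Y p = lift d a c Y + B + P p + smult (coeff B (2 * d + 2)) (Vp a ^ (d + 1))" for Y p
  define f where "f Y p = restrict (coeff (R Y p)) (S d)" for Y p
  have finY: "finite Y" "Y \<subseteq> K" if "Y \<in> T" for Y
    using that finite_subset[of Y "U a"] finite_H U_K[OF aK] by (auto simp: T_def U_def)
  have lift_zero: "coeff (lift d a c Y) j = 0" if "j > 2 * d + 1" for Y j
    using that by (cases j) (auto simp: coeff_lift coeff_Vp_power intro!: sum.neutral)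
  have lift_lead: "coeff (lift d a c Y) (2 * d + 1) = c" for Y
  proof -
    have "coeff (lift d a c Y) (Suc (2 * d)) = (\<Sum>i\<in>{0}. c * esym Y i * coeff (Vp a ^ (d - i)) (2 * d))"
      unfolding coeff_lift by (rule sum.mono_neutral_right) (auto simp: coeff_Vp_power)
    thus ?thesis by (simp add: esym_0 coeff_Vp_power_lead)
  qed
  have P_zero: "coeff (P p) j = 0" if "j \<notin> S d" for p j
    using that by (simp add: P_def coeff_sum coeff_Vp_power_notin_S)
  have V_zero: "coeff (Vp a ^ (d + 1)) j = 0" if "j \<notin> S d" "j \<le> 2 * d + 1" for j
  proof -
    have "odd j"
    proof (cases "j = 2 * d + 1")
      case False
      hence "j \<le> 2 * d" using that by simp
      from notin_S_cases[OF d this that(1)] obtain l where "j = 2 * d + 1 - 4 * l" "l \<in> {1..d div 4}" .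
      thus ?thesis by auto
    qed simp
    \<comment> \<open>Absorption, \<open>k * (n choose k) = n * (n - 1 choose k - 1)\<close>, with
      \<open>n = d + 1\<close> even and \<open>k\<close> odd.\<close>
    have "even (d + 1 choose (j - (d + 1)))" if "d + 1 \<le> j"
    proof -
      have "(j - (d + 1)) * (d + 1 choose (j - (d + 1))) = (d + 1) * (d choose (j - (d + 1) - 1))"
        using times_binomial_minus1_eq[of "j - (d + 1)" "d + 1"] \<open>odd j\<close> d that
        by (cases "j = d + 1") auto
      hence "even ((j - (d + 1)) * (d + 1 choose (j - (d + 1))))" using d by simp
      thus ?thesis using \<open>odd j\<close> d that by simp
    qed
    thus ?thesis unfolding coeff_Vp_power by (auto simp: of_nat_even simp del: binomial_Suc_Suc)
  qed
  have R_eq: "R Y p = polyS d (f Y p)" if "Y \<in> T" for Y p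
  proof (rule poly_eqI)
    fix j
    consider "j \<in> S d" | "j \<notin> S d" "j \<le> 2 * d" | "j = 2 * d + 1" | "j = 2 * d + 2" | "j > 2 * d + 2"
      by linarith
    thus "coeff (R Y p) j = coeff (polyS d (f Y p)) j"
    proof cases
      case 1 thus ?thesis by (simp add: coeff_polyS f_def)
    next
      case 2
      have "coeff (lift d a c Y) j = coeff B j" using that 2 by (auto simp: T_def)
      thus ?thesis using 2 V_zero[of j] by (simp add: R_def coeff_polyS P_zero add_self del: power_Suc)
    next
      case 3
      hence "j \<notin> S d" using S_le[of j d] by auto
      thus ?thesis using 3 V_zero[of j] P_zero[of j] lift_lead
        by (simp add: R_def coeff_polyS c_def add_self del: power_Suc)
    next
      case 4
      hence "j \<notin> S d" using S_le[of j d] by auto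
      thus ?thesis using 4 P_zero[of j] lift_zero[of j] coeff_Vp_power_lead[of a "d + 1"]
        by (simp add: R_def coeff_polyS add_self del: power_Suc)
    next
      case 5
      hence "j \<notin> S d" using S_le[of j d] by auto
      moreover have "coeff B j = 0" using 5 deg by (intro coeff_eq_0) simp
      moreover have "coeff (Vp a ^ (d + 1)) j = 0" using 5 by (simp add: coeff_Vp_power del: power_Suc)
      ultimately show ?thesis using 5 P_zero[of j] lift_zero[of j]
        by (simp add: R_def coeff_polyS del: power_Suc)
    qed
  qed
  have \<Delta>_eq: "\<Delta> a (B + polyS d (f Y p)) = smult (a * c) (\<Prod>z\<in>Y. Vp a + [:z:])" if "Y \<in> T" for Y p
  proof -
    have "B + R Y p = lift d a c Y + P p + smult (coeff B (2 * d + 2)) (Vp a ^ (d + 1))"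
      unfolding R_def by (simp only: add_ac add_cancel_poly)
    hence "\<Delta> a (B + polyS d (f Y p)) = \<Delta> a (lift d a c Y)"
      by (simp only: R_eq[OF that, symmetric] \<Delta>_add P_def \<Delta>_sum \<Delta>_Vp_power sum.neutral_const add_0_right)
    moreover have "card Y = d" using that by (simp add: T_def)
    ultimately show ?thesis using \<Delta>_lift[OF finY(1)[OF that]] by simp
  qed
  have inj: "inj_on (\<lambda>(Y, p). f Y p) (T \<times> vecs {..d})"
  proof (rule inj_onI, clarify)
    fix Y p Y' p' assume *: "Y \<in> T" "p \<in> vecs {..d}" "Y' \<in> T" "p' \<in> vecs {..d}" "f Y p = f Y' p'"
    have "smult (a * c) (\<Prod>z\<in>Y. Vp a + [:z:]) = smult (a * c) (\<Prod>z\<in>Y'. Vp a + [:z:])"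
      using \<Delta>_eq[OF *(1), of p] \<Delta>_eq[OF *(3), of p'] *(5) by simp
    hence "(\<Prod>z\<in>Y. Vp a + [:z:]) = (\<Prod>z\<in>Y'. Vp a + [:z:])"
      using a c by (metis mult_eq_0_iff smult_eq_iff)
    hence "(\<Prod>z\<in>Y. [:z, 1:]) = (\<Prod>z\<in>Y'. [:z, 1:])"
      by (simp only: prod_Vp_eq_pcompose pcompose_Vp_inject)
    hence Y: "Y = Y'" by (rule prod_linear_inject[OF finY(1)[OF *(1)] finY(1)[OF *(3)]])
    hence "R Y p = R Y p'" using R_eq * by metis
    hence "P p = P p'" by (simp add: R_def)
    moreover have "P p = pcompose (\<Sum>i\<le>d. monom (p i) i) (Vp a)" for p
      by (simp add: P_def pcompose_sum pcompose_monom)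
    ultimately have eq: "(\<Sum>i\<le>d. monom (p i) i) = (\<Sum>i\<le>d. monom (p' i) i)"
      by (simp only: pcompose_Vp_inject)
    have "p i = p' i" if "i \<in> {..d}" for i
      using coeff_sum_monom[of i d p] coeff_sum_monom[of i d p'] eq that by simp
    hence "p = p'" using * by (intro PiE_ext) auto
    thus "Y = Y' \<and> p = p'" using Y by simp
  qed
  have coeff_R_K: "coeff (R Y p) j \<in> K" if "Y \<in> T" "p \<in> vecs {..d}" for Y p j
  proof -
    have "coeff (lift d a c Y) j \<in> K"
      by (cases j) (use c aK finY[OF that(1)] in
        \<open>auto simp: coeff_lift lift_def coeff_sum intro!: K_intros esym_K coeff_Vp_power_K\<close>)
    moreover have "coeff (P p) j \<in> K"
      using that(2) aK by (auto simp: P_def coeff_sum intro!: K_intros coeff_Vp_power_K)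
    moreover have "coeff (smult (coeff B (2 * d + 2)) (Vp a ^ (d + 1))) j \<in> K"
      unfolding coeff_smult by (intro mult_K B coeff_Vp_power_K aK)
    ultimately show ?thesis unfolding R_def coeff_add by (intro add_K B)
  qed
  have sub: "(\<lambda>(Y, p). f Y p) ` (T \<times> vecs {..d}) \<subseteq> {x \<in> vecs (S d). splits d a c (B + polyS d x)}"
  proof (clarify, intro conjI)
    fix Y p assume *: "Y \<in> T" "p \<in> vecs {..d}"
    show "f Y p \<in> vecs (S d)" using coeff_R_K[OF *] by (simp add: f_def)
    show "splits d a c (B + polyS d (f Y p))"
      using \<Delta>_eq[OF *(1), of p] * unfolding splits_def T_def by blast
  qed
  have fin: "finite {x \<in> vecs (S d). splits d a c (B + polyS d x)}"
    using finite_vecs[OF finite_S] by simp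
  have compl: "card (S_compl d) \<le> d"
    and T: "real (card K) ^ (d - card (S_compl d)) / (4 * (16 * real d) ^ d) \<le> real (card T)"
    using card_lift_prescribed_ge[OF d a c, of "coeff B"] B q by (auto simp: T_def)
  have "card (S d) + card (S_compl d) = 2 * d + 1"
  proof -
    have "S d \<subseteq> {..2 * d}" using S_le by auto
    thus ?thesis using card_Diff_subset[of "S d" "{..2 * d}"] card_mono[of "{..2 * d}" "S d"] finite_S[of d] by simp
  qed
  hence "card (S d) = (d - card (S_compl d)) + (d + 1)" using compl by simp
  hence "real (card (vecs (S d))) = real (card K) ^ (d - card (S_compl d)) * real (card K) ^ (d + 1)"
    by (simp add: card_PiE finite_S power_add)
  hence "real (card (vecs (S d))) / (4 * (16 * real d) ^ d)
      = real (card K) ^ (d - card (S_compl d)) / (4 * (16 * real d) ^ d) * real (card (vecs {..d}))"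
    by (simp add: card_PiE)
  also have "\<dots> \<le> real (card T) * real (card (vecs {..d}))"
    by (intro mult_right_mono T) auto
  also have "\<dots> = real (card (T \<times> vecs {..d}))" by (simp add: card_cartesian_product)
  also have "\<dots> \<le> real (card {x \<in> vecs (S d). splits d a c (B + polyS d x)})"
    using card_inj_on_le[OF inj sub fin] by simp
  finally show ?thesis by (simp add: c_def)
qed

section \<open>Sieving over all \<open>a\<close>\<close>

text \<open>The set is invariant under adding multiples of \<open>Vp a ^ i\<close>. A nonzero
  character sum therefore forces the pairing of \<open>w\<close> with \<open>Vp a ^ i\<close> to
  vanish, which says that \<open>a\<close> is a root of \<open>T\<close>. Choosing \<open>i\<close>
  with an odd binomial at some \<open>j0\<close> where \<open>w\<close> is nonzero makes
  \<open>T\<close> nonzero, since distinct \<open>j\<close> give distinct powers of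
  \<open>a\<close>.\<close>

lemma card_nonzero_\<chi>_le:
  assumes w: "w \<in> vecs (S d)" "\<exists>j\<in>S d. w j \<noteq> 0"
  shows "card {a \<in> H - {0}. (\<Sum>x\<in>{x \<in> vecs (S d). splits d a c (B + polyS d x)}. \<chi> (S d) w x) \<noteq> 0} \<le> d"
    (is "card ?I \<le> d")
proof -
  obtain j0 where j0: "j0 \<in> S d" "w j0 \<noteq> 0" using w by blast
  then obtain i where i: "i \<le> d" "i \<le> j0" "j0 \<le> 2 * i" "odd (i choose (j0 - i))"
    by (auto simp: S_def)
  define S' where "S' = {j \<in> S d. i \<le> j \<and> j \<le> 2 * i}"
  define T where "T = (\<Sum>j\<in>S'. monom (w j * of_nat (i choose (j - i))) (2 * i - j))"
  have finS': "finite S'" using finite_S by (simp add: S'_def)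
  have "coeff T (2 * i - j0) = (\<Sum>j\<in>S'. if j = j0 then w j * of_nat (i choose (j - i)) else 0)"
    unfolding T_def coeff_sum coeff_monom by (rule sum.cong) (use i in \<open>auto simp: S'_def\<close>)
  also have "\<dots> = w j0" using finS' i j0 by (simp add: S'_def of_nat_odd)
  finally have T_nz: "T \<noteq> 0" using j0 by auto
  have deg_T: "Polynomial.degree T \<le> i" unfolding T_def
    by (rule degree_sum_le[OF finS'], rule order_trans[OF degree_monom_le]) (auto simp: S'_def)
  have "poly T a = 0" if a: "a \<in> ?I" for a
  proof (rule ccontr)
    assume nz: "poly T a \<noteq> 0"
    have aK: "a \<in> K" using a H_K by blast
    have T_eq: "poly T a = (\<Sum>j\<in>S d. w j * coeff (Vp a ^ i) j)"
    proof -
      have "(\<Sum>j\<in>S d. w j * coeff (Vp a ^ i) j) = (\<Sum>j\<in>S'. w j * coeff (Vp a ^ i) j)"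
        by (rule sum.mono_neutral_right) (auto simp: S'_def finite_S coeff_Vp_power)
      thus ?thesis by (simp add: T_def poly_sum poly_monom S'_def coeff_Vp_power mult.assoc)
    qed
    have TK: "poly T a \<in> K"
      unfolding T_eq using w aK by (auto intro!: K_intros coeff_Vp_power_K)
    obtain e where e: "e \<in> K" "sgn_H e = -1" using \<psi>_nontrivial by blast
    \<comment> \<open>Scaling moves the pairing to \<open>e\<close>, where the character is
      -1.\<close>
    define \<theta> where "\<theta> = e / poly T a"
    have \<theta>: "\<theta> \<in> K" "\<theta> * poly T a = e" using e TK nz by (auto simp: \<theta>_def intro: divide_K)
    define s where "s = (\<lambda>j\<in>S d. \<theta> * coeff (Vp a ^ i) j)"
    have s: "s \<in> vecs (S d)" using \<theta> aK by (auto simp: s_def intro!: mult_K coeff_Vp_power_K)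
    have "\<chi> (S d) w s = sgn_H (\<Sum>j\<in>S d. w j * s j)"
      by (rule \<chi>_eq_\<psi>) (use finite_S w s in auto)
    also have "(\<Sum>j\<in>S d. w j * s j) = e"
      unfolding \<theta>(2)[symmetric] T_eq by (simp add: s_def sum_distrib_left mult_ac)
    finally have neg: "\<chi> (S d) w s = -1" using e by simp
    have polyS_s: "polyS d (\<lambda>j\<in>S d. x j + s j) = polyS d x + smult \<theta> (Vp a ^ i)" for x
      by (rule poly_eqI) (use i in \<open>auto simp: coeff_polyS s_def coeff_Vp_power_notin_S\<close>)
    have "(\<Sum>x\<in>{x \<in> vecs (S d). splits d a c (B + polyS d x)}. \<chi> (S d) w x) = 0"
    proof (rule sum_\<chi>_invariant[OF finite_S _ w(1) s _ neg])
      fix x assume x: "x \<in> {x \<in> vecs (S d). splits d a c (B + polyS d x)}"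
      have "\<Delta> a (B + polyS d (\<lambda>j\<in>S d. x j + s j)) = \<Delta> a (B + polyS d x)"
        by (simp only: polyS_s \<Delta>_add \<Delta>_Vp_power add_0_right)
      moreover have "(\<lambda>j\<in>S d. x j + s j) \<in> vecs (S d)"
        using x s by (auto intro!: add_K)
      ultimately show "(\<lambda>j\<in>S d. x j + s j) \<in> {x \<in> vecs (S d). splits d a c (B + polyS d x)}"
        using x by (simp add: splits_def)
    qed auto
    thus False using a by simp
  qed
  hence "?I \<subseteq> {a. poly T a = 0}" by blast
  hence "card ?I \<le> card {a. poly T a = 0}"
    by (rule card_mono[OF poly_roots_finite[OF T_nz]])
  also have "\<dots> \<le> Polynomial.degree T" by (rule card_poly_roots_bound[OF T_nz])
  finally show ?thesis using deg_T i by simp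
qed

text \<open>At least \<open>q / 4\<close> nonzero \<open>a\<close> in \<open>H\<close>, each with
  density at least \<open>1 / (4 E)\<close> for \<open>E = (16 d)^d\<close>, and the sieve with
  \<open>J = d\<close> give exceptional density at most \<open>16 d E / q\<close>.\<close>

lemma card_no_splits_le:
  assumes d: "odd d" and B: "\<And>j. coeff B j \<in> K"
    and deg: "Polynomial.degree B \<le> 2 * d + 2" and lead: "coeff B (2 * d + 1) \<noteq> 0"
    and q: "large_order d"
  shows "real (card {x \<in> vecs (S d). \<not> (\<exists>a\<in>H - {0}. splits d a (coeff B (2 * d + 1)) (B + polyS d x))})
    * real (card K) \<le> 16 * real d * (16 * real d) ^ d * real (card (vecs (S d)))"
proof -
  define A where "A a = {x \<in> vecs (S d). splits d a (coeff B (2 * d + 1)) (B + polyS d x)}" for a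
  define bad where "bad = card {x \<in> vecs (S d). \<forall>a\<in>H - {0}. x \<notin> A a}"
  define v where "v = real (card (vecs (S d)))"
  define E where "E = (16 * real d) ^ d"
  have E: "E > 0" using d by (auto simp: E_def odd_pos)
  have v: "v > 0" by (simp add: v_def card_PiE finite_S) (use card_K_ge_2 in auto)
  have "bad * (\<Sum>a\<in>H - {0}. card (A a)) \<le> d * (card (vecs (S d)))\<^sup>2"
  unfolding bad_def
  proof (rule card_avoiding_le[OF finite_S])
    show "finite (H - {0})" using finite_H by simp
    show "A a \<subseteq> vecs (S d)" for a by (auto simp: A_def)
    show "card {a \<in> H - {0}. (\<Sum>x\<in>A a. \<chi> (S d) w x) \<noteq> 0} \<le> d"
      if "w \<in> vecs (S d)" "\<exists>j\<in>S d. w j \<noteq> 0" for w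
      unfolding A_def using that by (rule card_nonzero_\<chi>_le)
  qed
  hence "real (bad * (\<Sum>a\<in>H - {0}. card (A a))) \<le> real (d * (card (vecs (S d)))\<^sup>2)"
    by (simp only: of_nat_le_iff)
  hence sieve: "real bad * (\<Sum>a\<in>H - {0}. real (card (A a))) \<le> real d * v\<^sup>2"
    by (simp add: v_def)
  have d1: "real d \<ge> 1" using odd_pos[OF d] by simp
  have "4 \<le> card K"
  proof -
    have "16 * real d \<le> E" unfolding E_def using d1 by (intro self_le_power) auto
    moreover have "2 * E \<le> 2 * (real d + 1) * E" using E by simp
    ultimately have "32 * real d \<le> real (card K)" using q unfolding large_order_def E_def by linarith
    thus ?thesis using d1 by linarith
  qed
  moreover have "0 \<in> H" by (auto simp: H_def V_def intro!: image_eqI[of _ _ 0])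
  hence "card (H - {0}) = card H - 1" using finite_H by simp
  ultimately have cardH: "real (card K) / 4 \<le> real (card (H - {0}))" using card_K_eq by simp
  have "real (card K) / 4 * (v / (4 * E)) \<le> real (card (H - {0})) * (v / (4 * E))"
    using cardH v E by (intro mult_right_mono) auto
  also have "\<dots> = (\<Sum>a\<in>H - {0}. v / (4 * E))" by simp
  also have "\<dots> \<le> (\<Sum>a\<in>H - {0}. real (card (A a)))"
    unfolding v_def E_def A_def
    by (intro sum_mono card_splits_ge[OF d _ _ B deg lead q]) auto
  finally have "real bad * (real (card K) / 4 * (v / (4 * E))) \<le> real bad * (\<Sum>a\<in>H - {0}. real (card (A a)))"
    by (rule mult_left_mono) simp
  hence "real bad * (real (card K) / 4 * (v / (4 * E))) \<le> real d * v\<^sup>2" using sieve by linarith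
  hence "real bad * real (card K) \<le> 16 * real d * E * v"
    using v E by (simp add: field_simps power2_eq_square)
  moreover have "{x \<in> vecs (S d). \<not> (\<exists>a\<in>H - {0}. splits d a (coeff B (2 * d + 1)) (B + polyS d x))}
      = {x \<in> vecs (S d). \<forall>a\<in>H - {0}. x \<notin> A a}" by (auto simp: A_def)
  ultimately show ?thesis by (simp only: bad_def v_def E_def)
qed

end

section \<open>Second derivatives\<close>

lemma coeff_pcompose_shift:
  fixes B :: "'a::comm_ring_1 poly"
  assumes "Polynomial.degree B \<le> n"
  shows "coeff (pcompose B [:a, 1:]) j = (\<Sum>i\<le>n. coeff B i * (of_nat (i choose j) * a ^ (i - j)))"
proof -
  have "pcompose B [:a, 1:] = (\<Sum>i\<le>n. smult (coeff B i) ([:a, 1:] ^ i))"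
    using poly_as_sum_of_monoms'[OF assms] by (metis (no_types, lifting) pcompose_monom pcompose_sum sum.cong)
  moreover have "coeff ([:a, 1:] ^ i) j = of_nat (i choose j) * a ^ (i - j)" for i
  proof (cases "j \<le> i")
    case False
    have "Polynomial.degree ([:a, 1:] ^ i) \<le> 1 * i"
      by (rule order_trans[OF degree_power_le]) auto
    hence "coeff ([:a, 1:] ^ i) j = 0" using False by (intro coeff_eq_0) simp
    thus ?thesis using False by (simp add: binomial_eq_0)
  qed (simp add: coeff_linear_poly_power)
  ultimately show ?thesis by (simp add: coeff_sum)
qed

lemma coeff_pcompose_scale:
  fixes f :: "'a::comm_ring_1 poly"
  shows "coeff (pcompose f [:0, c:]) j = coeff f j * c ^ j"
proof (induction f arbitrary: j)
  case (pCons b f)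
  have "[:0, c:] = smult c (monom 1 1)" by (simp add: monom_altdef)
  thus ?case using pCons by (cases j) (simp_all add: pcompose_pCons coeff_monom_mult coeff_pCons)
qed simp

text \<open>\<open>2 * d + 2 choose 2\<close> equals \<open>(d + 1) * (2 * d + 1)\<close>, which is
  even because \<open>d\<close> is odd; absorption carries this over to
  \<open>2 * d + 3 choose 3\<close>.\<close>

lemma even_choose:
  assumes "odd d"
  shows "even (2 * d + 2 choose (2 * d))" "even (2 * d + 2 choose (2 * d + 1))"
    "even (2 * d + 3 choose (2 * d))"
proof -
  obtain k where k: "d = 2 * k + 1" using assms by (auto elim: oddE)
  have "2 * d + 2 choose (2 * d) = 2 * d + 2 choose 2"
    using binomial_symmetric[of "2 * d" "2 * d + 2"] by simp
  also have "\<dots> = 2 * ((k + 1) * (4 * k + 3))"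
    unfolding choose_two k by (simp add: algebra_simps)
  finally show "even (2 * d + 2 choose (2 * d))" by simp
  have "2 * d + 2 choose (2 * d + 1) = 2 * d + 2"
    using binomial_symmetric[of "2 * d + 1" "2 * d + 2"] by simp
  thus "even (2 * d + 2 choose (2 * d + 1))" by simp
  have "3 * (2 * d + 3 choose 3) = (2 * d + 3) * (2 * d + 2 choose 2)"
    using times_binomial_minus1_eq[of 3 "2 * d + 3"] by (simp del: binomial_Suc_Suc)
  moreover have "2 * d + 2 choose 2 = 2 * ((k + 1) * (4 * k + 3))"
    unfolding choose_two k by (simp add: algebra_simps)
  ultimately have "even (3 * (2 * d + 3 choose 3))" by simp
  moreover have "2 * d + 3 choose (2 * d) = 2 * d + 3 choose 3"
    using binomial_symmetric[of "2 * d" "2 * d + 3"] by simp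
  ultimately show "even (2 * d + 3 choose (2 * d))" by simp
qed

context binary_subfield
begin

section \<open>Expansion along \<open>u = x^2 + x\<close> and the upper bound
  \<open>4 d\<close>\<close>

text \<open>Expansion in the basis \<open>u^i\<close>, \<open>x u^i\<close>, obtained by removing
  two leading coefficients at a time. \<open>B\<close> is bounded through vanishing coefficients, so
  that \<open>n = 0\<close> forces \<open>B = 0\<close>.\<close>

lemma decompose:
  assumes "\<And>i. coeff f i \<in> K" "Polynomial.degree f \<le> 2 * n"
  obtains P B where "\<And>i. coeff P i \<in> K" "\<And>i. coeff B i \<in> K"
    "Polynomial.degree P \<le> n" "\<And>j. n \<le> j \<Longrightarrow> coeff B j = 0"
    "f = pcompose P (Vp 1) + [:0, 1:] * pcompose B (Vp 1)"
proof -
  have "\<exists>P B. (\<forall>i. coeff P i \<in> K) \<and> (\<forall>i. coeff B i \<in> K) \<and>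
      Polynomial.degree P \<le> n \<and> (\<forall>j\<ge>n. coeff B j = 0) \<and> f = pcompose P (Vp 1) + [:0, 1:] * pcompose B (Vp 1)"
    using assms
  proof (induction n arbitrary: f)
    case 0
    hence "Polynomial.degree f = 0" by simp
    then obtain c where "f = [:c:]" by (rule degree_eq_zeroE)
    hence "f = pcompose f (Vp 1) + [:0, 1:] * pcompose 0 (Vp 1)" by simp
    thus ?case using 0 by (intro exI[of _ f] exI[of _ 0]) auto
  next
    case (Suc n)
    define c where "c = coeff f (2 * n + 2)"
    define f1 where "f1 = f - smult c (Vp 1 ^ (n + 1))"
    define c1 where "c1 = coeff f1 (2 * n + 1)"
    define f2 where "f2 = f1 - smult c1 ([:0, 1:] * Vp 1 ^ n)"
    have VK: "coeff (Vp 1 ^ i) j \<in> K" for i j by (rule coeff_Vp_power_K) simp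
    have f1K: "coeff f1 i \<in> K" for i
      unfolding f1_def c_def coeff_diff coeff_smult by (intro diff_K mult_K Suc.prems(1) VK)
    have f2K: "coeff f2 i \<in> K" for i
      unfolding f2_def c1_def coeff_diff coeff_smult
      by (intro diff_K mult_K f1K) (auto simp: coeff_pCons VK split: nat.split)
    have "coeff f2 j = 0" if j: "j > 2 * n" for j
    proof -
      have lead: "coeff (Vp 1 ^ (n + 1)) (2 * n + 2) = 1" using coeff_Vp_power_lead[of 1 "n + 1"] by simp
      have big: "coeff (Vp 1 ^ i) j = 0" if "j > 2 * i" for i j
        using that by (simp add: coeff_Vp_power)
      have Xbig: "coeff ([:0, 1:] * Vp 1 ^ n) j = (if j = 2 * n + 1 then 1 else 0)"
        using j big[of n "j - 1"] coeff_Vp_power_lead[of 1 n] by (cases j) auto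
      from j consider "j = 2 * n + 1" | "j = 2 * n + 2" | "j > 2 * n + 2" by linarith
      thus ?thesis
      proof cases
        case 1
        thus ?thesis using Xbig by (simp add: f2_def c1_def)
      next
        case 2
        thus ?thesis using Xbig lead by (simp add: f2_def f1_def c_def del: power_Suc)
      next
        case 3
        moreover have "coeff f j = 0" using 3 Suc.prems(2) by (intro coeff_eq_0) simp
        ultimately show ?thesis using Xbig big[of "n + 1" j]
          by (simp add: f2_def f1_def del: power_Suc mult_pCons_left)
      qed
    qed
    hence "Polynomial.degree f2 \<le> 2 * n" by (intro degree_le) simp
    from Suc.IH[OF f2K this] obtain P B where PB: "\<forall>i. coeff P i \<in> K" "\<forall>i. coeff B i \<in> K"
      "Polynomial.degree P \<le> n" "\<forall>j\<ge>n. coeff B j = 0" "f2 = pcompose P (Vp 1) + [:0, 1:] * pcompose B (Vp 1)"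
      by auto
    let ?P = "P + monom c (n + 1)" and ?B = "B + monom c1 n"
    have "f = f2 + smult c (Vp 1 ^ (n + 1)) + [:0, 1:] * smult c1 (Vp 1 ^ n)"
      by (simp add: f2_def f1_def)
    also have "\<dots> = pcompose ?P (Vp 1) + [:0, 1:] * pcompose ?B (Vp 1)"
      unfolding PB(5) by (simp only: pcompose_add pcompose_monom distrib_left add_ac)
    finally have "f = pcompose ?P (Vp 1) + [:0, 1:] * pcompose ?B (Vp 1)" .
    moreover have "coeff ?P i \<in> K" "coeff ?B i \<in> K" for i
      using PB Suc.prems(1) f1K by (auto simp: c_def c1_def intro!: add_K)
    moreover have "Polynomial.degree ?P \<le> Suc n"
      by (rule degree_add_le) (use PB degree_monom_le[of c "n + 1"] in auto)
    moreover have "coeff ?B j = 0" if "j \<ge> Suc n" for j using PB that by auto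
    ultimately show ?case by blast
  qed
  thus ?thesis using that by blast
qed

text \<open>Within the degree bounds, apart from \<open>x u^(2d+1)\<close> the exponent
  \<open>4 * d + 3\<close> is reached only by \<open>u^(2d+2)\<close>, \<open>u^(2d+3)\<close> and
  \<open>x u^(2d+2)\<close>, where the binomials are those of \<open>even_choose\<close>.\<close>

lemma coeff_decomposed:
  assumes d: "odd d" and P: "Polynomial.degree P \<le> 2 * d + 3"
    and B: "\<And>j. 2 * d + 3 \<le> j \<Longrightarrow> coeff B j = 0"
    and f: "f = pcompose P (Vp 1) + [:0, 1:] * pcompose B (Vp 1)"
  shows "coeff f (4 * d + 3) = coeff B (2 * d + 1)"
proof -
  have suc: "4 * d + 3 = Suc (4 * d + 2)" by simp
  have deg_B: "Polynomial.degree B \<le> 2 * d + 2" by (rule degree_le) (use B in auto)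
  have expand: "coeff (pcompose Q (Vp 1)) j = (\<Sum>i\<le>n. coeff Q i * coeff (Vp 1 ^ i) j)"
    if "Polynomial.degree Q \<le> n" for Q n j
    by (subst poly_as_sum_of_monoms'[OF that, symmetric]) (simp add: pcompose_sum pcompose_monom coeff_sum)
  have "coeff (pcompose P (Vp 1)) (4 * d + 3) = 0"
    unfolding expand[OF P]
  proof (rule sum.neutral, rule ballI)
    fix i assume "i \<in> {..2 * d + 3}"
    then consider "i \<le> 2 * d + 1" | "i = 2 * d + 2" | "i = 2 * d + 3" by force
    thus "coeff P i * coeff (Vp 1 ^ i) (4 * d + 3) = 0"
    proof cases
      case 2
       hence e: "4 * d + 3 - i = 2 * d + 1" by simp
      have "even (i choose (4 * d + 3 - i))" unfolding e unfolding 2 by (rule even_choose(2)[OF d])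
      thus ?thesis unfolding coeff_Vp_power by (simp add: of_nat_even)
    next
      case 3
       hence e: "4 * d + 3 - i = 2 * d" by simp
      have "even (i choose (4 * d + 3 - i))" unfolding e unfolding 3 by (rule even_choose(3)[OF d])
      thus ?thesis unfolding coeff_Vp_power by (simp add: of_nat_even)
    qed (auto simp: coeff_Vp_power)
  qed
  moreover have "coeff (pcompose B (Vp 1)) (4 * d + 2) = coeff B (2 * d + 1)"
  proof -
    have "coeff (pcompose B (Vp 1)) (4 * d + 2) = (\<Sum>i\<in>{2 * d + 1}. coeff B i * coeff (Vp 1 ^ i) (4 * d + 2))"
      unfolding expand[OF deg_B]
    proof (rule sum.mono_neutral_right)
      show "\<forall>i\<in>{..2 * d + 2} - {2 * d + 1}. coeff B i * coeff (Vp 1 ^ i) (4 * d + 2) = 0"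
      proof
        fix i assume "i \<in> {..2 * d + 2} - {2 * d + 1}"
        then consider "i \<le> 2 * d" | "i = 2 * d + 2" by force
        thus "coeff B i * coeff (Vp 1 ^ i) (4 * d + 2) = 0"
        proof cases
          case 2
          hence e: "4 * d + 2 - i = 2 * d" by simp
          have "even (i choose (4 * d + 2 - i))" unfolding e unfolding 2 by (rule even_choose(1)[OF d])
          thus ?thesis unfolding coeff_Vp_power by (simp add: of_nat_even)
        qed (auto simp: coeff_Vp_power)
      qed
    qed auto
    thus ?thesis using coeff_Vp_power_lead[of 1 "2 * d + 1"] by simp
  qed
  moreover have "coeff ([:0, 1:] * pcompose B (Vp 1)) (4 * d + 3) = coeff (pcompose B (Vp 1)) (4 * d + 2)"
    unfolding suc by simp
  ultimately show ?thesis unfolding f coeff_add by (simp only: add_0_left)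
qed

definition D2 :: "'k poly \<Rightarrow> 'k \<Rightarrow> 'k \<Rightarrow> 'k \<Rightarrow> 'k" where
  "D2 f \<alpha> \<alpha>' x = poly f x + poly f (x + \<alpha>) + poly f (x + \<alpha>') + poly f (x + \<alpha> + \<alpha>')"

text \<open>Adding 1 to \<open>x\<close> fixes \<open>u\<close>, so \<open>P\<close> cancels and
  \<open>B(u)\<close> is left; adding \<open>\<tau>\<close> then shifts \<open>u\<close> by
  \<open>V 1 \<tau>\<close>.\<close>

lemma D2_decomposed:
  assumes "f = pcompose P (Vp 1) + [:0, 1:] * pcompose B (Vp 1)"
  shows "D2 f 1 \<tau> x = poly (\<Delta> (V 1 \<tau>) B) (V 1 x)"
proof -
  have V11: "V 1 1 = 0" by (simp add: V_def add_self)
  have f: "poly f x = poly P (V 1 x) + x * poly B (V 1 x)" for x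
    by (simp add: assms poly_pcompose poly_Vp)
  have D1: "poly f x + poly f (x + 1) = poly B (V 1 x)" for x
  proof -
    have "poly f x + poly f (x + 1) = (poly P (V 1 x) + poly P (V 1 x)) + ((x + x) * poly B (V 1 x) + poly B (V 1 x))"
      unfolding f V_add V11 by (simp add: algebra_simps)
    thus ?thesis by (simp only: add_self) simp
  qed
  have "D2 f 1 \<tau> x = (poly f x + poly f (x + 1)) + (poly f (x + \<tau>) + poly f (x + \<tau> + 1))"
    by (simp add: D2_def add_ac)
  thus ?thesis unfolding D1 poly_\<Delta> V_add .
qed

lemma V1_eq_0: "V 1 \<tau> = 0 \<longleftrightarrow> \<tau> = 0 \<or> \<tau> = 1"
  using V_eq_iff[of 1 0 \<tau>] by (auto simp: V_def)

text \<open>The bound counts roots in \<open>u\<close>: after scaling, \<open>\<Delta> a B\<close>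
  has degree exactly \<open>2 * d\<close>, and each \<open>u\<close> in \<open>H\<close> comes from
  two elements of \<open>K\<close>.\<close>

lemma card_D2_le:
  assumes d: "odd d" and f: "\<And>i. coeff f i \<in> K" "Polynomial.degree f \<le> 4 * d + 6" "coeff f (4 * d + 3) \<noteq> 0"
    and \<alpha>: "\<alpha> \<in> K" "\<alpha>' \<in> K" "\<alpha> \<noteq> 0" "\<alpha>' \<noteq> 0" "\<alpha> \<noteq> \<alpha>'"
  shows "card {x \<in> K. D2 f \<alpha> \<alpha>' x = \<beta>} \<le> 4 * d"
proof -
  define g where "g = pcompose f [:0, \<alpha>:]"
  define \<tau> where "\<tau> = \<alpha>' / \<alpha>"
  have \<tau>: "\<tau> \<noteq> 0" "\<tau> \<noteq> 1" "\<alpha>' = \<tau> * \<alpha>" using \<alpha> by (auto simp: \<tau>_def)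
  define a where "a = V 1 \<tau>"
  have a: "a \<noteq> 0" using \<tau> by (simp add: a_def V1_eq_0)
  have coeff_g: "coeff g j = coeff f j * \<alpha> ^ j" for j unfolding g_def by (rule coeff_pcompose_scale)
  have gK: "coeff g j \<in> K" for j unfolding coeff_g by (intro mult_K power_K f \<alpha>)
  have "Polynomial.degree g \<le> 2 * (2 * d + 3)"
    by (rule degree_le) (use f(2) in \<open>auto simp: coeff_g coeff_eq_0\<close>)
  from decompose[OF gK this] obtain P B where PB: "\<And>i. coeff P i \<in> K" "\<And>i. coeff B i \<in> K"
    "Polynomial.degree P \<le> 2 * d + 3" "\<And>j. 2 * d + 3 \<le> j \<Longrightarrow> coeff B j = 0"
    "g = pcompose P (Vp 1) + [:0, 1:] * pcompose B (Vp 1)" by blast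
  define c where "c = coeff B (2 * d + 1)"
  have "coeff g (4 * d + 3) \<noteq> 0" using f(3) \<alpha> by (simp add: coeff_g)
  hence c: "c \<noteq> 0" unfolding c_def using coeff_decomposed[OF d PB(3-5)] by metis
  have deg_B: "Polynomial.degree B \<le> 2 * d + 2" by (rule degree_le) (use PB(4) in auto)
  have coeff_\<Delta>: "coeff (\<Delta> a B) j = coeff B j + (\<Sum>i\<le>2 * d + 2. coeff B i * (of_nat (i choose j) * a ^ (i - j)))" for j
    by (simp only: \<Delta>_def coeff_add coeff_pcompose_shift[OF deg_B])
  \<comment> \<open>Only \<open>i = 2 * d\<close> and \<open>i = 2 * d + 1\<close> survive in the
    shifted copy, and the former cancels against \<open>B\<close> itself.\<close>
  have "coeff (\<Delta> a B) (2 * d) = (\<Sum>i\<in>{2 * d + 1}. coeff B i * (of_nat (i choose (2 * d)) * a ^ (i - 2 * d)))"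
  proof -
    have "(\<Sum>i\<le>2 * d + 2. coeff B i * (of_nat (i choose (2 * d)) * a ^ (i - 2 * d)))
        = (\<Sum>i\<in>{2 * d, 2 * d + 1}. coeff B i * (of_nat (i choose (2 * d)) * a ^ (i - 2 * d)))"
    proof (rule sum.mono_neutral_right)
      show "\<forall>i\<in>{..2 * d + 2} - {2 * d, 2 * d + 1}. coeff B i * (of_nat (i choose (2 * d)) * a ^ (i - 2 * d)) = 0"
      proof
        fix i assume "i \<in> {..2 * d + 2} - {2 * d, 2 * d + 1}"
        then consider "i < 2 * d" | "i = 2 * d + 2" by force
        thus "coeff B i * (of_nat (i choose (2 * d)) * a ^ (i - 2 * d)) = 0"
          by cases (use of_nat_even[OF even_choose(1)[OF d]] in \<open>simp_all add: binomial_eq_0 del: binomial_Suc_Suc of_nat_add\<close>)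
      qed
    qed auto
    thus ?thesis unfolding coeff_\<Delta> by (simp add: add_self flip: add.assoc)
  qed
  also have "\<dots> = c * a"
    by (simp add: c_def of_nat_odd del: of_nat_add of_nat_Suc of_nat_mult)
  finally have lead: "coeff (\<Delta> a B) (2 * d) \<noteq> 0" using c a by simp
  have high: "coeff (\<Delta> a B) j = 0" if j: "j > 2 * d" for j
  proof -
    have "(\<Sum>i\<le>2 * d + 2. coeff B i * (of_nat (i choose j) * a ^ (i - j))) = coeff B j"
    proof (cases "j \<le> 2 * d + 2")
      case True
      have "(\<Sum>i\<le>2 * d + 2. coeff B i * (of_nat (i choose j) * a ^ (i - j)))
          = (\<Sum>i\<in>{j}. coeff B i * (of_nat (i choose j) * a ^ (i - j)))"
      proof (rule sum.mono_neutral_right)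
        show "\<forall>i\<in>{..2 * d + 2} - {j}. coeff B i * (of_nat (i choose j) * a ^ (i - j)) = 0"
        proof
          fix i assume "i \<in> {..2 * d + 2} - {j}"
          with j consider "i < j" | "i = 2 * d + 2" "j = 2 * d + 1" by force
          thus "coeff B i * (of_nat (i choose j) * a ^ (i - j)) = 0"
            by cases (use of_nat_even[OF even_choose(2)[OF d]] in \<open>simp_all add: binomial_eq_0 del: binomial_Suc_Suc of_nat_add\<close>)
        qed
      qed (use True in auto)
      thus ?thesis by simp
    next
      case False
      thus ?thesis using deg_B by (auto simp: binomial_eq_0 coeff_eq_0)
    qed
    thus ?thesis unfolding coeff_\<Delta> by (simp add: add_self)
  qed
  define G where "G = \<Delta> a B - [:\<beta>:]"
  \<comment> \<open>For positive \<open>d\<close>, subtracting the constant \<open>\<beta>\<close>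
    leaves the leading coefficient alone.\<close>
  have d0: "d > 0" using d by (rule odd_pos)
  have "coeff G (2 * d) \<noteq> 0" using lead d0 by (cases "2 * d") (auto simp: G_def)
  hence G0: "G \<noteq> 0" by auto
  have degG: "Polynomial.degree G \<le> 2 * d"
    by (rule degree_le) (use high in \<open>auto simp: G_def coeff_pCons split: nat.split\<close>)
  define W where "W = {w \<in> H. poly G w = 0}"
  have "card W \<le> card {w. poly G w = 0}"
    by (rule card_mono[OF poly_roots_finite[OF G0]]) (auto simp: W_def)
  also have "\<dots> \<le> 2 * d" using card_poly_roots_bound[OF G0] degG by linarith
  finally have cardW: "card W \<le> 2 * d" .
  have "bij_betw (\<lambda>y. y * \<alpha>) {y \<in> K. V 1 y \<in> W} {x \<in> K. D2 f \<alpha> \<alpha>' x = \<beta>}"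
  proof (rule bij_betw_imageI)
    show "inj_on (\<lambda>y. y * \<alpha>) {y \<in> K. V 1 y \<in> W}" using \<alpha> by (auto intro: inj_onI)
    have iff: "V 1 y \<in> W \<longleftrightarrow> D2 f \<alpha> \<alpha>' (y * \<alpha>) = \<beta>" if "y \<in> K" for y
    proof -
      have "D2 f \<alpha> \<alpha>' (y * \<alpha>) = D2 g 1 \<tau> y"
        by (simp add: D2_def g_def poly_pcompose \<tau>(3) algebra_simps)
      also have "\<dots> = poly (\<Delta> a B) (V 1 y)" unfolding a_def by (rule D2_decomposed[OF PB(5)])
      finally show ?thesis using that by (auto simp: W_def G_def H_def)
    qed
    show "(\<lambda>y. y * \<alpha>) ` {y \<in> K. V 1 y \<in> W} = {x \<in> K. D2 f \<alpha> \<alpha>' x = \<beta>}"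
    proof (intro equalityI subsetI)
      fix x assume x: "x \<in> {x \<in> K. D2 f \<alpha> \<alpha>' x = \<beta>}"
      have "x / \<alpha> \<in> K" "x / \<alpha> * \<alpha> = x" using x \<alpha> by (auto intro: divide_K)
      thus "x \<in> (\<lambda>y. y * \<alpha>) ` {y \<in> K. V 1 y \<in> W}"
        using x iff[of "x / \<alpha>"] by (intro image_eqI[of _ _ "x / \<alpha>"]) auto
    qed (use iff \<alpha> in \<open>auto intro: mult_K\<close>)
  qed
  hence "card {x \<in> K. D2 f \<alpha> \<alpha>' x = \<beta>} = card {y \<in> K. V 1 y \<in> W}" by (rule bij_betw_same_card[symmetric])
  also have "\<dots> = 2 * card W" by (rule card_V1_vimage) (auto simp: W_def)
  finally show ?thesis using cardW by simp
qed

text \<open>The value 0 serves as \<open>\<beta>\<close>: each of the \<open>d\<close> elements of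
  \<open>Y\<close> has two preimages under \<open>V a\<close> in \<open>H\<close>, and each of those
  has two preimages under \<open>V 1\<close> in \<open>K\<close>.\<close>

lemma card_D2_splits:
  assumes f: "f = pcompose P (Vp 1) + [:0, 1:] * pcompose B (Vp 1)"
    and a: "a \<in> H" "a \<noteq> 0" and c: "c \<noteq> 0" and sp: "splits d a c B"
  obtains \<tau> where "\<tau> \<in> K" "\<tau> \<noteq> 0" "\<tau> \<noteq> 1" "card {x \<in> K. D2 f 1 \<tau> x = 0} = 4 * d"
proof -
  obtain \<tau> where \<tau>: "\<tau> \<in> K" "a = V 1 \<tau>" using a by (auto simp: H_def)
  obtain Y where Y: "Y \<subseteq> U a" "card Y = d" "\<Delta> a B = smult (a * c) (\<Prod>z\<in>Y. Vp a + [:z:])"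
    using sp by (auto simp: splits_def)
  have finY: "finite Y" using Y(1) finite_H by (auto simp: U_def intro: finite_subset)
  have "D2 f 1 \<tau> x = 0 \<longleftrightarrow> V a (V 1 x) \<in> Y" for x
  proof -
    have "D2 f 1 \<tau> x = a * c * (\<Prod>z\<in>Y. V a (V 1 x) + z)"
      unfolding D2_decomposed[OF f] \<tau>(2)[symmetric] Y(3) by (simp add: poly_prod poly_Vp)
    thus ?thesis using a c finY by (auto simp: add_eq_0)
  qed
  hence "{x \<in> K. D2 f 1 \<tau> x = 0} = {x \<in> K. V 1 x \<in> {w \<in> H. V a w \<in> Y}}" by (auto simp: H_def)
  also have "card \<dots> = 2 * card {w \<in> H. V a w \<in> Y}" by (rule card_V1_vimage) auto
  also have "card {w \<in> H. V a w \<in> Y} = 2 * d" using card_V_vimage[OF a Y(1)] Y(2) by simp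
  finally have "card {x \<in> K. D2 f 1 \<tau> x = 0} = 4 * d" by simp
  thus ?thesis using that[of \<tau>] \<tau> a V1_eq_0 by auto
qed

section \<open>Counting exceptional polynomials of fixed degree\<close>

definition polys :: "nat \<Rightarrow> 'k poly set" where
  "polys m = {f. Polynomial.degree f = m \<and> (\<forall>i. coeff f i \<in> K)}"

definition uniform_4 :: "nat \<Rightarrow> 'k poly \<Rightarrow> bool" where
  "uniform_4 d f \<longleftrightarrow>
    (\<forall>\<alpha>\<in>K - {0}. \<forall>\<alpha>'\<in>K - {0}. \<alpha> \<noteq> \<alpha>' \<longrightarrow> (\<forall>\<beta>\<in>K. card {x \<in> K. D2 f \<alpha> \<alpha>' x = \<beta>} \<le> 4 * d)) \<and>
    (\<exists>\<alpha>\<in>K - {0}. \<exists>\<alpha>'\<in>K - {0}. \<alpha> \<noteq> \<alpha>' \<and> (\<exists>\<beta>\<in>K. card {x \<in> K. D2 f \<alpha> \<alpha>' x = \<beta>} = 4 * d))"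

lemma finite_polys: "finite (polys m)"
proof (rule finite_surj)
  show "finite (vecs {..m})" by (rule finite_vecs) simp
  show "polys m \<subseteq> (\<lambda>w. \<Sum>i\<le>m. monom (w i) i) ` vecs {..m}"
  proof
    fix f assume f: "f \<in> polys m"
    hence "f = (\<Sum>i\<le>m. monom (restrict (coeff f) {..m} i) i)"
      using poly_as_sum_of_monoms[of f] by (simp add: polys_def)
    moreover have "restrict (coeff f) {..m} \<in> vecs {..m}" using f by (simp add: polys_def)
    ultimately show "f \<in> (\<lambda>w. \<Sum>i\<le>m. monom (w i) i) ` vecs {..m}" by blast
  qed
qed

text \<open>Filling the empty \<open>i\<close>-th coefficient with each of the \<open>card K\<close>
  values gives distinct polynomials; \<open>i < m\<close> keeps the degree.\<close>

lemma card_coeff_zero_le: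
  assumes "i < m"
  shows "card {f \<in> polys m. coeff f i = 0} * card K \<le> card (polys m)"
proof -
  have "card ({f \<in> polys m. coeff f i = 0} \<times> K) \<le> card (polys m)"
  proof (rule card_inj_on_le[of "\<lambda>(f, x). f + monom x i"])
    show "inj_on (\<lambda>(f, x). f + monom x i) ({f \<in> polys m. coeff f i = 0} \<times> K)"
    proof (rule inj_onI, clarify)
      fix f f' :: "'k poly" and x x' :: 'k assume *: "coeff f i = 0" "coeff f' i = 0" "f + monom x i = f' + monom x' i"
      have "coeff (f + monom x i) i = coeff (f' + monom x' i) i" by (simp only: *(3))
      hence "x = x'" using *(1,2) by simp
      thus "f = f' \<and> x = x'" using *(3) by simp
    qed
    show "(\<lambda>(f, x). f + monom x i) ` ({f \<in> polys m. coeff f i = 0} \<times> K) \<subseteq> polys m"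
    proof (clarify)
      fix f x assume f: "f \<in> polys m" "x \<in> K"
      have "Polynomial.degree (monom x i) < Polynomial.degree f"
        using f assms degree_monom_le[of x i] by (simp add: polys_def)
      hence "Polynomial.degree (f + monom x i) = m" using f by (simp add: polys_def degree_add_eq_left)
      thus "f + monom x i \<in> polys m" using f by (auto simp: polys_def intro!: add_K)
    qed
  qed (rule finite_polys)
  thus ?thesis by (simp add: card_cartesian_product)
qed

lemma card_polys_pos: "card (polys m) > 0"
proof -
  have "monom 1 m \<in> polys m" by (auto simp: polys_def degree_monom_eq)
  thus ?thesis using finite_polys card_gt_0_iff by blast
qed

text \<open>Translations by \<open>shift x\<close> are involutions of the set \<Omega> of
  polynomials with nonzero coefficient at \<open>4 * d + 3\<close>. Averaging over them turns the
  bound for fixed \<open>B\<close> and varying \<open>x\<close> into a bound for varying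
  \<open>f\<close>; the extra 1 accounts for the polynomials outside \<Omega>.\<close>

lemma card_not_uniform_le:
  assumes d: "odd d" and m: "4 * d + 3 \<le> m" "m \<le> 4 * d + 6" and q: "large_order d"
  shows "real (card {f \<in> polys m. \<not> uniform_4 d f}) * real (card K)
    \<le> (1 + 16 * real d * (16 * real d) ^ d) * real (card (polys m))"
proof -
  define C where "C = 16 * real d * (16 * real d) ^ d"
  define \<Omega> where "\<Omega> = {f \<in> polys m. coeff f (4 * d + 3) \<noteq> 0}"
  define bad where "bad f \<longleftrightarrow> \<not> uniform_4 d f" for f
  define shift where "shift x = [:0, 1:] * pcompose (polyS d x) (Vp 1)" for x
  have fin_\<Omega>: "finite \<Omega>" unfolding \<Omega>_def using finite_polys[of m] by simp
  have shift_high: "coeff (shift x) i = 0" if "i \<ge> 4 * d + 3" for x i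
  proof -
    have "Polynomial.degree (polyS d x) \<le> 2 * d"
      by (rule degree_le) (auto simp: coeff_polyS dest: S_le)
    hence "Polynomial.degree (pcompose (polyS d x) (Vp 1)) \<le> 4 * d"
      by (simp add: degree_pcompose degree_Vp)
    thus ?thesis using that by (cases i) (auto simp: shift_def coeff_eq_0)
  qed
  have shift_K: "coeff (shift x) i \<in> K" if "x \<in> vecs (S d)" for x i
  proof -
    have "coeff (pcompose (polyS d x) (Vp 1)) j \<in> K" for j
      using that by (auto simp: polyS_def pcompose_sum pcompose_monom coeff_sum intro!: K_intros coeff_Vp_power_K)
    thus ?thesis by (cases i) (auto simp: shift_def)
  qed
  have closed: "f + shift x \<in> \<Omega>" if "f \<in> \<Omega>" "x \<in> vecs (S d)" for f x
  proof -
    have "coeff (f + shift x) (4 * d + 3) \<noteq> 0" using that shift_high by (simp add: \<Omega>_def)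
    moreover have "Polynomial.degree (f + shift x) = m"
    proof (rule antisym)
      show "Polynomial.degree (f + shift x) \<le> m"
        by (rule degree_le) (use that m shift_high in \<open>auto simp: \<Omega>_def polys_def coeff_eq_0\<close>)
      have "coeff f m \<noteq> 0" using that m by (auto simp: \<Omega>_def polys_def)
      thus "m \<le> Polynomial.degree (f + shift x)"
        using m shift_high by (intro le_degree) simp
    qed
    ultimately show ?thesis using that shift_K by (auto simp: \<Omega>_def polys_def intro!: add_K)
  qed
  have invol: "f + shift x + shift x = f" for f x
    by (simp add: add.assoc add_self_poly)
  have card_shift: "card {f \<in> \<Omega>. bad (f + shift x)} = card {f \<in> \<Omega>. bad f}" if "x \<in> vecs (S d)" for x
  proof (rule bij_betw_same_card)
    show "bij_betw (\<lambda>f. f + shift x) {f \<in> \<Omega>. bad (f + shift x)} {f \<in> \<Omega>. bad f}"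
      by (rule bij_betwI[where g = "\<lambda>f. f + shift x"]) (use that in \<open>auto simp: closed invol\<close>)
  qed
  have fiber: "real (card {x \<in> vecs (S d). bad (f + shift x)}) * real (card K) \<le> C * real (card (vecs (S d)))"
    if f: "f \<in> \<Omega>" for f
  proof -
    have fK: "coeff f i \<in> K" for i using f by (simp add: \<Omega>_def polys_def)
    have "Polynomial.degree f \<le> 2 * (2 * d + 3)" using f m by (simp add: \<Omega>_def polys_def)
    from decompose[OF fK this] obtain P B where PB: "\<And>i. coeff P i \<in> K" "\<And>i. coeff B i \<in> K"
      "Polynomial.degree P \<le> 2 * d + 3" "\<And>j. 2 * d + 3 \<le> j \<Longrightarrow> coeff B j = 0"
      "f = pcompose P (Vp 1) + [:0, 1:] * pcompose B (Vp 1)" by blast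
    have lead: "coeff B (2 * d + 1) \<noteq> 0"
      using coeff_decomposed[OF d PB(3-5)] f unfolding \<Omega>_def by auto
    have deg_B: "Polynomial.degree B \<le> 2 * d + 2" by (rule degree_le) (use PB(4) in auto)
    have sub: "{x \<in> vecs (S d). bad (f + shift x)}
        \<subseteq> {x \<in> vecs (S d). \<not> (\<exists>a\<in>H - {0}. splits d a (coeff B (2 * d + 1)) (B + polyS d x))}"
    proof (intro subsetI CollectI conjI notI)
      fix x assume "x \<in> {x \<in> vecs (S d). bad (f + shift x)}"
      hence x: "x \<in> vecs (S d)" "bad (f + shift x)" by auto
      thus "x \<in> vecs (S d)" by blast
      assume "\<exists>a\<in>H - {0}. splits d a (coeff B (2 * d + 1)) (B + polyS d x)"
      then obtain a where a: "a \<in> H" "a \<noteq> 0" "splits d a (coeff B (2 * d + 1)) (B + polyS d x)"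
        by blast
      have eq: "f + shift x = pcompose P (Vp 1) + [:0, 1:] * pcompose (B + polyS d x) (Vp 1)"
        unfolding PB(5) shift_def pcompose_add distrib_left by (simp only: add.assoc)
      obtain \<tau> where \<tau>: "\<tau> \<in> K" "\<tau> \<noteq> 0" "\<tau> \<noteq> 1" "card {y \<in> K. D2 (f + shift x) 1 \<tau> y = 0} = 4 * d"
        using card_D2_splits[OF eq a(1,2) lead a(3)] by blast
      have g: "f + shift x \<in> \<Omega>" by (rule closed[OF f x(1)])
      have "card {y \<in> K. D2 (f + shift x) \<alpha> \<alpha>' y = \<beta>} \<le> 4 * d"
        if "\<alpha> \<in> K - {0}" "\<alpha>' \<in> K - {0}" "\<alpha> \<noteq> \<alpha>'" for \<alpha> \<alpha>' \<beta>
        by (rule card_D2_le[OF d]) (use g m that in \<open>auto simp: \<Omega>_def polys_def\<close>)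
      moreover have "\<exists>\<alpha>\<in>K - {0}. \<exists>\<alpha>'\<in>K - {0}. \<alpha> \<noteq> \<alpha>' \<and> (\<exists>\<beta>\<in>K. card {y \<in> K. D2 (f + shift x) \<alpha> \<alpha>' y = \<beta>} = 4 * d)"
        using \<tau> by (intro bexI[of _ 1] bexI[of _ \<tau>] conjI bexI[of _ 0]) auto
      ultimately have "uniform_4 d (f + shift x)" unfolding uniform_4_def by blast
      thus False using x(2) by (simp add: bad_def)
    qed
    have "real (card {x \<in> vecs (S d). bad (f + shift x)})
        \<le> real (card {x \<in> vecs (S d). \<not> (\<exists>a\<in>H - {0}. splits d a (coeff B (2 * d + 1)) (B + polyS d x))})"
      using card_mono[OF _ sub] finite_vecs[OF finite_S] by simp
    from mult_right_mono[OF this, of "real (card K)"] show ?thesis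
      using card_no_splits_le[OF d PB(2) deg_B lead q] by (simp add: C_def)
  qed
  define v where "v = real (card (vecs (S d)))"
  have v: "v > 0" by (simp add: v_def card_PiE finite_S) (use card_K_ge_2 in auto)
  have fin_v: "finite (vecs (S d))" by (rule finite_vecs[OF finite_S])
  have "v * real (card {f \<in> \<Omega>. bad f}) = (\<Sum>x\<in>vecs (S d). real (card {f \<in> \<Omega>. bad (f + shift x)}))"
    by (simp add: card_shift v_def)
  also have "\<dots> = (\<Sum>x\<in>vecs (S d). \<Sum>f\<in>\<Omega>. if bad (f + shift x) then 1 else 0)"
    using fin_\<Omega> by (simp add: sum.inter_filter [symmetric])
  also have "\<dots> = (\<Sum>f\<in>\<Omega>. \<Sum>x\<in>vecs (S d). if bad (f + shift x) then 1 else 0)"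
    by (rule sum.swap)
  also have "\<dots> = (\<Sum>f\<in>\<Omega>. real (card {x \<in> vecs (S d). bad (f + shift x)}))"
    using fin_v by (simp add: sum.inter_filter [symmetric])
  finally have "v * real (card {f \<in> \<Omega>. bad f}) * real (card K)
      = (\<Sum>f\<in>\<Omega>. real (card {x \<in> vecs (S d). bad (f + shift x)}) * real (card K))"
    by (simp add: sum_distrib_right)
  also have "\<dots> \<le> (\<Sum>f\<in>\<Omega>. C * v)" unfolding v_def by (rule sum_mono) (rule fiber)
  finally have "v * (real (card {f \<in> \<Omega>. bad f}) * real (card K)) \<le> v * (C * real (card \<Omega>))"
    by (simp add: mult_ac)
  hence 1: "real (card {f \<in> \<Omega>. bad f}) * real (card K) \<le> C * real (card \<Omega>)"
    using v by simp
  have "C \<ge> 0" by (simp add: C_def)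
  moreover have "card \<Omega> \<le> card (polys m)"
    by (rule card_mono[OF finite_polys]) (auto simp: \<Omega>_def)
  ultimately have 2: "C * real (card \<Omega>) \<le> C * real (card (polys m))" by (simp add: mult_left_mono)
  let ?Z = "{f \<in> polys m. coeff f (4 * d + 3) = 0}"
  have 3: "real (card ?Z) * real (card K) \<le> real (card (polys m))"
  \<comment> \<open>For \<open>m = 4 * d + 3\<close> the coefficient in question is the leading
    one.\<close>
  proof (cases "m = 4 * d + 3")
    case True
    have "coeff f m \<noteq> 0" if "Polynomial.degree f = m" for f :: "'k poly"
      using that True by (metis add_is_0 degree_0 leading_coeff_0_iff zero_neq_numeral)
    hence Z: "?Z = {}" using True by (auto simp: polys_def)
    show ?thesis unfolding Z by simp
  next
    case False
    thus ?thesis using card_coeff_zero_le[of "4 * d + 3" m] m by (simp flip: of_nat_mult)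
  qed
  have "{f \<in> polys m. \<not> uniform_4 d f} \<subseteq> {f \<in> \<Omega>. bad f} \<union> ?Z" by (auto simp: \<Omega>_def bad_def)
  hence "card {f \<in> polys m. \<not> uniform_4 d f} \<le> card ({f \<in> \<Omega>. bad f} \<union> ?Z)"
    by (rule card_mono[rotated]) (use fin_\<Omega> finite_polys[of m] in auto)
  also have "\<dots> \<le> card {f \<in> \<Omega>. bad f} + card ?Z" by (rule card_Un_le)
  finally have "real (card {f \<in> polys m. \<not> uniform_4 d f}) * real (card K)
      \<le> (real (card {f \<in> \<Omega>. bad f}) + real (card ?Z)) * real (card K)"
    by (intro mult_right_mono) auto
  also have "\<dots> \<le> C * real (card (polys m)) + real (card (polys m))"
    using 1 2 3 by (simp add: distrib_right)
  finally show ?thesis by (simp add: C_def algebra_simps)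
qed

end

section \<open>Embedding into an algebraic closure\<close>

locale finite_field_two_power = field R for R :: "('a, 'b) ring_scheme" (structure) +
  fixes n :: nat
  assumes order_R: "Coset.order R = 2 ^ n"
begin

lemma finite_carrier: "finite (carrier R)"
  using order_R by (metis card.infinite Coset.order_def power_not_zero zero_neq_numeral)

text \<open>The multiple \<open>2^n\<close> of the unit vanishes because the additive group has that
  order, and it equals \<open>(1 + 1)^n\<close>; a field has no nonzero nilpotents.\<close>

lemma one_add_one: "\<one> \<oplus> \<one> = \<zero>"
proof -
  define t where "t = \<one> \<oplus> \<one>"
  have t: "t \<in> carrier R" by (simp add: t_def)
  have *: "[(2 ^ k :: nat)] \<cdot> \<one> = t [^] k" for k
  proof (induction k)
    case (Suc k)
    have "[(2 ^ Suc k :: nat)] \<cdot> \<one> = [(2 ^ k :: nat)] \<cdot> \<one> \<oplus> [(2 ^ k :: nat)] \<cdot> \<one>"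
      by (simp add: add.nat_pow_mult mult_2)
    also have "\<dots> = ([(2 ^ k :: nat)] \<cdot> \<one>) \<otimes> t"
      by (simp add: t_def r_distr)
    finally show ?case using Suc t by simp
  qed simp
  have "[(2 ^ n :: nat)] \<cdot> \<one> = \<zero>"
    using group.pow_order_eq_1[OF a_group, of \<one>] order_R by (simp add: Coset.order_def add_pow_def)
  hence "t [^] n = \<zero>" using * by simp
  moreover have "t [^] k \<noteq> \<zero>" if "t \<noteq> \<zero>" for k :: nat
    by (induction k) (use t that integral in auto)
  ultimately show ?thesis by (auto simp: t_def)
qed

lemma double_eq_zero: "x \<in> carrier R \<Longrightarrow> x \<oplus> x = \<zero>"
  using r_distr[of \<one> \<one> x] by (simp add: one_add_one)

definition of_bit :: "bit \<Rightarrow> 'a" where "of_bit c = (if c = 0 then \<zero> else \<one>)"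

lemma of_bit_closed [simp]: "of_bit c \<in> carrier R" by (simp add: of_bit_def)

lemma of_bit_add: "of_bit (c + d) = of_bit c \<oplus> of_bit d"
  by (cases c; cases d) (auto simp: of_bit_def one_add_one)

text \<open>Evaluation at \<open>g\<close> by Horner's scheme, with \<open>bit\<close> as prime
  field; built by hand because the target is a ring record and not a type.\<close>

definition ev :: "'a \<Rightarrow> bit poly \<Rightarrow> 'a" where
  "ev g p = fold_coeffs (\<lambda>c r. of_bit c \<oplus> g \<otimes> r) p \<zero>"

lemma ev_0 [simp]: "ev g 0 = \<zero>" by (simp add: ev_def)

lemma ev_pCons: "g \<in> carrier R \<Longrightarrow> ev g (pCons c p) = of_bit c \<oplus> g \<otimes> ev g p"
  by (cases "p = 0"; cases "c = 0") (auto simp: ev_def of_bit_def)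

lemma ev_closed: "g \<in> carrier R \<Longrightarrow> ev g p \<in> carrier R"
  by (induction p) (auto simp: ev_pCons)

lemma ev_add: "g \<in> carrier R \<Longrightarrow> ev g (p + q) = ev g p \<oplus> ev g q"
proof (induction p arbitrary: q)
  case (pCons c p)
  obtain d r where q: "q = pCons d r" by (cases q) auto
  show ?case
    using pCons ev_closed[OF pCons.prems, of p] ev_closed[OF pCons.prems, of r]
    by (simp add: q ev_pCons of_bit_add r_distr a_ac del: add_bit_eq_xor)
qed (simp add: ev_closed)

lemma ev_smult: "g \<in> carrier R \<Longrightarrow> ev g (smult c p) = of_bit c \<otimes> ev g p"
  using ev_closed[of g p] by (cases c) (auto simp: of_bit_def)

lemma ev_mult: "g \<in> carrier R \<Longrightarrow> ev g (p * q) = ev g p \<otimes> ev g q"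
proof (induction p)
  case (pCons c p)
  show ?case
    using pCons ev_closed[OF pCons.prems, of p] ev_closed[OF pCons.prems, of q]
    by (simp add: mult_pCons_left ev_add ev_smult ev_pCons l_distr m_assoc of_bit_def)
qed (simp add: ev_closed)

lemma ev_monom: "g \<in> carrier R \<Longrightarrow> ev g (Polynomial.monom 1 i) = g [^] i"
  by (induction i) (simp_all add: monom_0 monom_Suc ev_pCons of_bit_def m_comm)

text \<open>The field is \<open>\<F>\<^sub>2[g]\<close> for a generator \<open>g\<close> of its multiplicative group, so a field
  embedding is determined by sending \<open>g\<close> to a root of its minimal polynomial.\<close>

lemma obtain_embedding:
  obtains \<phi> :: "'a \<Rightarrow> bit alg_closure"
  where "inj_on \<phi> (carrier R)" "\<phi> \<zero> = 0" "\<phi> \<one> = 1"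
    "\<And>x y. x \<in> carrier R \<Longrightarrow> y \<in> carrier R \<Longrightarrow> \<phi> (x \<oplus> y) = \<phi> x + \<phi> y"
    "\<And>x y. x \<in> carrier R \<Longrightarrow> y \<in> carrier R \<Longrightarrow> \<phi> (x \<otimes> y) = \<phi> x * \<phi> y"
proof -
  obtain g where g: "g \<in> carrier (Multiplicative_Group.mult_of R)" "carrier (Multiplicative_Group.mult_of R) = {g [^] i | i :: nat. i \<in> UNIV}"
    by (rule bexE[OF finite_field_mult_group_has_gen[OF finite_carrier]])
  have gR: "g \<in> carrier R" using g by simp
  have surj: "\<exists>p. ev g p = x" if "x \<in> carrier R" for x
  proof (cases "x = \<zero>")
    case True
    thus ?thesis by (intro exI[of _ 0]) simp
  next
    case False
    hence "x \<in> carrier (Multiplicative_Group.mult_of R)" using that by simp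
    then obtain i :: nat where "x = g [^] i" using g(2) by blast
    thus ?thesis using ev_monom[OF gR] by blast
  qed
  have "\<exists>p. p \<noteq> 0 \<and> ev g p = \<zero>"
  proof -
    \<comment> \<open>Finiteness forces two equal powers of \<open>g\<close>, and the sum of the two
      monomials is a nonzero relation.\<close>
    have "\<not> inj (\<lambda>i. g [^] (i :: nat))"
      using finite_carrier range_inj_infinite[of "\<lambda>i. g [^] (i :: nat)"] gR finite_subset[of "range (\<lambda>i. g [^] (i :: nat))" "carrier R"]
      by (auto simp: nat_pow_closed)
    then obtain i j :: nat where ij: "i \<noteq> j" "g [^] i = g [^] j" by (auto simp: inj_def)
    have "ev g (Polynomial.monom 1 i + Polynomial.monom 1 j) = \<zero>"
      using gR double_eq_zero[of "g [^] j"] ij(2) by (simp add: ev_add ev_monom)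
    moreover have "Polynomial.monom 1 i + Polynomial.monom 1 j \<noteq> (0 :: bit poly)"
    proof
      assume "Polynomial.monom 1 i + Polynomial.monom 1 j = (0 :: bit poly)"
      hence "Polynomial.coeff (Polynomial.monom 1 i + Polynomial.monom 1 j) i = (0 :: bit)" by (simp only: coeff_0)
      thus False using ij(1) by simp
    qed
    ultimately show ?thesis by blast
  qed
  then obtain P where P: "P \<noteq> 0" "ev g P = \<zero>"
    and P_min: "\<And>Q. Q \<noteq> 0 \<Longrightarrow> ev g Q = \<zero> \<Longrightarrow> Polynomial.degree P \<le> Polynomial.degree Q"
    using ex_has_least_nat[of "\<lambda>p. p \<noteq> 0 \<and> ev g p = \<zero>" _ Polynomial.degree] by blast
  have P_dvd: "P dvd Q" if "ev g Q = \<zero>" for Q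
  proof (rule ccontr)
    assume *: "\<not> P dvd Q"
    have "ev g Q = ev g (Q div P * P + Q mod P)" by simp
    also have "\<dots> = ev g (Q mod P)"
      using gR by (simp only: ev_add ev_mult P) (simp add: ev_closed)
    finally have "ev g (Q mod P) = \<zero>" using that by simp
    moreover have "Q mod P \<noteq> 0" using * by (simp add: mod_eq_0_iff_dvd)
    ultimately show False using P_min[of "Q mod P"] degree_mod_less_degree[OF P(1) *] by simp
  qed
  have "Polynomial.degree P > 0"
  proof (rule ccontr)
    assume "\<not> Polynomial.degree P > 0"
    then obtain c where c: "P = [:c:]" using degree_eq_zeroE by blast
    hence "c \<noteq> 0" using P by simp
    hence "ev g P = \<one>" using gR c by (simp add: ev_pCons of_bit_def)
    thus False using P by simp
  qed
  define emb where "emb p = map_poly to_ac p" for p :: "bit poly"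
  have emb_add: "emb (p + q) = emb p + emb q" for p q
    by (rule poly_eqI) (simp add: emb_def coeff_map_poly del: add_bit_eq_xor)
  have emb_mult: "emb (p * q) = emb p * emb q" for p q
    by (rule poly_eqI) (simp add: emb_def coeff_map_poly coeff_mult to_ac_sum del: mult_bit_eq_and)
  have "Polynomial.degree (emb P) > 0"
    using \<open>Polynomial.degree P > 0\<close> by (simp add: emb_def degree_map_poly)
  then obtain \<zeta> where \<zeta>: "poly (emb P) \<zeta> = 0" using alg_closed_imp_poly_has_root by blast
  define \<epsilon> where "\<epsilon> p = poly (emb p) \<zeta>" for p
  have \<epsilon>_0: "\<epsilon> Q = 0" if Q: "ev g Q = \<zero>" for Q
  proof -
    obtain T where "Q = P * T" by (rule dvdE[OF P_dvd[OF Q]])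
    thus ?thesis by (simp add: \<epsilon>_def emb_mult \<zeta>)
  qed
  have \<epsilon>_add: "\<epsilon> (p + q) = \<epsilon> p + \<epsilon> q" for p q by (simp add: \<epsilon>_def emb_add)
  have \<epsilon>_cong: "\<epsilon> p = \<epsilon> q" if "ev g p = ev g q" for p q
  proof -
    have "ev g (p + q) = \<zero>" using that double_eq_zero[OF ev_closed[OF gR, of q]] gR by (simp add: ev_add)
    hence "\<epsilon> p + \<epsilon> q = 0" using \<epsilon>_0[of "p + q"] \<epsilon>_add[of p q] by metis
    moreover have "ev g (q + q) = \<zero>"
      by (simp only: ev_add[OF gR] double_eq_zero[OF ev_closed[OF gR]])
    hence "\<epsilon> q + \<epsilon> q = 0" using \<epsilon>_0[of "q + q"] \<epsilon>_add[of q q] by metis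
    ultimately show ?thesis by (metis add_right_cancel)
  qed
  \<comment> \<open>The choice of a representing polynomial is immaterial by
    \<open>\<epsilon>_cong\<close>.\<close>
  define \<phi> where "\<phi> x = \<epsilon> (SOME p. ev g p = x)" for x
  have \<phi>: "\<phi> (ev g p) = \<epsilon> p" for p
    unfolding \<phi>_def by (rule \<epsilon>_cong, rule someI[of "\<lambda>q. ev g q = ev g p" p]) simp
  have \<phi>_add: "\<phi> (x \<oplus> y) = \<phi> x + \<phi> y" if "x \<in> carrier R" "y \<in> carrier R" for x y
  proof -
    from surj[OF that(1)] surj[OF that(2)] obtain p q where pq: "ev g p = x" "ev g q = y" by auto
    have "\<phi> (ev g (p + q)) = \<phi> (ev g p) + \<phi> (ev g q)" unfolding \<phi> by (rule \<epsilon>_add)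
    thus ?thesis unfolding ev_add[OF gR] pq .
  qed
  have \<phi>_mult: "\<phi> (x \<otimes> y) = \<phi> x * \<phi> y" if "x \<in> carrier R" "y \<in> carrier R" for x y
  proof -
    from surj[OF that(1)] surj[OF that(2)] obtain p q where pq: "ev g p = x" "ev g q = y" by auto
    have "\<phi> (ev g (p * q)) = \<phi> (ev g p) * \<phi> (ev g q)" unfolding \<phi> by (simp add: \<epsilon>_def emb_mult)
    thus ?thesis unfolding ev_mult[OF gR] pq .
  qed
  have \<phi>_0: "\<phi> \<zero> = 0" using \<phi>[of 0] by (simp add: \<epsilon>_def emb_def)
  have \<phi>_1: "\<phi> \<one> = 1"
  proof -
    have "ev g 1 = \<one>" using gR by (simp add: one_pCons ev_pCons of_bit_def)
    moreover have "\<epsilon> 1 = 1" by (simp add: \<epsilon>_def emb_def)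
    ultimately show ?thesis using \<phi>[of 1] by simp
  qed
  \<comment> \<open>A nonzero difference is a unit, and units cannot map to 0.\<close>
  have "inj_on \<phi> (carrier R)"
  proof (rule inj_onI)
    fix x y assume xy: "x \<in> carrier R" "y \<in> carrier R" "\<phi> x = \<phi> y"
    show "x = y"
    proof (rule ccontr)
      assume "x \<noteq> y"
      hence nz: "x \<ominus> y \<in> Units R" using xy by (simp add: field_Units)
      have "\<phi> x = \<phi> ((x \<ominus> y) \<oplus> y)" using xy by (simp add: minus_eq a_assoc l_neg)
      hence "\<phi> (x \<ominus> y) = 0" using xy by (simp add: \<phi>_add)
      moreover have "\<phi> (x \<ominus> y) * \<phi> (inv (x \<ominus> y)) = 1"
        using nz \<phi>_mult[of "x \<ominus> y" "inv (x \<ominus> y)"] xy \<phi>_1 by simp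
      ultimately show False by simp
    qed
  qed
  thus ?thesis using that[of \<phi>] \<phi>_0 \<phi>_1 \<phi>_add \<phi>_mult by blast
qed

end

section \<open>Transfer to coefficient lists over the carrier\<close>

locale embedded_field = finite_field_two_power R n for R :: "('a, 'b) ring_scheme" (structure) and n +
  fixes \<phi> :: "'a \<Rightarrow> 'k::field"
  assumes inj: "inj_on \<phi> (carrier R)"
    and \<phi>_0: "\<phi> \<zero> = 0" and \<phi>_1: "\<phi> \<one> = 1"
    and \<phi>_add: "x \<in> carrier R \<Longrightarrow> y \<in> carrier R \<Longrightarrow> \<phi> (x \<oplus> y) = \<phi> x + \<phi> y"
    and \<phi>_mult: "x \<in> carrier R \<Longrightarrow> y \<in> carrier R \<Longrightarrow> \<phi> (x \<otimes> y) = \<phi> x * \<phi> y"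
begin

lemma double_eq_0: "\<phi> x + \<phi> x = 0" if "x \<in> carrier R"
  using that by (simp add: double_eq_zero \<phi>_0 flip: \<phi>_add)

sublocale im: binary_subfield "\<phi> ` carrier R"
proof
  show "finite (\<phi> ` carrier R)" using finite_carrier by simp
  show "0 \<in> \<phi> ` carrier R" using \<phi>_0 by (metis imageI zero_closed)
  show "1 \<in> \<phi> ` carrier R" using \<phi>_1 by (metis imageI one_closed)
  show "x + y \<in> \<phi> ` carrier R" if "x \<in> \<phi> ` carrier R" "y \<in> \<phi> ` carrier R" for x y
    using that by (auto simp flip: \<phi>_add)
  show "x * y \<in> \<phi> ` carrier R" if "x \<in> \<phi> ` carrier R" "y \<in> \<phi> ` carrier R" for x y
    using that by (auto simp flip: \<phi>_mult)
  show "- x \<in> \<phi> ` carrier R" if "x \<in> \<phi> ` carrier R" for x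
  proof -
    have "x + x = 0" using that double_eq_0 by blast
    hence "- x = x" by (simp only: neg_eq_iff_add_eq_0)
    thus ?thesis using that by (simp only:)
  qed
  show "inverse x \<in> \<phi> ` carrier R" if x: "x \<in> \<phi> ` carrier R" for x
  proof (cases "x = 0")
    case False
    then obtain y where y: "y \<in> carrier R" "x = \<phi> y" "y \<noteq> \<zero>" using x \<phi>_0 by auto
    hence "y \<in> Units R" by (simp add: field_Units)
    hence "x * \<phi> (inv y) = 1" "inv y \<in> carrier R" using y \<phi>_1 by (auto simp flip: \<phi>_mult)
    thus ?thesis using False by (metis imageI inverse_unique)
  qed (use x in simp)
  show "(1 :: 'k) + 1 = 0" using double_eq_0[of \<one>] by (simp add: \<phi>_1)
qed

lemma card_im: "card (\<phi> ` carrier R) = 2 ^ n"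
  using order_R by (simp add: card_image[OF inj] Coset.order_def)

text \<open>The reversal is due to conventions: the lists start with the leading coefficient,
  \<open>Poly\<close> with the constant one.\<close>

definition to_poly :: "'a list \<Rightarrow> 'k poly" where "to_poly f = Poly (rev (map \<phi> f))"

lemma \<phi>_pow: "x \<in> carrier R \<Longrightarrow> \<phi> (x [^] (k :: nat)) = \<phi> x ^ k"
  by (induction k) (simp_all add: \<phi>_1 \<phi>_mult)

lemma \<phi>_eval:
  assumes "set f \<subseteq> carrier R" "x \<in> carrier R"
  shows "\<phi> (eval f x) = poly (to_poly f) (\<phi> x)"
  using assms
proof (induction f)
  case (Cons c f)
  have "eval f x \<in> carrier R" using Cons.prems by (intro eval_in_carrier) auto
  thus ?case using Cons
    by (simp add: to_poly_def Poly_snoc poly_monom \<phi>_add \<phi>_mult \<phi>_pow)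
qed (simp add: to_poly_def \<phi>_0)

lemma \<phi>_second_deriv:
  assumes f: "set f \<subseteq> carrier R" and x: "x \<in> carrier R" "\<alpha> \<in> carrier R" "\<alpha>' \<in> carrier R"
  shows "\<phi> (second_deriv R \<alpha> \<alpha>' f x) = im.D2 (to_poly f) (\<phi> \<alpha>) (\<phi> \<alpha>') (\<phi> x)"
  using eval_in_carrier[OF f] x f
  by (simp add: second_deriv_def im.D2_def \<phi>_add \<phi>_eval)

lemma second_deriv_closed:
  assumes f: "set f \<subseteq> carrier R" and x: "x \<in> carrier R" "\<alpha> \<in> carrier R" "\<alpha>' \<in> carrier R"
  shows "second_deriv R \<alpha> \<alpha>' f x \<in> carrier R"
  using eval_in_carrier[OF f] x by (simp add: second_deriv_def)

lemma card_second_deriv: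
  assumes f: "set f \<subseteq> carrier R" and \<alpha>: "\<alpha> \<in> carrier R" "\<alpha>' \<in> carrier R" "\<beta> \<in> carrier R"
  shows "card {x \<in> carrier R. second_deriv R \<alpha> \<alpha>' f x = \<beta>}
    = card {x \<in> \<phi> ` carrier R. im.D2 (to_poly f) (\<phi> \<alpha>) (\<phi> \<alpha>') x = \<phi> \<beta>}"
proof -
  have iff: "second_deriv R \<alpha> \<alpha>' f x = \<beta> \<longleftrightarrow> im.D2 (to_poly f) (\<phi> \<alpha>) (\<phi> \<alpha>') (\<phi> x) = \<phi> \<beta>"
    if "x \<in> carrier R" for x
    using inj_on_eq_iff[OF inj second_deriv_closed[OF f that \<alpha>(1,2)] \<alpha>(3)]
      \<phi>_second_deriv[OF f that \<alpha>(1,2)] by simp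
  have "{x \<in> \<phi> ` carrier R. im.D2 (to_poly f) (\<phi> \<alpha>) (\<phi> \<alpha>') x = \<phi> \<beta>}
      = \<phi> ` {x \<in> carrier R. second_deriv R \<alpha> \<alpha>' f x = \<beta>}"
    using iff by auto
  moreover have "inj_on \<phi> {x \<in> carrier R. second_deriv R \<alpha> \<alpha>' f x = \<beta>}"
    by (rule inj_on_subset[OF inj]) auto
  ultimately show ?thesis by (simp add: card_image)
qed

text \<open>\<open>im.uniform_4\<close> supplies an attained value, so the maximum is over a
  nonempty set; the bound \<open>4 * d\<close> makes that set finite.\<close>

lemma second_diff_uniformity_eq:
  assumes f: "set f \<subseteq> carrier R" and u: "im.uniform_4 d (to_poly f)"
  shows "second_diff_uniformity R f = 4 * d"
  unfolding second_diff_uniformity_def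
proof (rule Max_eqI)
  let ?M = "{card {x \<in> carrier R. second_deriv R \<alpha> \<alpha>' f x = \<beta>} | \<alpha> \<alpha>' \<beta>.
            \<alpha> \<in> carrier R - {\<zero>} \<and> \<alpha>' \<in> carrier R - {\<zero>} \<and> \<alpha> \<noteq> \<alpha>' \<and> \<beta> \<in> carrier R}"
  have nz: "\<phi> x \<noteq> 0" if "x \<in> carrier R - {\<zero>}" for x
    using that inj_on_eq_iff[OF inj, of x \<zero>] \<phi>_0 by auto
  show le: "k \<le> 4 * d" if "k \<in> ?M" for k
  proof -
    from that obtain \<alpha> \<alpha>' \<beta> where *: "\<alpha> \<in> carrier R - {\<zero>}" "\<alpha>' \<in> carrier R - {\<zero>}" "\<alpha> \<noteq> \<alpha>'" "\<beta> \<in> carrier R"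
      and k: "k = card {x \<in> carrier R. second_deriv R \<alpha> \<alpha>' f x = \<beta>}" by auto
    have "\<phi> \<alpha> \<noteq> \<phi> \<alpha>'" using * inj_on_eq_iff[OF inj, of \<alpha> \<alpha>'] by auto
    thus ?thesis
      using u * nz[of \<alpha>] nz[of \<alpha>'] unfolding k im.uniform_4_def by (simp add: card_second_deriv f)
  qed
  show "finite ?M" by (rule finite_subset[of _ "{..4 * d}"]) (use le in auto)
  from u obtain a a' b where *: "a \<in> \<phi> ` carrier R - {0}" "a' \<in> \<phi> ` carrier R - {0}" "a \<noteq> a'" "b \<in> \<phi> ` carrier R"
    "card {x \<in> \<phi> ` carrier R. im.D2 (to_poly f) a a' x = b} = 4 * d"
    unfolding im.uniform_4_def by blast
  then obtain \<alpha> \<alpha>' \<beta> where **: "\<alpha> \<in> carrier R" "\<alpha>' \<in> carrier R" "\<beta> \<in> carrier R" "a = \<phi> \<alpha>" "a' = \<phi> \<alpha>'" "b = \<phi> \<beta>"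
    by blast
  have "\<alpha> \<noteq> \<zero>" "\<alpha>' \<noteq> \<zero>" "\<alpha> \<noteq> \<alpha>'" using * ** \<phi>_0 by auto
  moreover have "4 * d = card {x \<in> carrier R. second_deriv R \<alpha> \<alpha>' f x = \<beta>}"
    using *(5) ** f by (simp add: card_second_deriv)
  ultimately show "4 * d \<in> ?M" using ** by blast
qed

text \<open>Positive \<open>m\<close> excludes the empty list, whose degree is 0 by
  truncation.\<close>

lemma polys_of_degree_iff:
  assumes "m > 0"
  shows "f \<in> polys_of_degree R m \<longleftrightarrow> set f \<subseteq> carrier R \<and> length f = Suc m \<and> hd f \<noteq> \<zero>"
  using assms by (cases f) (auto simp: polys_of_degree_def univ_poly_def polynomial_def)

lemma bij_to_poly:
  assumes "m > 0"
  shows "bij_betw to_poly (polys_of_degree R m) (im.polys m)"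
proof (rule bij_betwI[where g = "\<lambda>p. rev (map (the_inv_into (carrier R) \<phi>) (coeffs p))"])
  have coeffs: "coeffs (to_poly f) = rev (map \<phi> f)" if "f \<in> polys_of_degree R m" for f
  proof -
    from that obtain c g where f: "f = c # g" "c \<in> carrier R" "c \<noteq> \<zero>"
      unfolding polys_of_degree_iff[OF assms] by (cases f) auto
    have "\<phi> c \<noteq> 0" using f inj_on_eq_iff[OF inj, of c \<zero>] \<phi>_0 by auto
    thus ?thesis by (simp add: to_poly_def f)
  qed
  show "to_poly \<in> polys_of_degree R m \<rightarrow> im.polys m"
  proof
    fix f assume f: "f \<in> polys_of_degree R m"
    have f': "set f \<subseteq> carrier R" "length f = Suc m" using f by (auto simp: polys_of_degree_iff[OF assms])
    have "Polynomial.degree (to_poly f) = m"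
      using f' by (simp add: degree_eq_length_coeffs coeffs[OF f])
    moreover have "Polynomial.coeff (to_poly f) i \<in> \<phi> ` carrier R" for i
    proof (cases "i \<le> m")
      case True
      hence "Polynomial.coeff (to_poly f) i \<in> set (coeffs (to_poly f))"
        using f' nth_mem[of i "coeffs (to_poly f)"]
        by (simp add: coeffs[OF f] nth_default_nth flip: nth_default_coeffs_eq)
      thus ?thesis using f' by (auto simp: coeffs[OF f])
    next
      case False
      thus ?thesis using calculation by (simp add: coeff_eq_0)
    qed
    ultimately show "to_poly f \<in> im.polys m" by (simp add: im.polys_def)
  qed
  show "(\<lambda>p. rev (map (the_inv_into (carrier R) \<phi>) (coeffs p))) \<in> im.polys m \<rightarrow> polys_of_degree R m"
  proof
    fix p assume p: "p \<in> im.polys m"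
    have p0: "p \<noteq> 0" using p assms by (auto simp: im.polys_def)
    have set: "set (coeffs p) \<subseteq> \<phi> ` carrier R"
      using p by (auto simp: im.polys_def coeffs_def)
    have closed: "the_inv_into (carrier R) \<phi> y \<in> carrier R" if "y \<in> \<phi> ` carrier R" for y
      by (rule the_inv_into_into[OF inj that]) simp
    have lead: "last (coeffs p) \<in> \<phi> ` carrier R" "last (coeffs p) \<noteq> 0"
      using p p0 by (auto simp: im.polys_def last_coeffs_eq_coeff_degree)
    have "the_inv_into (carrier R) \<phi> (last (coeffs p)) \<noteq> \<zero>"
      using lead f_the_inv_into_f[OF inj lead(1)] \<phi>_0 by auto
    moreover have "hd (rev (map (the_inv_into (carrier R) \<phi>) (coeffs p)))
        = the_inv_into (carrier R) \<phi> (last (coeffs p))"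
      using p0 by (simp add: hd_rev last_map)
    moreover have "length (coeffs p) = Suc m" using p p0 by (simp add: im.polys_def length_coeffs_degree)
    ultimately show "rev (map (the_inv_into (carrier R) \<phi>) (coeffs p)) \<in> polys_of_degree R m"
      unfolding polys_of_degree_iff[OF assms] using set closed by auto
  qed
  show "rev (map (the_inv_into (carrier R) \<phi>) (coeffs (to_poly f))) = f" if "f \<in> polys_of_degree R m" for f
  proof -
    have "map (the_inv_into (carrier R) \<phi> \<circ> \<phi>) f = map (\<lambda>x. x) f"
      using that by (intro map_cong) (auto simp: polys_of_degree_iff[OF assms] the_inv_into_f_f[OF inj])
    thus ?thesis by (simp add: coeffs[OF that] rev_map)
  qed
  show "to_poly (rev (map (the_inv_into (carrier R) \<phi>) (coeffs p))) = p" if "p \<in> im.polys m" for p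
  proof -
    have "set (coeffs p) \<subseteq> \<phi> ` carrier R" using that by (auto simp: im.polys_def coeffs_def)
    hence "map (\<phi> \<circ> the_inv_into (carrier R) \<phi>) (coeffs p) = map (\<lambda>x. x) (coeffs p)"
      by (intro map_cong) (auto simp: f_the_inv_into_f[OF inj])
    thus ?thesis by (simp add: to_poly_def rev_map)
  qed
qed

lemma card_exceptional_le:
  assumes d: "odd d" and m: "4 * d + 3 \<le> m" "m \<le> 4 * d + 6" and q: "im.large_order d"
  shows "card (polys_of_degree R m) > 0"
    and "real (card {f \<in> polys_of_degree R m. second_diff_uniformity R f \<noteq> 4 * d}) * 2 ^ n
      \<le> (1 + 16 * real d * (16 * real d) ^ d) * real (card (polys_of_degree R m))"
proof -
  have m0: "m > 0" using m by simp
  note bij = bij_to_poly[OF m0]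
  have card_eq: "card (polys_of_degree R m) = card (im.polys m)" by (rule bij_betw_same_card[OF bij])
  thus "card (polys_of_degree R m) > 0" using im.card_polys_pos by simp
  have "card {f \<in> polys_of_degree R m. second_diff_uniformity R f \<noteq> 4 * d}
      \<le> card {p \<in> im.polys m. \<not> im.uniform_4 d p}"
  proof (rule card_inj_on_le[of to_poly])
    show "inj_on to_poly {f \<in> polys_of_degree R m. second_diff_uniformity R f \<noteq> 4 * d}"
      by (rule inj_on_subset[OF bij_betw_imp_inj_on[OF bij]]) auto
    show "to_poly ` {f \<in> polys_of_degree R m. second_diff_uniformity R f \<noteq> 4 * d}
        \<subseteq> {p \<in> im.polys m. \<not> im.uniform_4 d p}"
      using bij_betw_imp_surj_on[OF bij] second_diff_uniformity_eq
      by (auto simp: polys_of_degree_iff[OF m0])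
    show "finite {p \<in> im.polys m. \<not> im.uniform_4 d p}" using im.finite_polys by simp
  qed
  hence "real (card {f \<in> polys_of_degree R m. second_diff_uniformity R f \<noteq> 4 * d}) * 2 ^ n
      \<le> real (card {p \<in> im.polys m. \<not> im.uniform_4 d p}) * 2 ^ n"
    by (intro mult_right_mono) auto
  also have "\<dots> \<le> (1 + 16 * real d * (16 * real d) ^ d) * real (card (im.polys m))"
    using im.card_not_uniform_le[OF d m q] by (simp add: card_im)
  finally show "real (card {f \<in> polys_of_degree R m. second_diff_uniformity R f \<noteq> 4 * d}) * 2 ^ n
      \<le> (1 + 16 * real d * (16 * real d) ^ d) * real (card (polys_of_degree R m))"
    by (simp add: card_eq)
qed

end

section \<open>The limit over the fields of order \<open>2^n\<close>\<close>

hide_const (open) Polynomial.order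

theorem theorem7p1:
  fixes F :: "nat \<Rightarrow> ('a, 'b) ring_scheme"
    and m \<delta>\<^sub>0 :: nat
  assumes F_field: "\<And>n. n \<ge> 1 \<Longrightarrow> field (F n)"
    and F_order: "\<And>n. n \<ge> 1 \<Longrightarrow> order (F n) = 2 ^ n"
    and m_ge: "m \<ge> 7"
    and m_cases:
      "(m mod 8 = 0 \<and> \<delta>\<^sub>0 = m - 4) \<or>
       (m mod 8 = 1 \<and> \<delta>\<^sub>0 = m - 5) \<or>
       (m mod 8 = 2 \<and> \<delta>\<^sub>0 = m - 6) \<or>
       (m mod 8 = 7 \<and> \<delta>\<^sub>0 = m - 3)"
  shows "(\<lambda>n. real (card {f \<in> polys_of_degree (F n) m. second_diff_uniformity (F n) f = \<delta>\<^sub>0})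
              / real (card (polys_of_degree (F n) m))) \<longlonglongrightarrow> 1"
proof -
  obtain d where d: "odd d" "4 * d + 3 \<le> m" "m \<le> 4 * d + 6" and \<delta>: "\<delta>\<^sub>0 = 4 * d"
  proof -
    define k where "k = m div 8"
    have m: "m = 8 * k + m mod 8" by (simp add: k_def)
    show ?thesis
    \<comment> \<open>Residue 7 gives \<open>m = 4 * d + 3\<close> with
      \<open>d = 2 * k + 1\<close>. Residues 0, 1, 2 belong to the preceding block,
      \<open>d = 2 * k - 1\<close>, which exists because \<open>m \<ge> 7\<close> forces
      \<open>k \<ge> 1\<close>.\<close>
    proof (cases "m mod 8 = 7")
      case True
      thus ?thesis using that[of "2 * k + 1"] m m_cases by auto
    next
      case False
      hence "m mod 8 \<le> 2" using m_cases by auto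
      hence "k \<ge> 1" using m m_ge by linarith
      then obtain j where "k = Suc j" by (cases k) auto
      thus ?thesis using that[of "2 * j + 1"] m m_cases False by auto
    qed
  qed
  define C where "C = 1 + 16 * real d * (16 * real d) ^ d"
  define Q where "Q = 2 * (real d + 1) * (16 * real d) ^ d"
  define r where "r n = real (card {f \<in> polys_of_degree (F n) m. second_diff_uniformity (F n) f = \<delta>\<^sub>0})
              / real (card (polys_of_degree (F n) m))" for n
  have bounds: "1 - C / 2 ^ n \<le> r n \<and> r n \<le> 1" if n: "n \<ge> 1" "2 ^ n \<ge> Q" for n
  proof -
    interpret field "F n" by (rule F_field[OF n(1)])
    interpret finite_field_two_power "F n" n by unfold_locales (rule F_order[OF n(1)])
    obtain \<phi> :: "'a \<Rightarrow> bit alg_closure" where \<phi>: "inj_on \<phi> (carrier (F n))"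
      "\<phi> \<zero>\<^bsub>F n\<^esub> = 0" "\<phi> \<one>\<^bsub>F n\<^esub> = 1"
      "\<And>x y. x \<in> carrier (F n) \<Longrightarrow> y \<in> carrier (F n) \<Longrightarrow> \<phi> (x \<oplus>\<^bsub>F n\<^esub> y) = \<phi> x + \<phi> y"
      "\<And>x y. x \<in> carrier (F n) \<Longrightarrow> y \<in> carrier (F n) \<Longrightarrow> \<phi> (x \<otimes>\<^bsub>F n\<^esub> y) = \<phi> x * \<phi> y"
      by (rule obtain_embedding) blast
    interpret embedded_field "F n" n \<phi> by unfold_locales (use \<phi> in auto)
    have "im.large_order d"
      using n(2) by (simp add: im.large_order_def card_im Q_def)
    note card = card_exceptional_le[OF d this]
    define N where "N = real (card (polys_of_degree (F n) m))"
    define bad where "bad = real (card {f \<in> polys_of_degree (F n) m. second_diff_uniformity (F n) f \<noteq> 4 * d})"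
    have fin: "finite (polys_of_degree (F n) m)" using card(1) card_gt_0_iff by blast
    have N: "N > 0" using card(1) by (simp add: N_def)
    have "polys_of_degree (F n) m = {f \<in> polys_of_degree (F n) m. second_diff_uniformity (F n) f = \<delta>\<^sub>0}
        \<union> {f \<in> polys_of_degree (F n) m. second_diff_uniformity (F n) f \<noteq> 4 * d}" (is "_ = ?A \<union> ?B")
      using \<delta> by auto
    hence "card (polys_of_degree (F n) m) = card (?A \<union> ?B)" by simp
    also have "\<dots> = card ?A + card ?B"
      by (rule card_Un_disjoint) (use fin \<delta> in auto)
    finally have "real (card ?A) = N - bad" by (simp add: N_def bad_def)
    hence r: "r n = 1 - bad / N" using N by (simp add: r_def N_def[symmetric] diff_divide_distrib)
    have "bad * 2 ^ n \<le> C * N" using card(2) by (simp add: bad_def C_def N_def)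
    hence "bad / N \<le> C / 2 ^ n" using N by (simp add: field_simps)
    thus ?thesis unfolding r using N by (simp add: bad_def)
  qed
  \<comment> \<open>The bounds hold from the threshold \<open>Q\<close> on; since \<open>Q\<close>
    depends on \<open>d\<close> alone, this covers all large \<open>n\<close>.\<close>
  have large: "eventually (\<lambda>n. n \<ge> 1 \<and> 2 ^ n \<ge> Q) sequentially"
  proof -
    obtain n0 where n0: "Q < 2 ^ n0" using real_arch_pow[of 2 Q] by auto
    show ?thesis
    proof (rule eventually_sequentiallyI[of "max 1 n0"])
      fix n assume n: "max 1 n0 \<le> n"
      have "(2 :: real) ^ n0 \<le> 2 ^ n" by (rule power_increasing) (use n in auto)
      thus "n \<ge> 1 \<and> 2 ^ n \<ge> Q" using n0 n by linarith
    qed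
  qed
  have "(\<lambda>n. C / 2 ^ n) \<longlonglongrightarrow> 0"
    using tendsto_mult_right_zero[OF LIMSEQ_power_zero[of "1 / 2 :: real"], of C]
    by (simp add: power_divide)
  hence lower: "(\<lambda>n. 1 - C / 2 ^ n) \<longlonglongrightarrow> 1"
    using tendsto_diff[OF tendsto_const[of 1], of "\<lambda>n. C / 2 ^ n" 0] by simp
  have "r \<longlonglongrightarrow> 1"
    by (rule tendsto_sandwich[OF _ _ lower tendsto_const])
       (use large bounds in \<open>auto elim!: eventually_mono\<close>)
  thus ?thesis unfolding r_def .
qed

end
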